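(* Let $d\ge 1$ and let $X=(X_t)_{t\in\mathbb{R}_+^d}$ be a $d$-parameter Lévy field with jump measure $J_X$ and characteristic triplet $(\gamma,\sigma,\nu)$. Let $\Omega_X=\{\omega\in\Omega:X(\omega)\in\mathcal{S}'(\mathbb{R}^d)\}$. Then: (i) If there exists $\eta>0$ such that $\mathbb{E}(|X_{\mathbf 1_d}|^\eta)<+\infty$, then $\mathbb{P}(\Omega_X)=1$. (ii) If $\mathbb{E}(|X_{\mathbf 1_d}|^\eta)=+\infty$ for all $\eta>0$, then $\mathbb{P}(\Omega_X)=0$.
   Context: $(\Omega,\mathcal F,\mathbb P)$ is a complete probability space. $\mathbf 1_d=(1,\dots,1)\in\mathbb{R}^d$. For $s,t\in\mathbb{R}^d_+$, $s\le t$ (resp. $s<t$) means $s_i\le t_i$ (resp. $s_i<t_i$) for all $i$. For $a\le b$ in $\mathbb{R}_+^d$, $]a,b]=\{t: a<t\le b\}$, and $\Delta_a^bX=\sum_{\varepsilon\in\{0,1\}^d}(-1)^{|\varepsilon|}X_{c_\varepsilon(a,b)}$, where $|\varepsilon|=\sum_i\varepsilon_i$, $c_\varepsilon(a,b)_i=a_i$ if $\varepsilon_i=1$ and $b_i$ if $\varepsilon_i=0$. Lamp: for each of the $2^d$ relations $\mathcal R=(\mathcal R_1,\dots,\mathcal R_d)$ with $\mathcal R_i\in\{\le,>\}$, write $a\,\mathcal R\,b$ iff $a_i\mathcal R_ib_i$ for all $i$. A field $X$ is lamp if (a) for all $\mathcal R$ and $t$, $\lim_{u\to t,\,t\mathcal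 R u}X_u$ exists; (b) for $\mathcal R=(\le,\dots,\le)$ this limit equals $X_t$; (c) $X_t=0$ if $t_i=0$ for some $i$. A $d$-parameter Lévy field is a real-valued random field $X=(X_t)_{t\in\mathbb{R}_+^d}$ that is almost surely lamp, is continuous in probability, has independent increments $\Delta_{a_k}^{b_k}X$ over disjoint boxes $]a_k,b_k]$, and has identically distributed increments over boxes that are translates of each other. Its jump at $t$ is $\Delta_tX=\lim_{u\to t,u<t}\Delta_u^tX$, and $J_X(B)=\#\{(t,\Delta_tX)\in B\}$ for Borel $B\subset\mathbb{R}_+^d\times(\mathbb{R}\setminus\{0\})$. Its characteristic triplet $(\gamma,\sigma,\nu)$ (with $\gamma,\sigma\in\mathbb{R}$, $\nu$ a Lévy measure) is determined by $\mathbb{E}(e^{iuX_t})=\exp\big(\mathrm{Leb}_d([0,t])\,[iu\gamma-\tfrac12\sigma^2u^2+\int_{\mathbb{R}}(e^{iux}-1-iux\mathbf 1_{|x|\le1})\nu(dx)]\big)$ for all $t\in\mathbb{R}_+^d$, $u\in\mathbb{R}$. $X(\omega)$ is viewed as an element of $\mathcal D'(\mathbb{R}^d)$ via $\langle X(\omega),\varphi\rangle=\int_{\mathbb{R}_+^d}X_t(\omega)\varphi(t)\,dt$. $\mathcal S'(\mathbb{R}^d)$ is the space of tempered distributions (continuous linear functionals on the Schwartz space $\mathcal S(\mathbb{R}^d)$). In the definition of $\Omega_X$ it is understood that when $X(\omega)\in\mathcal S'(\mathbb{R}^d)$, the associated continuous linear functional is $\langle X(\omega),\varphi\rangle=\int_{\mathbb{R}_+^d}X_t(\omega)\varphi(t)\,dt$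 for all $\varphi\in\mathcal S(\mathbb{R}^d)$. *)

theory Defs
  imports "HOL-Probability.Probability"
begin

definition orthant :: "(real ^ 'd) set" where
  "orthant = {t. \<forall>i. 0 \<le> t $ i}"

text \<open>
  The order \<open>\<le>\<close> of \<^typ>\<open>real ^ 'd\<close> is the componentwise one, but the library's \<open><\<close> is its strict
  part and not the componentwise strict order. The latter is therefore always written out.
\<close>

definition half_open_box :: "real ^ 'd \<Rightarrow> real ^ 'd \<Rightarrow> (real ^ 'd) set" where
  "half_open_box a b = {t. (\<forall>i. a $ i < t $ i) \<and> t \<le> b}"

definition increment :: "real ^ 'd \<Rightarrow> real ^ 'd \<Rightarrow> (real ^ 'd \<Rightarrow> real) \<Rightarrow> real" where
  "increment a b f =
     (\<Sum>\<epsilon> \<in> (UNIV :: 'd set) \<rightarrow>\<^sub>E {0, 1 :: nat}.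
        (-1) ^ (\<Sum>i\<in>UNIV. \<epsilon> i) * f (\<chi> i. if \<epsilon> i = 1 then a $ i else b $ i))"

text \<open>
  If \<open>t\<close> lies on the boundary of the orthant and \<open>R i\<close> is \<open>>\<close> for some \<open>i\<close> with \<open>t $ i = 0\<close>, then no
  \<open>u\<close> in the orthant satisfies \<open>t R u\<close>; the filter below is then \<open>bot\<close> and the condition is void.
\<close>

definition lamp :: "(real ^ 'd \<Rightarrow> real) \<Rightarrow> bool" where
  "lamp f \<longleftrightarrow>
     (\<forall>t\<in>orthant. \<forall>R :: 'd \<Rightarrow> real \<Rightarrow> real \<Rightarrow> bool. (\<forall>i. R i \<in> {(\<le>), (>)}) \<longrightarrow>
        (\<exists>l. (f \<longlongrightarrow> l) (at t within {u \<in> orthant. \<forall>i. R i (t $ i) (u $ i)}))) \<and>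
     (\<forall>t\<in>orthant. (f \<longlongrightarrow> f t) (at t within {u \<in> orthant. \<forall>i. t $ i \<le> u $ i})) \<and>
     (\<forall>t\<in>orthant. (\<exists>i. t $ i = 0) \<longrightarrow> f t = 0)"

definition continuous_in_probability ::
    "'w measure \<Rightarrow> (real ^ 'd \<Rightarrow> 'w \<Rightarrow> real) \<Rightarrow> bool" where
  "continuous_in_probability M X \<longleftrightarrow>
     (\<forall>t\<in>orthant. \<forall>\<delta>>0.
        ((\<lambda>u. measure M {\<omega> \<in> space M. \<bar>X u \<omega> - X t \<omega>\<bar> > \<delta>}) \<longlongrightarrow> 0) (at t within orthant))"

definition independent_increments ::
    "'w measure \<Rightarrow> (real ^ 'd \<Rightarrow> 'w \<Rightarrow> real) \<Rightarrow> bool" where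
  "independent_increments M X \<longleftrightarrow>
     (\<forall>n :: nat. \<forall>a b.
        (\<forall>k<n. a k \<in> orthant \<and> a k \<le> b k) \<longrightarrow>
        disjoint_family_on (\<lambda>k. half_open_box (a k) (b k)) {..<n} \<longrightarrow>
        prob_space.indep_vars M (\<lambda>_. borel)
          (\<lambda>k \<omega>. increment (a k) (b k) (\<lambda>t. X t \<omega>)) {..<n})"

definition stationary_increments ::
    "'w measure \<Rightarrow> (real ^ 'd \<Rightarrow> 'w \<Rightarrow> real) \<Rightarrow> bool" where
  "stationary_increments M X \<longleftrightarrow>
     (\<forall>a b h. a \<in> orthant \<longrightarrow> a \<le> b \<longrightarrow> a + h \<in> orthant \<longrightarrow>
        distr M borel (\<lambda>\<omega>. increment (a + h) (b + h) (\<lambda>t. X t \<omega>)) =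
        distr M borel (\<lambda>\<omega>. increment a b (\<lambda>t. X t \<omega>)))"

text \<open>Only the values of \<open>X\<close> on the orthant matter.\<close>

definition levy_field :: "'w measure \<Rightarrow> (real ^ 'd \<Rightarrow> 'w \<Rightarrow> real) \<Rightarrow> bool" where
  "levy_field M X \<longleftrightarrow>
     (\<forall>t\<in>orthant. X t \<in> borel_measurable M) \<and>
     (AE \<omega> in M. lamp (\<lambda>t. X t \<omega>)) \<and>
     continuous_in_probability M X \<and>
     independent_increments M X \<and>
     stationary_increments M X"

definition jump :: "(real ^ 'd \<Rightarrow> real) \<Rightarrow> real ^ 'd \<Rightarrow> real" where
  "jump f t = Lim (at t within {u \<in> orthant. \<forall>i. u $ i < t $ i}) (\<lambda>u. increment u t f)"

text \<open>
  The counting measure of the jump times, pushed forward by \<open>t \<mapsto> (t, jump f t)\<close>. Points on the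
  boundary of the orthant are excluded: there the limit defining the jump is over an empty set.
\<close>

definition jump_measure :: "(real ^ 'd \<Rightarrow> real) \<Rightarrow> ((real ^ 'd) \<times> real) measure" where
  "jump_measure f =
     distr (count_space {t. (\<forall>i. 0 < t $ i) \<and> jump f t \<noteq> 0})
       (restrict_space borel (orthant \<times> (- {0}))) (\<lambda>t. (t, jump f t))"

lemma emeasure_jump_measure:
  assumes "B \<in> sets (restrict_space borel (orthant \<times> (- {0})))"
  shows "emeasure (jump_measure f) B =
    emeasure (count_space UNIV) {t. (\<forall>i. 0 < t $ i) \<and> (t, jump f t) \<in> B}"
proof -
  let ?A = "{t. (\<forall>i. 0 < t $ i) \<and> jump f t \<noteq> 0}"
  have B: "B \<subseteq> orthant \<times> (- {0})"
    using sets.sets_into_space[OF assms] by (auto simp: space_restrict_space)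
  have eq: "(\<lambda>t. (t, jump f t)) -` B \<inter> ?A = {t. (\<forall>i. 0 < t $ i) \<and> (t, jump f t) \<in> B}"
    using B by auto
  have sub: "{t. (\<forall>i. 0 < t $ i) \<and> (t, jump f t) \<in> B} \<subseteq> ?A"
    using B by auto
  have "(\<lambda>t. (t, jump f t)) \<in> count_space ?A \<rightarrow>\<^sub>M restrict_space borel (orthant \<times> (- {0}))"
    by (auto simp: space_restrict_space orthant_def less_imp_le)
  then show ?thesis
    unfolding jump_measure_def using assms
    by (subst emeasure_distr) (auto simp: eq emeasure_count_space[OF sub] emeasure_count_space)
qed

definition levy_measure :: "real measure \<Rightarrow> bool" where
  "levy_measure \<nu> \<longleftrightarrow>
     sets \<nu> = sets borel \<and> emeasure \<nu> {0} = 0 \<and> (\<integral>\<^sup>+x. ennreal (min 1 (x\<^sup>2)) \<partial>\<nu>) < \<infinity>"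

definition characteristic_triplet ::
    "'w measure \<Rightarrow> (real ^ 'd \<Rightarrow> 'w \<Rightarrow> real) \<Rightarrow> real \<Rightarrow> real \<Rightarrow> real measure \<Rightarrow> bool" where
  "characteristic_triplet M X \<gamma> \<sigma> \<nu> \<longleftrightarrow>
     levy_measure \<nu> \<and>
     (\<forall>t\<in>orthant. \<forall>u :: real.
        (CLINT \<omega>|M. iexp (u * X t \<omega>)) =
        exp (complex_of_real (measure lborel {0..t}) *
          (\<i> * complex_of_real (u * \<gamma>) - complex_of_real (\<sigma>\<^sup>2 * u\<^sup>2 / 2) +
           (CLINT x|\<nu>. (iexp (u * x) - 1
              - \<i> * complex_of_real (u * x) * indicator {x. \<bar>x\<bar> \<le> 1} x)))))"

text \<open>
  An iterated partial derivative is indexed by the list of its directions. On smooth functions it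
  depends only on how often each direction occurs, so lists and multi-indices give the same
  seminorms.
\<close>

definition partial_deriv :: "'d \<Rightarrow> (real ^ 'd \<Rightarrow> real) \<Rightarrow> real ^ 'd \<Rightarrow> real" where
  "partial_deriv i f x = frechet_derivative f (at x) (axis i 1)"

definition partial_derivs :: "'d list \<Rightarrow> (real ^ 'd \<Rightarrow> real) \<Rightarrow> real ^ 'd \<Rightarrow> real" where
  "partial_derivs is f = foldr partial_deriv is f"

text \<open>
  Differentiability of all iterated partial derivatives entails their continuity, so this is
  the usual class of infinitely differentiable functions.
\<close>

definition smooth :: "(real ^ 'd \<Rightarrow> real) \<Rightarrow> bool" where
  "smooth f \<longleftrightarrow> (\<forall>is. partial_derivs is f differentiable_on UNIV)"

definition weighted_deriv ::
    "('d \<Rightarrow> nat) \<Rightarrow> 'd list \<Rightarrow> (real ^ 'd \<Rightarrow> real) \<Rightarrow> real ^ 'd \<Rightarrow> real" where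
  "weighted_deriv \<alpha> is f x = (\<Prod>i\<in>UNIV. (x $ i) ^ \<alpha> i) * partial_derivs is f x"

definition schwartz_space :: "(real ^ 'd \<Rightarrow> real) set" where
  "schwartz_space = {\<phi>. smooth \<phi> \<and> (\<forall>\<alpha> is. bounded (range (weighted_deriv \<alpha> is \<phi>)))}"

definition schwartz_seminorm ::
    "('d \<Rightarrow> nat) \<Rightarrow> 'd list \<Rightarrow> (real ^ 'd \<Rightarrow> real) \<Rightarrow> real" where
  "schwartz_seminorm \<alpha> is \<phi> = (SUP x. \<bar>weighted_deriv \<alpha> is \<phi> x\<bar>)"

definition schwartz_topology :: "(real ^ 'd \<Rightarrow> real) topology" where
  "schwartz_topology =
     topology_generated_by
       {{\<psi> \<in> schwartz_space. schwartz_seminorm \<alpha> is (\<lambda>x. \<psi> x - \<phi> x) < r} | \<phi> \<alpha> is r.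
          \<phi> \<in> schwartz_space \<and> 0 < r}"

text \<open>Membership in the dual space; the values of \<open>T\<close> off the Schwartz space are irrelevant.\<close>

definition tempered_distribution :: "((real ^ 'd \<Rightarrow> real) \<Rightarrow> real) \<Rightarrow> bool" where
  "tempered_distribution T \<longleftrightarrow>
     (\<forall>\<phi>\<in>schwartz_space. \<forall>\<psi>\<in>schwartz_space. \<forall>a b.
        T (\<lambda>x. a * \<phi> x + b * \<psi> x) = a * T \<phi> + b * T \<psi>) \<and>
     continuous_map schwartz_topology euclideanreal T"

text \<open>
  A path is a tempered distribution if its pairing with every Schwartz function is given by an
  absolutely convergent integral and this pairing is a continuous linear functional. The
  integrability must be asked for, as the library's integral of a non-integrable function is \<open>0\<close>.
\<close>

definition tempered_event :: "'w measure \<Rightarrow> (real ^ 'd \<Rightarrow> 'w \<Rightarrow> real) \<Rightarrow> 'w set" where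
  "tempered_event M X =
     {\<omega> \<in> space M.
        (\<forall>\<phi>\<in>schwartz_space. set_integrable lborel orthant (\<lambda>t. X t \<omega> * \<phi> t)) \<and>
        tempered_distribution (\<lambda>\<phi>. LINT t:orthant|lborel. X t \<omega> * \<phi> t)}"

end

theory Submission
  imports Defs "HOL-Computational_Algebra.Polynomial"
begin

text \<open>
  If \<open>E |X_1|^\<eta> < \<infinity>\<close>, split \<open>[0,t]\<close>, for \<open>t \<in> [0,n]^d\<close>, into at most \<open>n^d\<close> boxes of side at most one.
  The increment over a box in \<open>[0,1]^d\<close> is an independent summand of \<open>X_1\<close>, so its tail is dominated by that of
  \<open>X_1\<close>; Etemadi's maximal inequality, used in one coordinate after the other, then bounds the tail of
  the supremum over \<open>[0,n]^d\<close>. By Borel--Cantelli the paths have polynomial growth, hence are tempered.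

  If no moment is finite, pair \<open>X\<close> with the mixed difference (of step 2 in each coordinate) of a
  bump \<open>\<psi>\<close> supported in \<open>[0,1]^d\<close>, translated to \<open>3j(1,\<dots>,1)\<close>. The result \<open>W_j\<close> averages
  increments over boxes that all contain \<open>[3j+1,3j+2]^d\<close>, so it is a multiple of a copy of \<open>X_1\<close> plus an
  independent remainder that is tight uniformly in \<open>j\<close>; moreover the \<open>W_j\<close> are independent. Temperedness forces
  \<open>|W_j|\<close> to grow polynomially, and the second Borel--Cantelli argument excludes this. Both the
  independence and the tail estimate are only needed for dyadic Riemann sums of \<open>W_j\<close>.
\<close>

section \<open>Increments and lamp functions\<close>

text \<open>Values of \<open>X\<close> are not independent; only increments over disjoint boxes are.
  Both halves therefore work with finitely many disjoint cells of a grid, where sums of increments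
  obey exact algebra, and pass to the path by right-continuity afterwards. This also keeps suprema
  and integrals over uncountable sets out of the sigma-algebra: probabilities are computed for
  dyadic events only, and these control the exceptional paths.

  Neither symmetry nor a finite mean is available for comparing a part with the whole. The
  substitute, used in both halves, is that for large \<open>a\<close> an independent remainder lies
  in \<open>[-a, a]\<close> with probability at least 1/2, so a part beyond \<open>2 * a\<close>
  forces the sum beyond \<open>a\<close> at the cost of a factor 2.

  The numbers 1, 2, 3 belong together: for \<open>s\<close> in \<open>(0,1)^d\<close> the box from
  \<open>s\<close> to \<open>s + 2\<close> contains \<open>[1,2]^d\<close> and lies in
  \<open>[0,3]^d\<close>. In the second half the order \<open>1 / (p + 1)\<close> is matched with
  growth of degree \<open>p + 1\<close>: if that moment is infinite, the probabilities that
  \<open>|X_1|\<close> is at least \<open>\<beta> * (1 + j) ^ (p + 1)\<close> have a divergent sum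
  over \<open>j\<close>.\<close>

lemma finite_PiE_UNIV [simp]: "(\<And>i. finite (A i)) \<Longrightarrow> finite (PiE (UNIV :: 'd::finite set) A)"
  by (rule finite_PiE) auto

text \<open>
  Expanding \<open>f\<close> on the grid in indicators of points turns the alternating sum into a product of
  one-dimensional differences; additivity over a grid is then telescoping in each coordinate.
\<close>

lemma increment_point_expansion:
  fixes g :: "'d::finite \<Rightarrow> nat \<Rightarrow> real" and f :: "real ^ 'd \<Rightarrow> real"
  assumes "\<And>i. finite (P i)" "\<And>i. c i \<in> P i" "\<And>i. d i \<in> P i"
  shows "increment (\<chi> i. g i (c i)) (\<chi> i. g i (d i)) f =
    (\<Sum>q\<in>PiE UNIV P. f (\<chi> i. g i (q i)) * (\<Prod>i\<in>UNIV. of_bool (d i = q i) - of_bool (c i = q i)))"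
proof -
  let ?F = "\<lambda>q. f (\<chi> i. g i (q i))"
  let ?k = "\<lambda>\<epsilon> i. if \<epsilon> i = (1::nat) then c i else d i"
  have 1: "?F p = (\<Sum>q\<in>PiE UNIV P. ?F q * (\<Prod>i\<in>UNIV. of_bool (p i = q i)))"
    if "p \<in> PiE UNIV P" for p
  proof -
    have "(\<Sum>q\<in>PiE UNIV P. ?F q * (\<Prod>i\<in>UNIV. of_bool (p i = q i))) =
        (\<Sum>q\<in>PiE UNIV P. if q = p then ?F q else 0)"
    proof (rule sum.cong)
      fix q
      show "?F q * (\<Prod>i\<in>UNIV. of_bool (p i = q i)) = (if q = p then ?F q else 0)"
      proof (cases "q = p")
        case False
        then obtain i where "p i \<noteq> q i" by (metis ext)
        then have "(\<Prod>i\<in>UNIV. of_bool (p i = q i)) = (0 :: real)"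
          by (intro prod_zero) auto
        then show ?thesis using False by simp
      qed simp
    qed simp
    also have "\<dots> = ?F p"
      using that assms by (simp add: sum.delta finite_PiE)
    finally show ?thesis by simp
  qed
  have "increment (\<chi> i. g i (c i)) (\<chi> i. g i (d i)) f =
      (\<Sum>\<epsilon> \<in> UNIV \<rightarrow>\<^sub>E {0, 1 :: nat}. (-1) ^ (\<Sum>i\<in>UNIV. \<epsilon> i) * ?F (?k \<epsilon>))"
    unfolding increment_def by (intro sum.cong arg_cong2[where f="(*)"] arg_cong[of _ _ f]) (auto simp: vec_eq_iff)
  also have "\<dots> = (\<Sum>\<epsilon> \<in> UNIV \<rightarrow>\<^sub>E {0, 1 :: nat}. (-1) ^ (\<Sum>i\<in>UNIV. \<epsilon> i) *
      (\<Sum>q\<in>PiE UNIV P. ?F q * (\<Prod>i\<in>UNIV. of_bool (?k \<epsilon> i = q i))))"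
    by (intro sum.cong arg_cong2[where f="(*)"] 1) (use assms in \<open>auto simp: PiE_def\<close>)
  also have "\<dots> = (\<Sum>q\<in>PiE UNIV P. ?F q * (\<Sum>\<epsilon> \<in> UNIV \<rightarrow>\<^sub>E {0, 1 :: nat}.
      \<Prod>i\<in>UNIV. (-1) ^ (\<epsilon> i) * of_bool ((if \<epsilon> i = 1 then c i else d i) = q i)))"
    by (simp add: sum_distrib_left power_sum prod.distrib mult_ac) (rule sum.swap)
  also have "\<dots> = (\<Sum>q\<in>PiE UNIV P. ?F q * (\<Prod>i\<in>UNIV. \<Sum>e\<in>{0, 1 :: nat}.
      (-1) ^ e * of_bool ((if e = 1 then c i else d i) = q i)))"
    by (subst prod_sum_PiE) auto
  also have "\<dots> = (\<Sum>q\<in>PiE UNIV P. ?F q * (\<Prod>i\<in>UNIV. of_bool (d i = q i) - of_bool (c i = q i)))"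
    by (intro sum.cong prod.cong arg_cong2[where f="(*)"]) auto
  finally show ?thesis .
qed

lemma increment_grid:
  fixes g :: "'d::finite \<Rightarrow> nat \<Rightarrow> real" and f :: "real ^ 'd \<Rightarrow> real"
  assumes "\<And>i. a i \<le> b i"
  shows "(\<Sum>c\<in>PiE UNIV (\<lambda>i. {a i..<b i}). increment (\<chi> i. g i (c i)) (\<chi> i. g i (Suc (c i))) f) =
    increment (\<chi> i. g i (a i)) (\<chi> i. g i (b i)) f"
proof -
  let ?P = "\<lambda>i. {a i..b i}" and ?F = "\<lambda>q. f (\<chi> i. g i (q i))"
  have tele: "(\<Sum>k\<in>{a i..<b i}. of_bool (Suc k = x) - of_bool (k = x)) =
      (of_bool (b i = x) - of_bool (a i = x) :: real)" for i x
    by (rule sum_Suc_diff') (use assms in auto)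
  have "(\<Sum>c\<in>PiE UNIV (\<lambda>i. {a i..<b i}). increment (\<chi> i. g i (c i)) (\<chi> i. g i (Suc (c i))) f) =
      (\<Sum>c\<in>PiE UNIV (\<lambda>i. {a i..<b i}). \<Sum>q\<in>PiE UNIV ?P.
         ?F q * (\<Prod>i\<in>UNIV. of_bool (Suc (c i) = q i) - of_bool (c i = q i)))"
    by (intro sum.cong increment_point_expansion) (auto simp: PiE_iff less_imp_le Suc_le_eq intro: le_SucI)
  also have "\<dots> = (\<Sum>q\<in>PiE UNIV ?P. ?F q * (\<Sum>c\<in>PiE UNIV (\<lambda>i. {a i..<b i}).
         \<Prod>i\<in>UNIV. of_bool (Suc (c i) = q i) - of_bool (c i = q i)))"
    by (subst sum.swap) (simp add: sum_distrib_left)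
  also have "\<dots> = (\<Sum>q\<in>PiE UNIV ?P. ?F q * (\<Prod>i\<in>UNIV. of_bool (b i = q i) - of_bool (a i = q i)))"
    by (subst prod_sum_PiE[symmetric]) (auto simp: tele)
  also have "\<dots> = increment (\<chi> i. g i (a i)) (\<chi> i. g i (b i)) f"
    by (rule increment_point_expansion[symmetric]) (use assms in auto)
  finally show ?thesis .
qed

lemma abs_increment_le:
  fixes f :: "real ^ 'd::finite \<Rightarrow> real"
  assumes "\<And>t. (\<forall>i. t $ i = a $ i \<or> t $ i = b $ i) \<Longrightarrow> \<bar>f t\<bar> \<le> B"
  shows "\<bar>increment a b f\<bar> \<le> 2 ^ CARD('d) * B"
proof -
  have "\<bar>increment a b f\<bar> \<le> (\<Sum>\<epsilon> \<in> (UNIV :: 'd set) \<rightarrow>\<^sub>E {0, 1 :: nat}. B)"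
    unfolding increment_def
    by (rule order_trans[OF sum_abs], intro sum_mono)
       (auto simp: abs_mult power_abs intro!: assms)
  also have "\<dots> = 2 ^ CARD('d) * B"
    by (simp add: card_PiE)
  finally show ?thesis .
qed

text \<open>Every corner other than \<open>t\<close> has a vanishing coordinate, so only the term
  with \<open>\<epsilon> = 0\<close> survives. This turns a value of the field into an increment,
  the only kind of quantity about which independence and stationarity say anything.\<close>

lemma increment_zero:
  fixes f :: "real ^ 'd::finite \<Rightarrow> real"
  assumes "\<And>u. \<exists>i. u $ i = 0 \<Longrightarrow> u \<in> orthant \<Longrightarrow> f u = 0" "t \<in> orthant"
  shows "increment 0 t f = f t"
proof -
  let ?E = "(UNIV :: 'd set) \<rightarrow>\<^sub>E {0, 1 :: nat}"
  have "increment 0 t f = (\<Sum>\<epsilon>\<in>?E. if \<epsilon> = (\<lambda>i. 0) then f t else 0)"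
    unfolding increment_def
  proof (rule sum.cong)
    fix \<epsilon> assume e: "\<epsilon> \<in> ?E"
    show "(-1) ^ (\<Sum>i\<in>UNIV. \<epsilon> i) * f (\<chi> i. if \<epsilon> i = 1 then 0 $ i else t $ i) = (if \<epsilon> = (\<lambda>i. 0) then f t else 0)"
    proof (cases "\<epsilon> = (\<lambda>i. 0)")
      case True
      then show ?thesis by simp
    next
      case False
      then obtain i where i: "\<epsilon> i \<noteq> 0" by auto
      have "\<epsilon> i \<in> {0, 1}" using e by (rule PiE_mem) simp
      then have "\<epsilon> i = 1" using i by simp
      then have "f (\<chi> i. if \<epsilon> i = 1 then 0 $ i else t $ i) = 0"
        by (intro assms(1) exI[of _ i]) (use assms(2) in \<open>auto simp: orthant_def\<close>)
      then show ?thesis using False by simp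
    qed
  qed simp
  also have "\<dots> = f t" by (simp add: sum.delta finite_PiE PiE_iff)
  finally show ?thesis .
qed

section \<open>Lamp functions: right-continuity and local boundedness\<close>

lemma lamp_zero: "lamp f \<Longrightarrow> t \<in> orthant \<Longrightarrow> t $ i = 0 \<Longrightarrow> f t = 0"
  unfolding lamp_def by blast

lemma lamp_increment_zero: "lamp f \<Longrightarrow> t \<in> orthant \<Longrightarrow> increment 0 t f = f t"
  by (rule increment_zero) (auto intro: lamp_zero)

lemma lamp_right_continuous:
  assumes "lamp f" "t \<in> orthant" "u \<longlonglongrightarrow> t" "\<And>n. t \<le> u n"
  shows "(\<lambda>n. f (u n)) \<longlonglongrightarrow> f t"
proof -
  let ?S = "{u \<in> orthant. \<forall>i. t $ i \<le> u $ i}"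
  have "(f \<longlongrightarrow> f t) (at t within ?S)"
    using assms(1,2) unfolding lamp_def by blast
  then have "continuous (at t within ?S) f"
    by (simp add: continuous_within)
  moreover have "u n \<in> ?S" for n
    using assms(2) assms(4)[of n] by (simp add: orthant_def less_eq_vec_def) (meson order_trans)
  ultimately show ?thesis
    using assms(3) unfolding continuous_within_sequentially o_def by blast
qed

text \<open>The finitely many relations cut the neighbourhood of \<open>t\<close> into pieces, and a
  limit within a piece bounds \<open>f\<close> there. For an empty piece the filter is
  \<open>bot\<close> and the bound costs nothing.\<close>

lemma lamp_locally_bounded:
  assumes "lamp f" "t \<in> orthant"
  shows "\<exists>B. \<forall>\<^sub>F u in nhds t. u \<in> orthant \<longrightarrow> \<bar>f u\<bar> \<le> B"
proof -
  define \<R> where "\<R> = {R :: 'a \<Rightarrow> real \<Rightarrow> real \<Rightarrow> bool. \<forall>i. R i \<in> {(\<le>), (>)}}"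
  have "\<R> = PiE UNIV (\<lambda>i. {(\<le>), (>)})"
    by (auto simp: \<R>_def PiE_def)
  then have fin: "finite \<R>" by simp
  let ?S = "\<lambda>R. {u \<in> orthant. \<forall>i. R i (t $ i) (u $ i)}"
  have "\<exists>B. \<forall>\<^sub>F u in at t within ?S R. \<bar>f u\<bar> \<le> B" if "R \<in> \<R>" for R
  proof -
    obtain l where "(f \<longlongrightarrow> l) (at t within ?S R)"
      using assms \<open>R \<in> \<R>\<close> unfolding lamp_def \<R>_def mem_Collect_eq by meson
    then have "\<forall>\<^sub>F u in at t within ?S R. dist (f u) l < 1"
      by (rule tendstoD) simp
    then have "\<forall>\<^sub>F u in at t within ?S R. \<bar>f u\<bar> \<le> \<bar>l\<bar> + 1"
      by eventually_elim (auto simp: dist_real_def)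
    then show ?thesis by blast
  qed
  then have "\<forall>R\<in>\<R>. \<exists>B. \<forall>\<^sub>F u in at t within ?S R. \<bar>f u\<bar> \<le> B" by blast
  from bchoice[OF this] obtain B
    where B: "\<And>R. R \<in> \<R> \<Longrightarrow> \<forall>\<^sub>F u in at t within ?S R. \<bar>f u\<bar> \<le> B R" by blast
  \<comment> \<open>The filters leave out the point \<open>t\<close> itself, hence the summand for
    \<open>f t\<close>. The sum stands in for a maximum over \<open>\<R>\<close>.\<close>
  define C where "C = (\<Sum>R\<in>\<R>. \<bar>B R\<bar>) + \<bar>f t\<bar>"
  have BC: "B R \<le> C" if "R \<in> \<R>" for R
  proof -
    have "\<bar>B R\<bar> \<le> (\<Sum>R\<in>\<R>. \<bar>B R\<bar>)" using fin that by (intro member_le_sum) auto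
    then show ?thesis by (simp add: C_def)
  qed
  have "\<forall>\<^sub>F u in nhds t. \<forall>R\<in>\<R>. u \<noteq> t \<longrightarrow> u \<in> ?S R \<longrightarrow> \<bar>f u\<bar> \<le> B R"
  proof (rule eventually_ball_finite[OF fin], rule ballI)
    fix R assume "R \<in> \<R>"
    from B[OF this] show "\<forall>\<^sub>F u in nhds t. u \<noteq> t \<longrightarrow> u \<in> ?S R \<longrightarrow> \<bar>f u\<bar> \<le> B R"
      by (simp add: eventually_at_filter)
  qed
  then have "\<forall>\<^sub>F u in nhds t. u \<in> orthant \<longrightarrow> \<bar>f u\<bar> \<le> C"
  proof eventually_elim
    case (elim u)
    define R where "R i = (if t $ i \<le> u $ i then (\<le>) else (>) :: real \<Rightarrow> real \<Rightarrow> bool)" for i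
    have "R \<in> \<R>" by (auto simp: \<R>_def R_def)
    have "\<bar>f t\<bar> \<le> C" by (simp add: C_def sum_nonneg)
    show ?case
    proof (cases "u = t")
      case False
      have "\<forall>i. R i (t $ i) (u $ i)" by (simp add: R_def)
      then have "u \<in> orthant \<longrightarrow> \<bar>f u\<bar> \<le> B R"
        using elim \<open>R \<in> \<R>\<close> False by blast
      then show ?thesis
        using BC[OF \<open>R \<in> \<R>\<close>] by linarith
    qed (use \<open>\<bar>f t\<bar> \<le> C\<close> in simp)
  qed
  then show ?thesis by blast
qed

lemma orthant_le: "a \<in> orthant \<Longrightarrow> a \<le> b \<Longrightarrow> b \<in> orthant"
  unfolding orthant_def less_eq_vec_def mem_Collect_eq by (meson order_trans)

lemma dyadic_orthant: "(\<chi> i. real (s i) / 2 ^ m) \<in> orthant"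
  by (simp add: orthant_def)

lemma zero_orthant [simp]: "0 \<in> orthant"
  by (simp add: orthant_def)

lemma orthant_iff: "t \<in> orthant \<longleftrightarrow> 0 \<le> t"
  by (simp add: orthant_def less_eq_vec_def)

lemma closed_orthant: "closed (orthant :: (real ^ 'd) set)"
  unfolding orthant_def by (intro closed_Collect_all closed_Collect_le continuous_intros)

lemma borel_orthant [measurable, simp]: "orthant \<in> sets borel"
  by (simp add: closed_orthant borel_closed)

text \<open>Bolzano-Weierstrass: points where \<open>f\<close> is ever larger would accumulate at a
  point of the orthant, against local boundedness there.\<close>

lemma lamp_bounded:
  fixes f :: "real ^ 'd::finite \<Rightarrow> real"
  assumes "lamp f" "compact K"
  shows "\<exists>B. \<forall>u\<in>K \<inter> orthant. \<bar>f u\<bar> \<le> B"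
proof (rule ccontr)
  assume "\<not> ?thesis"
  then have "\<exists>u\<in>K \<inter> orthant. \<bar>f u\<bar> > real n" for n
    by (meson not_le)
  then obtain u where u: "\<And>n. u n \<in> K \<inter> orthant" "\<And>n. \<bar>f (u n)\<bar> > real n"
    by metis
  have "compact (K \<inter> orthant)"
    using assms(2) closed_orthant by (rule compact_Int_closed)
  then obtain t r where t: "t \<in> K \<inter> orthant" "strict_mono r" "(u \<circ> r) \<longlonglongrightarrow> t"
    using u(1) unfolding compact_def by metis
  obtain B where "\<forall>\<^sub>F u in nhds t. u \<in> orthant \<longrightarrow> \<bar>f u\<bar> \<le> B"
    using lamp_locally_bounded[OF assms(1)] t(1) by blast
  with t(3) have "\<forall>\<^sub>F n in sequentially. (u \<circ> r) n \<in> orthant \<longrightarrow> \<bar>f ((u \<circ> r) n)\<bar> \<le> B"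
    unfolding filterlim_iff by blast
  then have "\<forall>\<^sub>F n in sequentially. \<bar>f (u (r n))\<bar> \<le> B"
    by eventually_elim (use u(1) in auto)
  moreover have "\<forall>\<^sub>F n in sequentially. real n > B"
    using filterlim_real_sequentially by (simp add: filterlim_at_top_dense)
  ultimately have "\<forall>\<^sub>F n in sequentially. False"
  proof eventually_elim
    case (elim n)
    have "real n \<le> real (r n)" using seq_suble[OF t(2)] by simp
    then show ?case using u(2)[of "r n"] elim by linarith
  qed
  then show False by simp
qed

text \<open>Rounding goes upwards in every coordinate because the relation \<open>\<le>\<close> in
  all coordinates is the one along which a lamp function converges to its own value. The range is
  countable, which gives measurability below.\<close>

definition round_up :: "nat \<Rightarrow> real ^ 'd \<Rightarrow> real ^ 'd" where
  "round_up m t = (\<chi> i. of_int \<lceil>2 ^ m * t $ i\<rceil> / 2 ^ m)"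

lemma round_up_ge: "t \<le> round_up m t"
proof -
  have "t $ i \<le> of_int \<lceil>2 ^ m * t $ i\<rceil> / 2 ^ m" for i
    by (subst pos_le_divide_eq) (simp_all add: mult.commute[of "t $ i"])
  then show ?thesis by (simp add: less_eq_vec_def round_up_def)
qed

lemma round_up_orthant: "t \<in> orthant \<Longrightarrow> round_up m t \<in> orthant"
  unfolding orthant_def
proof safe
  fix i assume "\<forall>i. 0 \<le> t $ i"
  then have "0 \<le> t $ i" by simp
  also have "\<dots> \<le> round_up m t $ i" using round_up_ge[of t m] by (simp add: less_eq_vec_def)
  finally show "0 \<le> round_up m t $ i" .
qed

lemma round_up_diff_le: "round_up m t $ i \<le> t $ i + 1 / 2 ^ m"
proof -
  have "of_int \<lceil>2 ^ m * t $ i\<rceil> \<le> 2 ^ m * t $ i + 1"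
    by (rule of_int_ceiling_le_add_one)
  then have "of_int \<lceil>2 ^ m * t $ i\<rceil> / 2 ^ m \<le> (2 ^ m * t $ i + 1) / 2 ^ m"
    by (rule divide_right_mono) simp
  then show ?thesis by (simp add: round_up_def add_divide_distrib)
qed

lemma tendsto_round_up: "(\<lambda>m. round_up m t) \<longlonglongrightarrow> t"
proof (rule vec_tendstoI)
  fix i
  have lim: "(\<lambda>m. t $ i + (1 / 2) ^ m) \<longlonglongrightarrow> t $ i"
    using tendsto_add[OF tendsto_const LIMSEQ_power_zero[of "1 / 2 :: real"], of "t $ i"] by simp
  have le: "t $ i \<le> round_up m t $ i" for m
    using round_up_ge[of t m] by (simp add: less_eq_vec_def)
  have ge: "round_up m t $ i \<le> t $ i + (1 / 2) ^ m" for m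
    using round_up_diff_le[of m t i] by (simp add: power_one_over)
  show "(\<lambda>m. round_up m t $ i) \<longlonglongrightarrow> t $ i"
    by (rule tendsto_sandwich[OF always_eventually always_eventually tendsto_const lim])
       (use le ge in blast)+
qed

lemma lamp_round_up: "lamp f \<Longrightarrow> t \<in> orthant \<Longrightarrow> (\<lambda>m. f (round_up m t)) \<longlonglongrightarrow> f t"
  by (rule lamp_right_continuous) (auto intro: tendsto_round_up round_up_ge)

lemma countable_rational_vectors: "countable {t :: real ^ 'd. \<forall>i. t $ i \<in> \<rat>}"
proof -
  have "countable (PiE (UNIV :: 'd set) (\<lambda>_. \<rat> :: real set))"
    by (intro countable_PiE) (auto simp: countable_rat)
  moreover have "{t :: real ^ 'd. \<forall>i. t $ i \<in> \<rat>} \<subseteq> vec_lambda ` PiE UNIV (\<lambda>_. \<rat>)"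
    by (auto intro!: image_eqI[where x="vec_nth _"])
  ultimately show ?thesis
    by (rule countable_subset[OF _ countable_image, rotated])
qed

lemma round_up_rational: "round_up m t $ i \<in> \<rat>"
  by (simp add: round_up_def)

text \<open>A measurable map with countable range may be followed by an arbitrary function. Together
  with right-continuity this makes every lamp path Borel on the orthant.\<close>

lemma measurable_round_up: "(\<lambda>t. f (round_up m t) :: real) \<in> borel_measurable borel"
proof -
  let ?I = "{t :: real ^ 'a. \<forall>i. t $ i \<in> \<rat>}"
  have "round_up m \<in> measurable borel (count_space ?I)"
  proof (subst measurable_count_space_eq_countable[OF countable_rational_vectors], safe)
    fix v :: "real ^ 'a"
    have "round_up m -` {v} \<inter> space borel = {t. \<forall>i. of_int \<lceil>2 ^ m * t $ i\<rceil> / 2 ^ m = v $ i}"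
      by (auto simp: round_up_def vec_eq_iff)
    also have "\<dots> \<in> sets borel" by measurable
    finally show "round_up m -` {v} \<inter> space borel \<in> sets borel" .
  qed (auto simp: round_up_rational)
  then show ?thesis
    by (rule measurable_compose_countable'[rotated]) (auto simp: countable_rational_vectors)
qed

lemma lamp_measurable:
  assumes "lamp f"
  shows "(\<lambda>t. indicator orthant t * f t) \<in> borel_measurable borel"
proof (rule borel_measurable_LIMSEQ_real)
  show "(\<lambda>m. indicator orthant t * f (round_up m t)) \<longlonglongrightarrow> indicator orthant t * f t" for t
    using lamp_round_up[OF assms, of t] by (cases "t \<in> orthant") auto
  show "(\<lambda>t. indicator orthant t * f (round_up m t)) \<in> borel_measurable borel" for m
    using measurable_round_up[of f m] by measurable
qed

section \<open>Smooth bumps\<close>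

text \<open>A smooth function of one variable carried along with the tower of its derivatives, so
  that derivatives of products are explicit formulas and no iterated derivative operator has to be
  evaluated.\<close>

definition derivative_sequence :: "(nat \<Rightarrow> real \<Rightarrow> real) \<Rightarrow> bool" where
  "derivative_sequence F \<longleftrightarrow> (\<forall>n x. (F n has_real_derivative F (Suc n) x) (at x))"

text \<open>The Leibniz formula; Pascal's rule is the step from \<open>n\<close> to
  \<open>Suc n\<close>.\<close>

lemma derivative_sequence_mult:
  assumes "derivative_sequence F" "derivative_sequence G"
  shows "derivative_sequence (\<lambda>n x. \<Sum>k\<le>n. real (n choose k) * (F k x * G (n - k) x))"
  unfolding derivative_sequence_def
proof (intro allI)
  fix n x
  let ?a = "\<lambda>k. F k x * G (Suc n - k) x"
  have "(\<Sum>k\<le>n. real (n choose k) * (F (Suc k) x * G (n - k) x + F k x * G (Suc (n - k)) x)) =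
      (\<Sum>k\<le>n. real (n choose k) * ?a (Suc k)) + (\<Sum>k\<le>n. real (n choose k) * ?a k)"
    by (simp add: sum.distrib[symmetric] distrib_left Suc_diff_le)
  \<comment> \<open>The added top term has coefficient \<open>n choose Suc n = 0\<close>. With it,
    splitting off \<open>k = 0\<close> leaves the same range as in the first sum, and Pascal's rule
    can join the two.\<close>
  also have "(\<Sum>k\<le>n. real (n choose k) * ?a k) = (\<Sum>k\<le>Suc n. real (n choose k) * ?a k)"
    by (simp add: binomial_eq_0)
  also have "\<dots> = ?a 0 + (\<Sum>k\<le>n. real (n choose Suc k) * ?a (Suc k))"
    by (subst sum.atMost_Suc_shift) simp
  also have "(\<Sum>k\<le>n. real (n choose k) * ?a (Suc k)) + (?a 0 + (\<Sum>k\<le>n. real (n choose Suc k) * ?a (Suc k))) =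
      (\<Sum>k\<le>Suc n. real (Suc n choose k) * ?a k)"
    by (subst sum.atMost_Suc_shift) (simp add: sum.distrib[symmetric] distrib_right)
  finally have eq: "(\<Sum>k\<le>n. real (n choose k) * (F (Suc k) x * G (n - k) x + F k x * G (Suc (n - k)) x)) =
      (\<Sum>k\<le>Suc n. real (Suc n choose k) * ?a k)" .
  have "((\<lambda>x. \<Sum>k\<le>n. real (n choose k) * (F k x * G (n - k) x)) has_real_derivative
      (\<Sum>k\<le>n. real (n choose k) * (F (Suc k) x * G (n - k) x + F k x * G (Suc (n - k)) x))) (at x)"
    using assms unfolding derivative_sequence_def
    by (intro DERIV_sum DERIV_cmult) (rule DERIV_mult'[THEN DERIV_cong], auto)
  then show "((\<lambda>x. \<Sum>k\<le>n. real (n choose k) * (F k x * G (n - k) x)) has_real_derivative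
      (\<Sum>k\<le>Suc n. real (Suc n choose k) * (F k x * G (Suc n - k) x))) (at x)"
    by (simp only: eq)
qed

lemma derivative_sequence_reflect:
  assumes "derivative_sequence F"
  shows "derivative_sequence (\<lambda>n x. (-1) ^ n * F n (1 - x))"
  unfolding derivative_sequence_def
proof (intro allI)
  fix n x
  have "(F n has_real_derivative F (Suc n) (1 - x)) (at (1 - x))"
    using assms by (simp add: derivative_sequence_def)
  then have "((\<lambda>x. F n (1 - x)) has_real_derivative F (Suc n) (1 - x) * (- 1)) (at x)"
    by (rule DERIV_chain2) (auto intro!: derivative_eq_intros)
  from DERIV_cmult[OF this, of "(-1) ^ n"]
  show "((\<lambda>x. (-1) ^ n * F n (1 - x)) has_real_derivative (-1) ^ Suc n * F (Suc n) (1 - x)) (at x)"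
    by simp
qed

text \<open>
  The functions \<open>flat n\<close> are the derivatives of \<open>exp (- 1 / x)\<close>: with \<open>y = 1 / x\<close>, the derivative of
  \<open>p y * exp (- y)\<close> with respect to \<open>x\<close> is \<open>y\<^sup>2 * (p y - p' y) * exp (- y)\<close>.
\<close>

fun flat_poly :: "nat \<Rightarrow> real poly" where
  "flat_poly 0 = 1"
| "flat_poly (Suc n) = [:0, 0, 1:] * (flat_poly n - pderiv (flat_poly n))"

definition flat :: "nat \<Rightarrow> real \<Rightarrow> real" where
  "flat n x = (if x \<le> 0 then 0 else poly (flat_poly n) (1 / x) * exp (- (1 / x)))"

lemma poly_times_exp_tendsto_0: "((\<lambda>y. poly p y * exp (- y)) \<longlongrightarrow> (0 :: real)) at_top"
proof -
  have "((\<lambda>y. \<Sum>i\<le>degree p. coeff p i * (y ^ i / exp y)) \<longlongrightarrow> (\<Sum>i\<le>degree p. coeff p i * 0)) at_top"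
    by (intro tendsto_sum tendsto_mult tendsto_const tendsto_power_div_exp_0)
  then show ?thesis
    by (simp add: poly_altdef sum_distrib_right exp_minus divide_inverse mult.assoc)
qed

lemma derivative_sequence_flat: "derivative_sequence flat"
  unfolding derivative_sequence_def
proof (intro allI)
  fix n and x :: real
  consider "x < 0" | "x = 0" | "x > 0" by linarith
  then show "(flat n has_real_derivative flat (Suc n) x) (at x)"
  proof cases
    case 1
    have "((\<lambda>_. 0) has_real_derivative flat (Suc n) x) (at x)"
      using 1 by (simp add: flat_def)
    then show ?thesis
      by (rule has_field_derivative_transform_within_open[of _ _ _ "{..<0}"])
         (use 1 in \<open>auto simp: flat_def\<close>)
  next
    case 2
    \<comment> \<open>\<open>pCons 0\<close> multiplies the polynomial by its variable
      \<open>1 / y\<close>, which is exactly the denominator of the difference quotient at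
      0.\<close>
    have "((\<lambda>y. poly (pCons 0 (flat_poly n)) (inverse y) * exp (- inverse y)) \<longlongrightarrow> 0) (at_right 0)"
      by (rule filterlim_compose[OF poly_times_exp_tendsto_0 filterlim_inverse_at_top_right])
    then have "((\<lambda>y. flat n y / y) \<longlongrightarrow> 0) (at_right 0)"
      by (rule Lim_transform_eventually)
         (auto simp: eventually_at_filter flat_def divide_inverse mult_ac)
    moreover have "((\<lambda>y. flat n y / y) \<longlongrightarrow> 0) (at_left 0)"
      by (rule Lim_transform_eventually[OF tendsto_const])
         (auto simp: eventually_at_filter flat_def)
    ultimately have "((\<lambda>y. flat n y / y) \<longlongrightarrow> 0) (at 0)"
      by (rule filterlim_split_at[rotated])
    then show ?thesis
      using 2 by (simp add: has_field_derivative_iff flat_def)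
  next
    case 3
    have "((\<lambda>x. poly (flat_poly n) (1 / x) * exp (- (1 / x))) has_real_derivative flat (Suc n) x) (at x)"
      using 3
      by (auto intro!: derivative_eq_intros DERIV_chain2[OF poly_DERIV] simp: flat_def power2_eq_square field_simps)
    then show ?thesis
      by (rule has_field_derivative_transform_within_open[of _ _ _ "{0<..}"])
         (use 3 in \<open>auto simp: flat_def\<close>)
  qed
qed

text \<open>The function is \<open>exp (- 1 / x) * exp (- 1 / (1 - x))\<close> on the unit interval.
  Outside it one of the two factors vanishes together with all its derivatives, so every Leibniz sum
  is zero there.\<close>

lemma bump_sequence:
  obtains H :: "nat \<Rightarrow> real \<Rightarrow> real" where
    "derivative_sequence H" "\<And>x. 0 \<le> H 0 x" "\<And>n x. x \<notin> {0<..<1} \<Longrightarrow> H n x = 0" "0 < H 0 (1 / 2)"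
proof -
  define H where "H n x = (\<Sum>k\<le>n. real (n choose k) * (flat k x * ((-1) ^ (n - k) * flat (n - k) (1 - x))))" for n x
  show ?thesis
  proof
    show "derivative_sequence H"
      using derivative_sequence_mult[OF derivative_sequence_flat derivative_sequence_reflect[OF derivative_sequence_flat]]
      unfolding H_def .
    show "H n x = 0" if "x \<notin> {0<..<1}" for n x
      unfolding H_def using that by (intro sum.neutral) (auto simp: flat_def)
  qed (auto simp: H_def flat_def)
qed

lemma derivative_sequence_bounded:
  assumes "derivative_sequence H" "\<And>n x. x \<notin> {0<..<1} \<Longrightarrow> H n x = 0"
  shows "\<exists>B\<ge>0. \<forall>x. \<bar>H n x\<bar> \<le> B"
proof -
  have "continuous_on {0..1} (H n)"
    using assms(1) unfolding derivative_sequence_def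
    by (meson DERIV_continuous_on has_field_derivative_at_within)
  then have "bounded (H n ` {0..1})"
    by (intro compact_imp_bounded compact_continuous_image) auto
  then obtain B where "\<forall>y\<in>H n ` {0..1}. norm y \<le> B"
    unfolding bounded_iff by blast
  then have B: "\<And>x. x \<in> {0..1} \<Longrightarrow> \<bar>H n x\<bar> \<le> B"
    by simp
  have "\<bar>H n x\<bar> \<le> B" for x
    using B[of x] B[of 0] assms(2)[of x n] by (cases "x \<in> {0..1}") auto
  moreover have "0 \<le> B" using B[of 0] by simp
  ultimately show ?thesis by blast
qed

text \<open>This is what a tensor product of one-variable functions buys: a partial derivative
  raises the order of a single factor, so an iterated one merely counts how often each direction
  occurs.\<close>

lemma partial_deriv_prod:
  fixes H :: "'d::finite \<Rightarrow> nat \<Rightarrow> real \<Rightarrow> real"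
  assumes "\<And>i. derivative_sequence (H i)"
  shows "(\<lambda>t. \<Prod>i\<in>UNIV. H i (n i) (t $ i)) differentiable_on UNIV"
    and "partial_deriv j (\<lambda>t. \<Prod>i\<in>UNIV. H i (n i) (t $ i)) =
      (\<lambda>t. \<Prod>i\<in>UNIV. H i ((n(j := Suc (n j))) i) (t $ i))"
proof -
  let ?f = "\<lambda>t. \<Prod>i\<in>UNIV. H i (n i) (t $ i)"
  let ?D = "\<lambda>t h. \<Sum>i\<in>UNIV. h $ i * H i (Suc (n i)) (t $ i) * (\<Prod>j\<in>UNIV - {i}. H j (n j) (t $ j))"
  have D: "(?f has_derivative ?D t) (at t)" for t
  proof -
    have "((\<lambda>t. H i (n i) (t $ i)) has_derivative (\<lambda>h. h $ i * H i (Suc (n i)) (t $ i))) (at t)" for i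
    proof -
      have "(H i (n i) has_derivative (\<lambda>h. h * H i (Suc (n i)) (t $ i))) (at (t $ i))"
        using assms[of i] unfolding derivative_sequence_def has_field_derivative_def
        by (metis (no_types, lifting) ext has_derivative_eq_rhs mult.commute)
      moreover have "((\<lambda>t. t $ i) has_derivative (\<lambda>h. h $ i)) (at t)"
        by (rule bounded_linear.has_derivative[OF bounded_linear_vec_nth has_derivative_ident])
      ultimately show ?thesis
        by (rule has_derivative_compose[rotated])
    qed
    then show ?thesis by (rule has_derivative_prod)
  qed
  then show "?f differentiable_on UNIV"
    by (auto simp: differentiable_on_def differentiable_def)
  show "partial_deriv j ?f = (\<lambda>t. \<Prod>i\<in>UNIV. H i ((n(j := Suc (n j))) i) (t $ i))"
  proof
    fix t
    have "partial_deriv j ?f t = ?D t (axis j 1)"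
      unfolding partial_deriv_def by (subst frechet_derivative_at[OF D[of t], symmetric]) (rule refl)
    also have "\<dots> = (\<Sum>i\<in>UNIV. if i = j then H i (Suc (n i)) (t $ i) * (\<Prod>j\<in>UNIV - {i}. H j (n j) (t $ j)) else 0)"
      by (intro sum.cong) (auto simp: axis_def)
    also have "\<dots> = H j (Suc (n j)) (t $ j) * (\<Prod>i\<in>UNIV - {j}. H i (n i) (t $ i))"
      by simp
    also have "\<dots> = (\<Prod>i\<in>UNIV. H i ((n(j := Suc (n j))) i) (t $ i))"
      by (subst prod.remove[of UNIV j]) auto
    finally show "partial_deriv j ?f t = (\<Prod>i\<in>UNIV. H i ((n(j := Suc (n j))) i) (t $ i))" .
  qed
qed

lemma partial_derivs_prod:
  fixes H :: "'d::finite \<Rightarrow> nat \<Rightarrow> real \<Rightarrow> real"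
  assumes "\<And>i. derivative_sequence (H i)"
  shows "partial_derivs is (\<lambda>t. \<Prod>i\<in>UNIV. H i 0 (t $ i)) = (\<lambda>t. \<Prod>i\<in>UNIV. H i (count_list is i) (t $ i))"
proof (induction "is")
  case Nil
  then show ?case by (simp add: partial_derivs_def)
next
  case (Cons j "is")
  have "partial_derivs (j # is) (\<lambda>t. \<Prod>i\<in>UNIV. H i 0 (t $ i)) =
      partial_deriv j (partial_derivs is (\<lambda>t. \<Prod>i\<in>UNIV. H i 0 (t $ i)))"
    by (simp add: partial_derivs_def)
  also have "\<dots> = (\<lambda>t. \<Prod>i\<in>UNIV. H i (((count_list is)(j := Suc (count_list is j))) i) (t $ i))"
    by (simp only: Cons.IH partial_deriv_prod(2)[OF assms])
  also have "(count_list is)(j := Suc (count_list is j)) = count_list (j # is)"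
    by auto
  finally show ?case .
qed

lemma smooth_prod:
  fixes H :: "'d::finite \<Rightarrow> nat \<Rightarrow> real \<Rightarrow> real"
  assumes "\<And>i. derivative_sequence (H i)"
  shows "smooth (\<lambda>t. \<Prod>i\<in>UNIV. H i 0 (t $ i))"
  unfolding smooth_def
proof
  fix "is" :: "'d list"
  show "partial_derivs is (\<lambda>t. \<Prod>i\<in>UNIV. H i 0 (t $ i)) differentiable_on UNIV"
    using partial_deriv_prod(1)[of H "count_list is"] assms by (simp add: partial_derivs_prod)
qed

lemma partial_derivs_linear:
  fixes f g :: "real ^ 'd \<Rightarrow> real"
  assumes "smooth f" "smooth g"
  shows "partial_derivs is (\<lambda>x. a * f x + b * g x) = (\<lambda>x. a * partial_derivs is f x + b * partial_derivs is g x)"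
proof (induction "is")
  case Nil
  then show ?case by (simp add: partial_derivs_def)
next
  case (Cons j "is")
  let ?f = "partial_derivs is f" and ?g = "partial_derivs is g"
  have "partial_derivs (j # is) (\<lambda>x. a * f x + b * g x) = partial_deriv j (\<lambda>x. a * ?f x + b * ?g x)"
    using Cons.IH by (simp add: partial_derivs_def)
  also have "\<dots> = (\<lambda>x. a * partial_deriv j ?f x + b * partial_deriv j ?g x)"
  proof
    fix x
    have "?f differentiable at x" "?g differentiable at x"
      using assms by (auto simp: smooth_def differentiable_on_def)
    then have "((\<lambda>x. a * ?f x + b * ?g x) has_derivative
        (\<lambda>h. a * frechet_derivative ?f (at x) h + b * frechet_derivative ?g (at x) h)) (at x)"
      by (intro has_derivative_add has_derivative_mult_right) (auto simp: frechet_derivative_works)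
    note fd = frechet_derivative_at[OF this, symmetric]
    show "partial_deriv j (\<lambda>x. a * ?f x + b * ?g x) x = a * partial_deriv j ?f x + b * partial_deriv j ?g x"
      unfolding partial_deriv_def fd ..
  qed
  finally show ?case by (simp add: partial_derivs_def)
qed

lemma schwartz_linear:
  assumes "f \<in> schwartz_space" "g \<in> schwartz_space"
  shows "(\<lambda>x. a * f x + b * g x) \<in> schwartz_space"
    and "weighted_deriv \<alpha> is (\<lambda>x. a * f x + b * g x) = (\<lambda>x. a * weighted_deriv \<alpha> is f x + b * weighted_deriv \<alpha> is g x)"
proof -
  have sm: "smooth f" "smooth g" using assms by (auto simp: schwartz_space_def)
  show w: "weighted_deriv \<alpha> is (\<lambda>x. a * f x + b * g x) =
      (\<lambda>x. a * weighted_deriv \<alpha> is f x + b * weighted_deriv \<alpha> is g x)" for \<alpha> "is"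
    by (auto simp: weighted_deriv_def partial_derivs_linear[OF sm] algebra_simps)
  have "smooth (\<lambda>x. a * f x + b * g x)"
    unfolding smooth_def partial_derivs_linear[OF sm]
    using sm by (auto simp: smooth_def intro!: differentiable_on_add differentiable_on_mult)
  moreover have "bounded (range (weighted_deriv \<alpha> is (\<lambda>x. a * f x + b * g x)))" for \<alpha> "is"
    unfolding w
  proof (rule bounded_plus_comp)
    show "bounded (range (\<lambda>x. a * weighted_deriv \<alpha> is f x))"
      using bounded_scaling[of "range (weighted_deriv \<alpha> is f)" a] assms
      by (simp add: schwartz_space_def image_image)
    show "bounded (range (\<lambda>x. b * weighted_deriv \<alpha> is g x))"
      using bounded_scaling[of "range (weighted_deriv \<alpha> is g)" b] assms
      by (simp add: schwartz_space_def image_image)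
  qed
  ultimately show "(\<lambda>x. a * f x + b * g x) \<in> schwartz_space"
    by (simp add: schwartz_space_def)
qed

section \<open>Tempered distributions\<close>

definition bump_at :: "(nat \<Rightarrow> real \<Rightarrow> real) \<Rightarrow> real ^ 'd \<Rightarrow> real ^ 'd \<Rightarrow> real" where
  "bump_at h v t = (\<Prod>i\<in>UNIV. h 0 (t $ i - v $ i))"

lemma derivative_sequence_shift:
  assumes "derivative_sequence h"
  shows "derivative_sequence (\<lambda>n x. h n (x - c))"
  unfolding derivative_sequence_def
proof (intro allI)
  fix n x
  have "(h n has_real_derivative h (Suc n) (x - c)) (at (x - c))"
    using assms by (simp add: derivative_sequence_def)
  then have "((\<lambda>x. h n (x - c)) has_real_derivative h (Suc n) (x - c) * 1) (at x)"
    by (rule DERIV_chain2) (auto intro!: derivative_eq_intros)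
  then show "((\<lambda>x. h n (x - c)) has_real_derivative h (Suc n) (x - c)) (at x)"
    by simp
qed

lemma partial_derivs_bump:
  assumes "derivative_sequence h"
  shows "partial_derivs is (bump_at h v) = (\<lambda>t. \<Prod>i\<in>UNIV. h (count_list is i) (t $ i - v $ i))"
  using partial_derivs_prod[of "\<lambda>i n x. h n (x - v $ i)" "is"] derivative_sequence_shift[OF assms]
  by (simp add: bump_at_def[abs_def])

lemma smooth_bump: "derivative_sequence h \<Longrightarrow> smooth (bump_at h v)"
  using smooth_prod[of "\<lambda>i n x. h n (x - v $ i)"] derivative_sequence_shift[of h]
  by (simp add: bump_at_def[abs_def])

text \<open>Derivatives of the translated bump are bounded independently of \<open>v\<close>, and on
  its support \<open>\<bar>x $ i\<bar> \<le> 1 + norm v\<close>. Only the polynomial weight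
  therefore sees the translation, which is the source of the polynomial growth of pairings.\<close>

lemma weighted_deriv_bump_bound:
  fixes \<alpha> :: "'d::finite \<Rightarrow> nat"
  assumes h: "derivative_sequence h" "\<And>n x. x \<notin> {0<..<1} \<Longrightarrow> h n x = 0"
  shows "\<exists>B\<ge>0. \<forall>v x. \<bar>weighted_deriv \<alpha> is (bump_at h v) x\<bar> \<le> B * (1 + norm v) ^ (\<Sum>i\<in>UNIV. \<alpha> i)"
proof -
  have "\<forall>n. \<exists>B\<ge>0. \<forall>x. \<bar>h n x\<bar> \<le> B"
    using derivative_sequence_bounded[OF h] by blast
  then obtain B where B: "\<And>n. 0 \<le> B n" "\<And>n x. \<bar>h n x\<bar> \<le> B n"
    by metis
  let ?B = "\<Prod>i\<in>UNIV. B (count_list is i)"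
  have "\<bar>weighted_deriv \<alpha> is (bump_at h v) x\<bar> \<le> ?B * (1 + norm v) ^ (\<Sum>i\<in>UNIV. \<alpha> i)" for v x
  proof (cases "\<forall>i. x $ i - v $ i \<in> {0<..<1}")
    case True
    have "\<bar>x $ i\<bar> \<le> 1 + norm v" for i
    proof -
      have "\<bar>x $ i - v $ i\<bar> \<le> 1" using True[rule_format, of i] by (simp add: abs_le_iff)
      then show ?thesis using component_le_norm_cart[of v i] by linarith
    qed
    then have "(\<Prod>i\<in>UNIV. \<bar>x $ i\<bar> ^ \<alpha> i) \<le> (\<Prod>i\<in>UNIV. (1 + norm v) ^ \<alpha> i)"
      by (intro prod_mono conjI power_mono) auto
    moreover have "(\<Prod>i\<in>UNIV. \<bar>h (count_list is i) (x $ i - v $ i)\<bar>) \<le> ?B"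
      by (intro prod_mono conjI B) auto
    ultimately have "(\<Prod>i\<in>UNIV. \<bar>x $ i\<bar> ^ \<alpha> i) * (\<Prod>i\<in>UNIV. \<bar>h (count_list is i) (x $ i - v $ i)\<bar>)
        \<le> (\<Prod>i\<in>UNIV. (1 + norm v) ^ \<alpha> i) * ?B"
      by (intro mult_mono) (auto intro!: prod_nonneg)
    then show ?thesis
      by (simp add: weighted_deriv_def partial_derivs_bump[OF h(1)] abs_mult abs_prod power_abs power_sum mult.commute)
  next
    case False
    then obtain i where "x $ i - v $ i \<notin> {0<..<1}" by blast
    from h(2)[OF this] have "partial_derivs is (bump_at h v) x = 0"
      unfolding partial_derivs_bump[OF h(1)] by (intro prod_zero bexI[of _ i]) auto
    then show ?thesis
      using B(1) by (auto simp: weighted_deriv_def intro!: mult_nonneg_nonneg prod_nonneg)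
  qed
  moreover have "0 \<le> ?B" using B(1) by (simp add: prod_nonneg)
  ultimately show ?thesis by blast
qed

lemma bump_schwartz:
  assumes h: "derivative_sequence h" "\<And>n x. x \<notin> {0<..<1} \<Longrightarrow> h n x = 0"
  shows "bump_at h (v :: real ^ 'd::finite) \<in> schwartz_space"
proof -
  have "bounded (range (weighted_deriv \<alpha> is (bump_at h v)))" for \<alpha> "is"
  proof -
    obtain B where "\<And>x. \<bar>weighted_deriv \<alpha> is (bump_at h v) x\<bar> \<le> B * (1 + norm v) ^ (\<Sum>i\<in>UNIV. \<alpha> i)"
      using weighted_deriv_bump_bound[OF h, of \<alpha> "is"] by blast
    then show ?thesis
      by (auto simp: bounded_iff)
  qed
  then show ?thesis
    using smooth_bump[OF h(1)] by (simp add: schwartz_space_def)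
qed

section \<open>Seminorms, neighbourhoods of zero, and growth of pairings with translated
  bumps\<close>

lemma schwartz_seminorm_upper:
  assumes "\<phi> \<in> schwartz_space"
  shows "\<bar>weighted_deriv \<alpha> is \<phi> x\<bar> \<le> schwartz_seminorm \<alpha> is \<phi>"
proof -
  have "bounded (range (weighted_deriv \<alpha> is \<phi>))"
    using assms by (simp add: schwartz_space_def)
  then obtain B where "\<forall>y\<in>range (weighted_deriv \<alpha> is \<phi>). norm y \<le> B"
    unfolding bounded_iff by blast
  then have "bdd_above (range (\<lambda>x. \<bar>weighted_deriv \<alpha> is \<phi> x\<bar>))"
    by (intro bdd_aboveI[of _ B]) auto
  then show ?thesis
    unfolding schwartz_seminorm_def by (rule cSUP_upper[OF UNIV_I])
qed

lemma schwartz_seminorm_least: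
  "(\<And>x. \<bar>weighted_deriv \<alpha> is \<phi> x\<bar> \<le> C) \<Longrightarrow> schwartz_seminorm \<alpha> is \<phi> \<le> C"
  unfolding schwartz_seminorm_def by (rule cSUP_least) auto

lemma schwartz_diff:
  assumes "f \<in> schwartz_space" "g \<in> schwartz_space"
  shows "(\<lambda>x. f x - g x) \<in> schwartz_space"
    and "weighted_deriv \<alpha> is (\<lambda>x. f x - g x) x = weighted_deriv \<alpha> is f x - weighted_deriv \<alpha> is g x"
  using schwartz_linear(1)[OF assms, of 1 "-1"] schwartz_linear(2)[OF assms, of \<alpha> "is" 1 "-1"]
  by (auto simp: fun_eq_iff)

abbreviation seminorm_balls :: "(real ^ 'd \<Rightarrow> real) set set" where
  "seminorm_balls \<equiv> {{\<psi> \<in> schwartz_space. schwartz_seminorm \<alpha> is (\<lambda>x. \<psi> x - \<phi> x) < r} | \<phi> \<alpha> is r.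
     \<phi> \<in> schwartz_space \<and> 0 < r}"

text \<open>Continuity at zero in terms of finitely many seminorms, by induction on how an open set
  is generated from the subbasis. The smallness condition is pointwise so that it can be checked
  without computing suprema.\<close>

lemma schwartz_neighbourhood_zero:
  fixes U :: "(real ^ 'd::finite \<Rightarrow> real) set"
  assumes "generate_topology_on seminorm_balls U" "(\<lambda>_. 0) \<in> U"
  shows "\<exists>F \<delta>. finite F \<and> 0 < \<delta> \<and> (\<forall>\<psi>\<in>schwartz_space.
    (\<forall>(\<alpha>, is)\<in>F. \<forall>x. \<bar>weighted_deriv \<alpha> is \<psi> x\<bar> \<le> \<delta>) \<longrightarrow> \<psi> \<in> U)"
  using assms
proof (induction rule: generate_topology_on.induct)
  case Empty
  then show ?case by simp
next
  case (Int a b)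
  then obtain F G \<delta> \<epsilon> where FG: "finite F" "0 < \<delta>" "finite G" "0 < \<epsilon>"
    and F: "\<And>\<psi>. \<psi> \<in> schwartz_space \<Longrightarrow> (\<forall>(\<alpha>, is)\<in>F. \<forall>x. \<bar>weighted_deriv \<alpha> is \<psi> x\<bar> \<le> \<delta>) \<Longrightarrow> \<psi> \<in> a"
    and G: "\<And>\<psi>. \<psi> \<in> schwartz_space \<Longrightarrow> (\<forall>(\<alpha>, is)\<in>G. \<forall>x. \<bar>weighted_deriv \<alpha> is \<psi> x\<bar> \<le> \<epsilon>) \<Longrightarrow> \<psi> \<in> b"
    by auto
  show ?case
  proof (intro exI conjI ballI impI)
    show "finite (F \<union> G)" "0 < min \<delta> \<epsilon>" using FG by auto
    fix \<psi> :: "real ^ 'd \<Rightarrow> real"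
    assume "\<psi> \<in> schwartz_space" "\<forall>(\<alpha>, is)\<in>F \<union> G. \<forall>x. \<bar>weighted_deriv \<alpha> is \<psi> x\<bar> \<le> min \<delta> \<epsilon>"
    then show "\<psi> \<in> a \<inter> b" by (intro IntI F G) auto
  qed
next
  case (UN K)
  then obtain k where k: "k \<in> K" "(\<lambda>_. 0) \<in> k" by blast
  from UN.IH[OF this] obtain F \<delta> where "finite F" "0 < \<delta>"
    "\<forall>\<psi>\<in>schwartz_space. (\<forall>(\<alpha>, is)\<in>F. \<forall>x. \<bar>weighted_deriv \<alpha> is \<psi> x\<bar> \<le> \<delta>) \<longrightarrow> \<psi> \<in> k"
    by blast
  with k(1) show ?case by (intro exI[of _ F] exI[of _ \<delta>]) blast
next
  case (Basis s)
  then obtain \<phi> \<alpha> "is" r where s: "s = {\<psi> \<in> schwartz_space. schwartz_seminorm \<alpha> is (\<lambda>x. \<psi> x - \<phi> x) < r}"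
    and \<phi>: "\<phi> \<in> schwartz_space" "0 < r"
    by blast
  have zero: "(\<lambda>_. 0 :: real) \<in> (schwartz_space :: (real ^ 'd \<Rightarrow> real) set)" using Basis(2) s by simp
  \<comment> \<open>The subbasic ball need not be centred at zero; \<open>p\<close> measures how far
    away its centre is. Only half of the slack \<open>r - p\<close> is spent, so that the final
    inequality is strict.\<close>
  define p where "p = schwartz_seminorm \<alpha> is (\<lambda>x. 0 - \<phi> x)"
  have "p < r" using Basis(2) by (simp add: s p_def)
  have \<phi>p: "\<bar>weighted_deriv \<alpha> is \<phi> x\<bar> \<le> p" for x
  proof -
    have "weighted_deriv \<alpha> is (\<lambda>_. 0) x = 0"
      using schwartz_diff(2)[OF \<phi>(1) \<phi>(1), of \<alpha> "is" x] by simp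
    then show ?thesis
      using schwartz_seminorm_upper[OF schwartz_diff(1)[OF zero \<phi>(1)], of \<alpha> "is" x]
      unfolding schwartz_diff(2)[OF zero \<phi>(1)] p_def by simp
  qed
  show ?case
  proof (intro exI conjI ballI impI)
    show "finite {(\<alpha>, is)}" "0 < (r - p) / 2" using \<open>p < r\<close> by auto
    fix \<psi> :: "real ^ 'd \<Rightarrow> real"
    assume \<psi>: "\<psi> \<in> schwartz_space" "\<forall>(\<alpha>, is)\<in>{(\<alpha>, is)}. \<forall>x. \<bar>weighted_deriv \<alpha> is \<psi> x\<bar> \<le> (r - p) / 2"
    have "schwartz_seminorm \<alpha> is (\<lambda>x. \<psi> x - \<phi> x) \<le> (r - p) / 2 + p"
    proof (rule schwartz_seminorm_least)
      fix x
      have "\<bar>weighted_deriv \<alpha> is \<psi> x\<bar> \<le> (r - p) / 2" using \<psi>(2) by simp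
      then show "\<bar>weighted_deriv \<alpha> is (\<lambda>x. \<psi> x - \<phi> x) x\<bar> \<le> (r - p) / 2 + p"
        using \<phi>p[of x] unfolding schwartz_diff(2)[OF \<psi>(1) \<phi>(1)] by linarith
    qed
    then show "\<psi> \<in> s" using \<open>p < r\<close> \<psi>(1) by (simp add: s field_simps)
  qed
qed

lemma topspace_schwartz: "topspace (schwartz_topology :: (real ^ 'd::finite \<Rightarrow> real) topology) = schwartz_space"
proof -
  have "\<phi> \<in> \<Union>seminorm_balls" if "\<phi> \<in> schwartz_space" for \<phi> :: "real ^ 'd \<Rightarrow> real"
  proof -
    have "weighted_deriv \<alpha> is (\<lambda>x. \<phi> x - \<phi> x) x = 0" for \<alpha> "is" x
      by (subst schwartz_diff(2)[OF that that]) simp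
    then have "schwartz_seminorm (\<lambda>_. 0) [] (\<lambda>x. \<phi> x - \<phi> x) < 1"
      by (intro le_less_trans[OF schwartz_seminorm_least[of _ _ _ 0]]) auto
    then show ?thesis
      using that by (intro UnionI[of "{\<psi> \<in> schwartz_space. schwartz_seminorm (\<lambda>_. 0) [] (\<lambda>x. \<psi> x - \<phi> x) < 1}"]) fastforce+
  qed
  then show ?thesis
    unfolding schwartz_topology_def topology_generated_by_topspace by blast
qed

lemma tempered_bump_bound:
  fixes T :: "(real ^ 'd::finite \<Rightarrow> real) \<Rightarrow> real"
  assumes h: "derivative_sequence h" "\<And>n x. x \<notin> {0<..<1} \<Longrightarrow> h n x = 0"
    and T: "tempered_distribution T"
  shows "\<exists>C N. \<forall>v. \<bar>T (bump_at h v)\<bar> \<le> C * (1 + norm v) ^ N"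
proof -
  have lin: "T (\<lambda>x. a * \<phi> x + b * \<psi> x) = a * T \<phi> + b * T \<psi>"
    if "\<phi> \<in> schwartz_space" "\<psi> \<in> schwartz_space" for \<phi> \<psi> a b
    using T that by (simp add: tempered_distribution_def)
  let ?b = "bump_at h :: real ^ 'd \<Rightarrow> real ^ 'd \<Rightarrow> real"
  have S: "?b v \<in> schwartz_space" for v
    using h by (rule bump_schwartz)
  have zero: "(\<lambda>_. 0) \<in> (schwartz_space :: (real ^ 'd \<Rightarrow> real) set)" "T (\<lambda>_. 0) = 0"
    using schwartz_linear(1)[OF S S, of 0 _ 0] lin[OF S S, of 0 _ 0] by auto
  let ?U = "{\<phi> \<in> topspace schwartz_topology. T \<phi> \<in> ball 0 1}"
  have "openin schwartz_topology ?U"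
    using T by (intro openin_continuous_map_preimage[of _ euclideanreal]) (auto simp: tempered_distribution_def)
  then have "generate_topology_on seminorm_balls ?U"
    unfolding schwartz_topology_def by (rule openin_topology_generated_by)
  moreover have "(\<lambda>_. 0) \<in> ?U"
    using zero by (simp add: topspace_schwartz)
  ultimately have "\<exists>F \<delta>. finite F \<and> 0 < \<delta> \<and> (\<forall>\<psi>\<in>schwartz_space.
      (\<forall>(\<alpha>, is)\<in>F. \<forall>x. \<bar>weighted_deriv \<alpha> is \<psi> x\<bar> \<le> \<delta>) \<longrightarrow> \<psi> \<in> ?U)"
    by (rule schwartz_neighbourhood_zero)
  then obtain F \<delta> where F: "finite F" "0 < \<delta>" and
    U: "\<And>\<psi>. \<psi> \<in> schwartz_space \<Longrightarrow> (\<forall>(\<alpha>, is)\<in>F. \<forall>x. \<bar>weighted_deriv \<alpha> is \<psi> x\<bar> \<le> \<delta>) \<Longrightarrow> \<psi> \<in> ?U"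
    by blast
  have "\<forall>q. \<exists>B\<ge>0. \<forall>v x. \<bar>weighted_deriv (fst q) (snd q) (?b v) x\<bar> \<le> B * (1 + norm v) ^ (\<Sum>i\<in>UNIV. fst q i)"
    using weighted_deriv_bump_bound[OF h] by blast
  then obtain B where B: "\<And>q. 0 \<le> B q"
    "\<And>q v x. \<bar>weighted_deriv (fst q) (snd q) (?b v) x\<bar> \<le> B q * (1 + norm v) ^ (\<Sum>i\<in>UNIV. fst q i)"
    by metis
  \<comment> \<open>The summand 1 keeps \<open>K\<close> positive even when \<open>F\<close> is
    empty.\<close>
  define K where "K = 1 + (\<Sum>q\<in>F. B q)"
  define N where "N = (\<Sum>q\<in>F. \<Sum>i\<in>UNIV. fst q i)"
  have "K > 0" using B(1) by (simp add: K_def add_pos_nonneg sum_nonneg)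
  have "\<bar>T (?b v)\<bar> \<le> K / \<delta> * (1 + norm v) ^ N" for v
  proof -
    \<comment> \<open>The largest scaling that the bounds \<open>B\<close> certainly allow:
      \<open>c * K * (1 + norm v) ^ N = \<delta>\<close>. Linearity then turns
      \<open>\<bar>T\<bar> < 1\<close> on the neighbourhood into the bound
      \<open>1 / c\<close>.\<close>
    define c where "c = \<delta> / (K * (1 + norm v) ^ N)"
    have c: "c > 0" using \<open>K > 0\<close> F by (simp add: c_def add_pos_nonneg)
    \<comment> \<open>The vanishing second term gives the scaled bump the two-term form for which
      linearity is stated.\<close>
    let ?\<psi> = "\<lambda>x. c * ?b v x + 0 * ?b v x"
    have "?\<psi> \<in> ?U"
    proof (rule U[OF schwartz_linear(1)[OF S S]], safe)
      fix \<alpha> "is" x assume q: "(\<alpha>, is) \<in> F"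
      have BK: "B (\<alpha>, is) \<le> K"
        using member_le_sum[OF q, of B] B(1) F by (simp add: K_def)
      have "(\<Sum>i\<in>UNIV. \<alpha> i) \<le> N"
        using member_le_sum[OF q, of "\<lambda>q. \<Sum>i\<in>UNIV. fst q i"] F by (simp add: N_def)
      then have "(1 + norm v) ^ (\<Sum>i\<in>UNIV. \<alpha> i) \<le> (1 + norm v) ^ N"
        by (intro power_increasing) auto
      then have "B (\<alpha>, is) * (1 + norm v) ^ (\<Sum>i\<in>UNIV. \<alpha> i) \<le> K * (1 + norm v) ^ N"
        using BK B(1)[of "(\<alpha>, is)"] by (intro mult_mono) auto
      then have "\<bar>weighted_deriv \<alpha> is (?b v) x\<bar> \<le> K * (1 + norm v) ^ N"
        using B(2)[of "(\<alpha>, is)" v x] by simp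
      then have "c * \<bar>weighted_deriv \<alpha> is (?b v) x\<bar> \<le> c * (K * (1 + norm v) ^ N)"
        using c by (intro mult_left_mono) auto
      moreover have "c * (K * (1 + norm v) ^ N) = \<delta>"
        using \<open>K > 0\<close> by (simp add: c_def add_pos_nonneg less_imp_neq[symmetric])
      ultimately show "\<bar>weighted_deriv \<alpha> is ?\<psi> x\<bar> \<le> \<delta>"
        using c by (simp only: schwartz_linear(2)[OF S S]) (simp add: abs_mult)
    qed
    then have "\<bar>c * T (?b v)\<bar> < 1"
      using lin[OF S S, of c v 0 v] by (simp add: dist_real_def)
    then have "\<bar>T (?b v)\<bar> < 1 / c"
      using c by (simp add: abs_mult field_simps)
    then show ?thesis by (simp add: c_def)
  qed
  then show ?thesis by blast
qed

section \<open>Decay of Schwartz functions and temperedness of polynomially bounded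
  densities\<close>

lemma integrable_prod_weight: "integrable lborel (\<lambda>t :: real ^ 'd::finite. \<Prod>i\<in>UNIV. inverse (1 + (t $ i)\<^sup>2))"
proof (rule integrableI_bounded)
  show "(\<lambda>t :: real ^ 'd. \<Prod>i\<in>UNIV. inverse (1 + (t $ i)\<^sup>2)) \<in> borel_measurable lborel"
    by measurable
  have "integrable lborel (\<lambda>x :: real. inverse (1 + x\<^sup>2))"
    using integrable_inverse_1_plus_square by (simp add: set_integrable_def einterval_def)
  then have fin: "(\<integral>\<^sup>+x. ennreal (inverse (1 + x\<^sup>2)) \<partial>(lborel :: real measure)) < \<infinity>"
    by (simp add: integrable_iff_bounded)
  have "(\<integral>\<^sup>+t. ennreal (norm (\<Prod>i\<in>UNIV. inverse (1 + (t $ i)\<^sup>2))) \<partial>(lborel :: (real ^ 'd) measure)) =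
      (\<integral>\<^sup>+t. (\<Prod>b\<in>Basis. ennreal (inverse (1 + (t \<bullet> b)\<^sup>2))) \<partial>(lborel :: (real ^ 'd) measure))"
  proof (rule nn_integral_cong)
    fix t :: "real ^ 'd"
    have B: "Basis = (\<lambda>i. axis i (1 :: real)) ` (UNIV :: 'd set)"
      by (auto simp: Basis_vec_def)
    have inj: "inj (\<lambda>i :: 'd. axis i (1 :: real))"
      by (auto simp: inj_on_def axis_eq_axis)
    have "(\<Prod>b\<in>Basis. ennreal (inverse (1 + (t \<bullet> b)\<^sup>2))) = (\<Prod>i\<in>UNIV. ennreal (inverse (1 + (t $ i)\<^sup>2)))"
      unfolding B by (subst prod.reindex[OF inj]) (simp add: inner_axis)
    then show "ennreal (norm (\<Prod>i\<in>UNIV. inverse (1 + (t $ i)\<^sup>2))) = (\<Prod>b\<in>Basis. ennreal (inverse (1 + (t \<bullet> b)\<^sup>2)))"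
      by (simp add: abs_prod prod_ennreal)
  qed
  also have "\<dots> = (\<Prod>b\<in>(Basis :: (real ^ 'd) set). \<integral>\<^sup>+x. ennreal (inverse (1 + x\<^sup>2)) \<partial>(lborel :: real measure))"
    by (rule nn_integral_lborel_prod) auto
  also have "\<dots> < \<infinity>"
    using fin by (simp add: power_less_top_ennreal)
  finally show "(\<integral>\<^sup>+t. ennreal (norm (\<Prod>i\<in>UNIV. inverse (1 + (t $ i)\<^sup>2))) \<partial>(lborel :: (real ^ 'd) measure)) < \<infinity>" .
qed

text \<open>
  A Schwartz function is controlled at \<open>t\<close> by the weight \<open>\<bar>t\<^sub>i\<bar> ^ M\<close> in exactly those coordinates
  \<open>i \<in> A\<close> with \<open>\<bar>t\<^sub>i\<bar> \<ge> 1\<close>.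
\<close>

definition cut_index :: "nat \<Rightarrow> 'd set \<Rightarrow> 'd \<Rightarrow> nat" where
  "cut_index M A i = (if i \<in> A then M else 0)"

lemma one_plus_sum_le_prod:
  fixes f :: "'a \<Rightarrow> real"
  assumes "finite I" "\<And>i. i \<in> I \<Longrightarrow> 0 \<le> f i"
  shows "1 + (\<Sum>i\<in>I. f i) \<le> (\<Prod>i\<in>I. 1 + f i)"
  using assms
proof (induction I rule: finite_induct)
  case (insert i I)
  have "1 + (\<Sum>i\<in>insert i I. f i) \<le> (1 + f i) * (1 + (\<Sum>i\<in>I. f i))"
    using insert by (simp add: algebra_simps sum_nonneg)
  also have "\<dots> \<le> (1 + f i) * (\<Prod>i\<in>I. 1 + f i)"
    using insert by (intro mult_left_mono) auto
  finally show ?case using insert by simp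
qed simp

text \<open>Of the exponent \<open>N + 2\<close>, \<open>N\<close> powers absorb the growth of a
  density and two leave an integrable weight. The set of large coordinates depends on
  \<open>t\<close>, so the sum over all \<open>A\<close> makes the constant uniform. The powers of 2
  come from \<open>1 + \<bar>t $ i\<bar> \<le> 2 * max 1 \<bar>t $ i\<bar>\<close> in each
  coordinate.\<close>

lemma schwartz_decay:
  fixes \<phi> :: "real ^ 'd::finite \<Rightarrow> real"
  assumes "\<phi> \<in> schwartz_space"
  shows "(1 + norm t) ^ N * \<bar>\<phi> t\<bar> \<le>
    2 ^ (CARD('d) * (N + 2)) * (\<Sum>A\<in>UNIV. schwartz_seminorm (cut_index (N + 2) A) [] \<phi>) *
    (\<Prod>i\<in>UNIV. inverse (1 + (t $ i)\<^sup>2))"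
proof -
  let ?w = "\<Prod>i\<in>UNIV. 1 + \<bar>t $ i\<bar>" and ?M = "N + 2"
  let ?v = "\<Prod>i\<in>UNIV. 1 + (t $ i)\<^sup>2"
  let ?A = "{i. 1 \<le> \<bar>t $ i\<bar>}"
  have w: "?w \<ge> 1" by (rule prod_ge_1) simp
  have "norm t \<le> (\<Sum>i\<in>UNIV. \<bar>t $ i\<bar>)" by (rule norm_le_l1_cart)
  moreover have "1 + (\<Sum>i\<in>UNIV. \<bar>t $ i\<bar>) \<le> ?w"
    by (rule one_plus_sum_le_prod) auto
  ultimately have nw: "1 + norm t \<le> ?w" by linarith
  have vw: "?v \<le> ?w ^ 2"
    unfolding prod_power_distrib
    by (intro prod_mono) (auto simp: power2_eq_square algebra_simps)
  have "?w ^ ?M \<le> (\<Prod>i\<in>UNIV. 2 ^ ?M * \<bar>t $ i\<bar> ^ cut_index ?M ?A i)"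
    unfolding prod_power_distrib
  proof (intro prod_mono conjI)
    fix i
    show "(1 + \<bar>t $ i\<bar>) ^ ?M \<le> 2 ^ ?M * \<bar>t $ i\<bar> ^ cut_index ?M ?A i"
    proof (cases "1 \<le> \<bar>t $ i\<bar>")
      case True
      then have "(1 + \<bar>t $ i\<bar>) ^ ?M \<le> (2 * \<bar>t $ i\<bar>) ^ ?M" by (intro power_mono) auto
      then show ?thesis using True by (simp only: power_mult_distrib) (simp add: cut_index_def)
    next
      case False
      then have "(1 + \<bar>t $ i\<bar>) ^ ?M \<le> 2 ^ ?M" by (intro power_mono) auto
      then show ?thesis using False by (simp add: cut_index_def)
    qed
  qed simp
  also have "\<dots> = 2 ^ (CARD('d) * ?M) * (\<Prod>i\<in>UNIV. \<bar>t $ i\<bar> ^ cut_index ?M ?A i)"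
    by (simp only: prod.distrib prod_constant power_mult[symmetric] mult.commute[of ?M])
  finally have "?w ^ ?M * \<bar>\<phi> t\<bar> \<le> 2 ^ (CARD('d) * ?M) * (\<Prod>i\<in>UNIV. \<bar>t $ i\<bar> ^ cut_index ?M ?A i) * \<bar>\<phi> t\<bar>"
    by (rule mult_right_mono) simp
  also have "\<dots> = 2 ^ (CARD('d) * ?M) * \<bar>weighted_deriv (cut_index ?M ?A) [] \<phi> t\<bar>"
    by (simp add: weighted_deriv_def partial_derivs_def abs_mult abs_prod power_abs)
  also have "\<dots> \<le> 2 ^ (CARD('d) * ?M) * schwartz_seminorm (cut_index ?M ?A) [] \<phi>"
    by (intro mult_left_mono schwartz_seminorm_upper[OF assms]) simp
  also have "\<dots> \<le> 2 ^ (CARD('d) * ?M) * (\<Sum>A\<in>UNIV. schwartz_seminorm (cut_index ?M A) [] \<phi>)"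
  proof (intro mult_left_mono member_le_sum)
    show "0 \<le> schwartz_seminorm (cut_index ?M A) [] \<phi>" for A
      using schwartz_seminorm_upper[OF assms, of _ _ t] by (meson abs_ge_zero order_trans)
  qed auto
  finally have 1: "?w ^ ?M * \<bar>\<phi> t\<bar> \<le> 2 ^ (CARD('d) * ?M) * (\<Sum>A\<in>UNIV. schwartz_seminorm (cut_index ?M A) [] \<phi>)" .
  have "?v > 0" by (intro prod_pos) (auto intro: add_pos_nonneg)
  have "(1 + norm t) ^ N * \<bar>\<phi> t\<bar> * ?v \<le> ?w ^ N * \<bar>\<phi> t\<bar> * ?w ^ 2"
    using nw vw w \<open>?v > 0\<close> by (intro mult_mono power_mono) auto
  also have "\<dots> = ?w ^ ?M * \<bar>\<phi> t\<bar>" by (simp only: power_add mult_ac)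
  also note 1
  finally have "(1 + norm t) ^ N * \<bar>\<phi> t\<bar> \<le>
      2 ^ (CARD('d) * ?M) * (\<Sum>A\<in>UNIV. schwartz_seminorm (cut_index ?M A) [] \<phi>) / ?v"
    by (subst pos_le_divide_eq[OF \<open>?v > 0\<close>])
  also have "\<dots> = 2 ^ (CARD('d) * ?M) * (\<Sum>A\<in>UNIV. schwartz_seminorm (cut_index ?M A) [] \<phi>) *
      (\<Prod>i\<in>UNIV. inverse (1 + (t $ i)\<^sup>2))"
    using prod_inversef[of "\<lambda>i. 1 + (t $ i)\<^sup>2" UNIV] by (simp only: o_def divide_inverse)
  finally show ?thesis .
qed

lemma schwartz_measurable:
  assumes "\<phi> \<in> schwartz_space"
  shows "\<phi> \<in> borel_measurable borel"
proof -
  have "\<phi> differentiable_on UNIV"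
    using assms unfolding schwartz_space_def smooth_def
    by (auto dest: spec[of _ "[]"] simp: partial_derivs_def)
  then show ?thesis
    by (intro borel_measurable_continuous_onI differentiable_imp_continuous_on)
qed

lemma poly_bounded_tempered:
  fixes f :: "real ^ 'd::finite \<Rightarrow> real"
  assumes meas: "(\<lambda>t. indicator orthant t * f t) \<in> borel_measurable borel"
    and bound: "\<And>t. t \<in> orthant \<Longrightarrow> \<bar>f t\<bar> \<le> C * (1 + norm t) ^ N"
  shows "\<forall>\<phi>\<in>schwartz_space. set_integrable lborel orthant (\<lambda>t. f t * \<phi> t)"
    and "tempered_distribution (\<lambda>\<phi>. LINT t:orthant|lborel. f t * \<phi> t)"
proof -
  let ?w = "\<lambda>t :: real ^ 'd. \<Prod>i\<in>UNIV. inverse (1 + (t $ i)\<^sup>2)"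
  let ?Q = "\<lambda>\<phi>. \<Sum>A\<in>UNIV. schwartz_seminorm (cut_index (N + 2) A) [] \<phi>"
  let ?T = "\<lambda>\<phi>. LINT t:orthant|lborel. f t * \<phi> t"
  define K where "K = \<bar>C\<bar> * 2 ^ (CARD('d) * (N + 2))"
  have K: "0 \<le> K" by (simp add: K_def)
  have le: "\<bar>indicator orthant t * (f t * \<phi> t)\<bar> \<le> K * ?Q \<phi> * ?w t" if "\<phi> \<in> schwartz_space" for \<phi> t
  proof -
    have "\<bar>indicator orthant t * (f t * \<phi> t)\<bar> \<le> \<bar>C\<bar> * (1 + norm t) ^ N * \<bar>\<phi> t\<bar>"
    proof (cases "t \<in> orthant")
      case True
      have "\<bar>f t\<bar> \<le> \<bar>C\<bar> * (1 + norm t) ^ N"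
        using bound[OF True] by (rule order_trans) (intro mult_right_mono, auto)
      then show ?thesis using True by (simp add: abs_mult mult_right_mono)
    qed simp
    also have "\<dots> \<le> \<bar>C\<bar> * (2 ^ (CARD('d) * (N + 2)) * ?Q \<phi> * ?w t)"
      using schwartz_decay[OF that, of t N] by (simp only: mult.assoc mult_left_mono abs_ge_zero)
    finally show ?thesis by (simp add: K_def mult_ac)
  qed
  have int: "set_integrable lborel orthant (\<lambda>t. f t * \<phi> t)" if "\<phi> \<in> schwartz_space" for \<phi>
    unfolding set_integrable_def
  proof (rule Bochner_Integration.integrable_bound)
    show "integrable lborel (\<lambda>t. K * ?Q \<phi> * ?w t)"
      by (intro integrable_mult_right integrable_prod_weight)
    have "(\<lambda>t. (indicator orthant t * f t) * \<phi> t) \<in> borel_measurable borel"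
      using meas schwartz_measurable[OF that] by (rule borel_measurable_times)
    then show "(\<lambda>t. indicator orthant t *\<^sub>R (f t * \<phi> t)) \<in> borel_measurable lborel"
      by (simp add: mult.assoc)
    show "AE t in lborel. norm (indicator orthant t *\<^sub>R (f t * \<phi> t)) \<le> norm (K * ?Q \<phi> * ?w t)"
    proof (rule AE_I2)
      fix t
      show "norm (indicator orthant t *\<^sub>R (f t * \<phi> t)) \<le> norm (K * ?Q \<phi> * ?w t)"
        using le[OF that, of t] by simp
    qed
  qed
  then show "\<forall>\<phi>\<in>schwartz_space. set_integrable lborel orthant (\<lambda>t. f t * \<phi> t)" by blast
  have lin: "?T (\<lambda>x. a * \<phi> x + b * \<psi> x) = a * ?T \<phi> + b * ?T \<psi>"
    if "\<phi> \<in> schwartz_space" "\<psi> \<in> schwartz_space" for \<phi> \<psi> a b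
  proof -
    have "?T (\<lambda>x. a * \<phi> x + b * \<psi> x) = (LINT t:orthant|lborel. a * (f t * \<phi> t) + b * (f t * \<psi> t))"
      by (simp add: algebra_simps)
    also have "\<dots> = (LINT t:orthant|lborel. a * (f t * \<phi> t)) + (LINT t:orthant|lborel. b * (f t * \<psi> t))"
      using int that by (intro set_integral_add set_integrable_mult_right) auto
    finally show ?thesis by simp
  qed
  define I where "I = K * (LINT t|lborel. ?w t)"
  have I: "0 \<le> I"
    unfolding I_def by (intro mult_nonneg_nonneg integral_nonneg_AE K AE_I2 prod_nonneg) (auto simp: add_nonneg_nonneg)
  have T: "\<bar>?T \<phi>\<bar> \<le> I * ?Q \<phi>" if "\<phi> \<in> schwartz_space" for \<phi>
  proof -
    have "\<bar>?T \<phi>\<bar> \<le> (LINT t|lborel. K * ?Q \<phi> * ?w t)"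
      unfolding set_lebesgue_integral_def real_norm_def[symmetric]
      by (rule Bochner_Integration.integral_norm_bound_integral)
         (use int[OF that] le[OF that] in \<open>auto simp: set_integrable_def intro!: integrable_mult_right integrable_prod_weight\<close>)
    also have "\<dots> = I * ?Q \<phi>" by (simp add: I_def mult_ac)
    finally show ?thesis .
  qed
  have "openin schwartz_topology {\<phi> \<in> topspace schwartz_topology. ?T \<phi> \<in> U}" if "openin euclideanreal U" for U
  proof (subst openin_subopen, safe)
    fix \<phi> assume \<phi>': "\<phi> \<in> topspace (schwartz_topology :: (real ^ 'd \<Rightarrow> real) topology)" "?T \<phi> \<in> U"
    then have \<phi>: "\<phi> \<in> schwartz_space" by (simp add: topspace_schwartz)
    obtain e where e: "e > 0" "ball (?T \<phi>) e \<subseteq> U"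
      using \<open>openin euclideanreal U\<close> \<phi>'(2) by (auto simp: open_contains_ball)
    \<comment> \<open>Here \<open>2 ^ CARD('d)\<close> counts the sets \<open>A\<close>, that is,
      the seminorms added up in \<open>?Q\<close>; \<open>I + 1\<close> instead of \<open>I\<close>
      avoids a zero denominator.\<close>
    define r where "r = e / ((I + 1) * 2 ^ CARD('d))"
    have r: "r > 0" using e I by (simp add: r_def)
    let ?V = "\<lambda>A. {\<psi> \<in> schwartz_space. schwartz_seminorm (cut_index (N + 2) A) [] (\<lambda>x. \<psi> x - \<phi> x) < r}"
    let ?W = "\<Inter>(?V ` (UNIV :: 'd set set))"
    have "openin schwartz_topology (?V A)" for A :: "'d set"
    proof -
      have "?V A \<in> seminorm_balls" using \<phi> r by blast
      then show ?thesis
        unfolding schwartz_topology_def by (rule topology_generated_by_Basis)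
    qed
    then have "openin schwartz_topology ?W"
      by (intro openin_Inter) auto
    moreover have "\<phi> \<in> ?W"
    proof safe
      fix A
      have "weighted_deriv \<alpha> is (\<lambda>x. \<phi> x - \<phi> x) x = 0" for \<alpha> "is" x
        by (subst schwartz_diff(2)[OF \<phi> \<phi>]) simp
      then show "schwartz_seminorm (cut_index (N + 2) A) [] (\<lambda>x. \<phi> x - \<phi> x) < r"
        using r by (intro le_less_trans[OF schwartz_seminorm_least[of _ _ _ 0]]) auto
    qed (use \<phi> in auto)
    moreover have "?W \<subseteq> {\<phi> \<in> topspace schwartz_topology. ?T \<phi> \<in> U}"
    proof
      fix \<psi> assume \<psi>W: "\<psi> \<in> ?W"
      then have \<psi>: "\<psi> \<in> schwartz_space" by auto
      let ?d = "\<lambda>x. \<psi> x - \<phi> x"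
      have "?Q ?d \<le> (\<Sum>A\<in>(UNIV :: 'd set set). r)"
        using \<psi>W by (intro sum_mono) (auto intro: less_imp_le)
      then have "?Q ?d \<le> 2 ^ CARD('d) * r" by (simp add: card_Pow flip: Pow_UNIV)
      then have "I * ?Q ?d \<le> I * (2 ^ CARD('d) * r)" using I by (rule mult_left_mono)
      also have "\<dots> = I / (I + 1) * e" by (simp add: r_def)
      also have "\<dots> < 1 * e" using e I by (intro mult_strict_right_mono) (auto simp: field_simps)
      finally have "\<bar>?T ?d\<bar> < e" using T[OF schwartz_diff(1)[OF \<psi> \<phi>]] by linarith
      moreover have "?T ?d = ?T \<psi> - ?T \<phi>"
        using lin[OF \<psi> \<phi>, of 1 "-1"] by simp
      ultimately have "?T \<psi> \<in> U" using e(2) by (auto simp: dist_real_def abs_minus_commute subset_iff)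
      then show "\<psi> \<in> {\<phi> \<in> topspace schwartz_topology. ?T \<phi> \<in> U}"
        using \<psi> by (simp add: topspace_schwartz)
    qed
    ultimately show "\<exists>W. openin schwartz_topology W \<and> \<phi> \<in> W \<and> W \<subseteq> {\<phi> \<in> topspace schwartz_topology. ?T \<phi> \<in> U}"
      by blast
  qed
  then have "continuous_map schwartz_topology euclideanreal ?T"
    by (auto simp: continuous_map_def)
  then show "tempered_distribution ?T"
    using lin by (simp add: tempered_distribution_def)
qed

section \<open>A multiparameter maximal inequality\<close>

context prob_space
begin

section \<open>Events and linear combinations built from disjoint groups of independent
  variables\<close>

lemma indep_blocks:
  assumes Z: "indep_vars (\<lambda>_. borel) Z I" and AB: "A \<inter> B = {}" "A \<subseteq> I" "B \<subseteq> I"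
    and P: "{x \<in> space (PiM A (\<lambda>_. borel)). P x} \<in> sets (PiM A (\<lambda>_. borel))"
    and Q: "{x \<in> space (PiM B (\<lambda>_. borel)). Q x} \<in> sets (PiM B (\<lambda>_. borel))"
  shows "prob {\<omega> \<in> space M. P (\<lambda>i\<in>A. Z i \<omega>) \<and> Q (\<lambda>i\<in>B. Z i \<omega>)} =
    prob {\<omega> \<in> space M. P (\<lambda>i\<in>A. Z i \<omega>)} * prob {\<omega> \<in> space M. Q (\<lambda>i\<in>B. Z i \<omega>)}"
proof -
  note ind = indep_var_restrict[OF Z AB]
  have rv: "(\<lambda>\<omega>. \<lambda>i\<in>A. Z i \<omega>) \<in> M \<rightarrow>\<^sub>M PiM A (\<lambda>_. borel)" "(\<lambda>\<omega>. \<lambda>i\<in>B. Z i \<omega>) \<in> M \<rightarrow>\<^sub>M PiM B (\<lambda>_. borel)"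
    using indep_var_rv1[OF ind] indep_var_rv2[OF ind] by auto
  let ?P = "{x \<in> space (PiM A (\<lambda>_. borel)). P x}" and ?Q = "{x \<in> space (PiM B (\<lambda>_. borel)). Q x}"
  have "{\<omega> \<in> space M. P (\<lambda>i\<in>A. Z i \<omega>)} = (\<lambda>\<omega>. \<lambda>i\<in>A. Z i \<omega>) -` ?P \<inter> space M"
       "{\<omega> \<in> space M. Q (\<lambda>i\<in>B. Z i \<omega>)} = (\<lambda>\<omega>. \<lambda>i\<in>B. Z i \<omega>) -` ?Q \<inter> space M"
       "{\<omega> \<in> space M. P (\<lambda>i\<in>A. Z i \<omega>) \<and> Q (\<lambda>i\<in>B. Z i \<omega>)} =
          (\<lambda>\<omega>. ((\<lambda>i\<in>A. Z i \<omega>), (\<lambda>i\<in>B. Z i \<omega>))) -` (?P \<times> ?Q) \<inter> space M"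
    using measurable_space[OF rv(1)] measurable_space[OF rv(2)] by auto
  then show ?thesis
    using indep_varD[OF ind P Q] by simp
qed

text \<open>Besides grouping cells into blocks, this transports independence along an injective
  reindexing, by taking singletons for \<open>K j\<close>.\<close>

lemma indep_vars_linear:
  fixes Z :: "'i \<Rightarrow> 'a \<Rightarrow> real"
  assumes Z: "indep_vars (\<lambda>_. borel) Z I" and K: "\<And>j. j \<in> L \<Longrightarrow> K j \<subseteq> I" "disjoint_family_on K L"
  shows "indep_vars (\<lambda>_. borel) (\<lambda>j \<omega>. \<Sum>i\<in>K j. v j i * Z i \<omega>) L"
proof -
  have "indep_vars (\<lambda>_. borel) (\<lambda>j \<omega>. (\<lambda>x. \<Sum>i\<in>K j. v j i * x i) (\<lambda>i\<in>K j. Z i \<omega>)) L"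
    by (rule indep_vars_compose2[OF indep_vars_restrict[OF Z K]]) auto
  then show ?thesis
    by (rule indep_vars_cong[THEN iffD1, rotated -1]) (auto intro!: sum.cong)
qed

text \<open>If the first sum is at least \<open>2 * a\<close> and the second at most
  \<open>a\<close> in absolute value, the total is at least \<open>a\<close>. With a lower bound for
  the second probability, the tail of a part is controlled by the tail of the whole.\<close>

lemma indep_linear_pair:
  fixes Z :: "'i \<Rightarrow> 'a \<Rightarrow> real"
  assumes Z: "indep_vars (\<lambda>_. borel) Z I" and AB: "A \<inter> B = {}" "A \<subseteq> I" "B \<subseteq> I"
  shows "prob {\<omega> \<in> space M. \<bar>\<Sum>i\<in>A. u i * Z i \<omega>\<bar> \<ge> 2 * a} * prob {\<omega> \<in> space M. \<bar>\<Sum>i\<in>B. v i * Z i \<omega>\<bar> \<le> a} \<le>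
    prob {\<omega> \<in> space M. \<bar>(\<Sum>i\<in>A. u i * Z i \<omega>) + (\<Sum>i\<in>B. v i * Z i \<omega>)\<bar> \<ge> a}"
proof -
  let ?P = "\<lambda>x. \<bar>\<Sum>i\<in>A. u i * x i\<bar> \<ge> 2 * a" and ?Q = "\<lambda>x. \<bar>\<Sum>i\<in>B. v i * x i\<bar> \<le> a"
  have rv: "i \<in> I \<Longrightarrow> Z i \<in> borel_measurable M" for i
    using Z by (simp add: indep_vars_def)
  have [measurable]: "(\<lambda>\<omega>. \<Sum>i\<in>A. u i * Z i \<omega>) \<in> borel_measurable M" "(\<lambda>\<omega>. \<Sum>i\<in>B. v i * Z i \<omega>) \<in> borel_measurable M"
    using AB by (auto intro!: borel_measurable_sum borel_measurable_times rv)
  have "prob {\<omega> \<in> space M. ?P (\<lambda>i\<in>A. Z i \<omega>)} * prob {\<omega> \<in> space M. ?Q (\<lambda>i\<in>B. Z i \<omega>)} =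
      prob {\<omega> \<in> space M. ?P (\<lambda>i\<in>A. Z i \<omega>) \<and> ?Q (\<lambda>i\<in>B. Z i \<omega>)}"
    by (rule indep_blocks[OF Z AB, symmetric]) measurable
  also have "\<dots> = prob {\<omega> \<in> space M. \<bar>\<Sum>i\<in>A. u i * Z i \<omega>\<bar> \<ge> 2 * a \<and> \<bar>\<Sum>i\<in>B. v i * Z i \<omega>\<bar> \<le> a}"
    by simp
  also have "\<dots> \<le> prob {\<omega> \<in> space M. \<bar>(\<Sum>i\<in>A. u i * Z i \<omega>) + (\<Sum>i\<in>B. v i * Z i \<omega>)\<bar> \<ge> a}"
    by (intro finite_measure_mono) auto
  finally show ?thesis by simp
qed

text \<open>Independence makes the joint law the product of the marginals, so equality cell by cell
  extends to combinations of cells that do not form a box.\<close>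

lemma distr_linear_eq:
  fixes Y Z :: "'i \<Rightarrow> 'a \<Rightarrow> real"
  assumes Y: "indep_vars (\<lambda>_. borel) Y I" and Z: "indep_vars (\<lambda>_. borel) Z I" and I: "finite I"
    and eq: "\<And>i. i \<in> I \<Longrightarrow> distr M borel (Y i) = distr M borel (Z i)"
  shows "distr M borel (\<lambda>\<omega>. \<Sum>i\<in>I. v i * Y i \<omega>) = distr M borel (\<lambda>\<omega>. \<Sum>i\<in>I. v i * Z i \<omega>)"
proof (cases "I = {}")
  case False
  have rv: "i \<in> I \<Longrightarrow> Y i \<in> borel_measurable M" "i \<in> I \<Longrightarrow> Z i \<in> borel_measurable M" for i
    using Y Z by (auto simp: indep_vars_def)
  let ?N = "PiM I (\<lambda>_. borel) :: ('i \<Rightarrow> real) measure"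
  have "distr M ?N (\<lambda>\<omega>. \<lambda>i\<in>I. Y i \<omega>) = (\<Pi>\<^sub>M i\<in>I. distr M borel (Y i))"
    by (rule indep_vars_iff_distr_eq_PiM'[OF False, THEN iffD1, OF rv(1) Y])
  also have "\<dots> = (\<Pi>\<^sub>M i\<in>I. distr M borel (Z i))"
    using eq by (intro PiM_cong) auto
  also have "\<dots> = distr M ?N (\<lambda>\<omega>. \<lambda>i\<in>I. Z i \<omega>)"
    by (rule indep_vars_iff_distr_eq_PiM'[OF False, THEN iffD1, OF rv(2) Z, symmetric])
  finally have "distr (distr M ?N (\<lambda>\<omega>. \<lambda>i\<in>I. Y i \<omega>)) borel (\<lambda>x. \<Sum>i\<in>I. v i * x i) =
      distr (distr M ?N (\<lambda>\<omega>. \<lambda>i\<in>I. Z i \<omega>)) borel (\<lambda>x. \<Sum>i\<in>I. v i * x i)"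
    by simp
  then show ?thesis
    using rv by (subst (asm) (1 2) distr_distr) (auto simp: o_def intro!: measurable_restrict)
qed simp

text \<open>A walk of vectors with coordinates \<open>q\<close> is stopped when some coordinate
  first reaches \<open>3 * b\<close>. If that same coordinate ends below \<open>b\<close>, it has
  moved by more than \<open>2 * b\<close> since. The end value costs one \<open>p\<close>. The later
  displacement costs \<open>2 * p\<close>, because it forces the walk to be large either at
  \<open>n\<close> or at \<open>j\<close>; the first-passage events are disjoint, so their
  probabilities add up to at most 1.\<close>

lemma etemadi:
  fixes V :: "nat \<Rightarrow> 'q \<Rightarrow> 'a \<Rightarrow> real"
  assumes Q: "finite Q"
    and rv [measurable]: "\<And>j q. j \<le> n \<Longrightarrow> q \<in> Q \<Longrightarrow> V j q \<in> borel_measurable M"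
    and ind: "\<And>j. j \<le> n \<Longrightarrow>
      prob {\<omega> \<in> space M. ((\<exists>q\<in>Q. 3 * b \<le> \<bar>V j q \<omega>\<bar>) \<and> (\<forall>l<j. \<forall>q\<in>Q. \<bar>V l q \<omega>\<bar> < 3 * b)) \<and> (\<exists>q\<in>Q. 2 * b < \<bar>V n q \<omega> - V j q \<omega>\<bar>)} =
      prob {\<omega> \<in> space M. (\<exists>q\<in>Q. 3 * b \<le> \<bar>V j q \<omega>\<bar>) \<and> (\<forall>l<j. \<forall>q\<in>Q. \<bar>V l q \<omega>\<bar> < 3 * b)} *
      prob {\<omega> \<in> space M. \<exists>q\<in>Q. 2 * b < \<bar>V n q \<omega> - V j q \<omega>\<bar>}"
    and p: "\<And>j. j \<le> n \<Longrightarrow> prob {\<omega> \<in> space M. \<exists>q\<in>Q. b \<le> \<bar>V j q \<omega>\<bar>} \<le> p"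
  shows "prob {\<omega> \<in> space M. \<exists>j\<le>n. \<exists>q\<in>Q. 3 * b \<le> \<bar>V j q \<omega>\<bar>} \<le> 3 * p"
proof -
  define E where "E j = {\<omega> \<in> space M. \<exists>q\<in>Q. b \<le> \<bar>V j q \<omega>\<bar>}" for j
  define F where "F j = {\<omega> \<in> space M. (\<exists>q\<in>Q. 3 * b \<le> \<bar>V j q \<omega>\<bar>) \<and> (\<forall>l<j. \<forall>q\<in>Q. \<bar>V l q \<omega>\<bar> < 3 * b)}" for j
  define G where "G j = {\<omega> \<in> space M. \<exists>q\<in>Q. 2 * b < \<bar>V n q \<omega> - V j q \<omega>\<bar>}" for j
  have [measurable]: "E j \<in> events" "F j \<in> events" "G j \<in> events" if "j \<le> n" for j
  proof -
    have [measurable]: "V l q \<in> borel_measurable M" if "l \<le> j" "q \<in> Q" for l q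
      using that \<open>j \<le> n\<close> by (intro rv) auto
    show "E j \<in> events" "G j \<in> events"
      unfolding E_def G_def using Q that by measurable
    have "{\<omega> \<in> space M. \<forall>l\<in>{..<j}. \<forall>q\<in>Q. \<bar>V l q \<omega>\<bar> < 3 * b} \<in> events"
      using Q that by measurable
    moreover have "{\<omega> \<in> space M. \<exists>q\<in>Q. 3 * b \<le> \<bar>V j q \<omega>\<bar>} \<in> events"
      using Q that by measurable
    ultimately have "{\<omega> \<in> space M. \<exists>q\<in>Q. 3 * b \<le> \<bar>V j q \<omega>\<bar>} \<inter> {\<omega> \<in> space M. \<forall>l\<in>{..<j}. \<forall>q\<in>Q. \<bar>V l q \<omega>\<bar> < 3 * b} \<in> events"
      by blast
    also have "{\<omega> \<in> space M. \<exists>q\<in>Q. 3 * b \<le> \<bar>V j q \<omega>\<bar>} \<inter> {\<omega> \<in> space M. \<forall>l\<in>{..<j}. \<forall>q\<in>Q. \<bar>V l q \<omega>\<bar> < 3 * b} = F j"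
      by (auto simp: F_def)
    finally show "F j \<in> events" .
  qed
  have "{\<omega> \<in> space M. \<exists>j\<le>n. \<exists>q\<in>Q. 3 * b \<le> \<bar>V j q \<omega>\<bar>} \<subseteq> E n \<union> (\<Union>j\<le>n. F j \<inter> G j)"
  proof
    fix \<omega> assume "\<omega> \<in> {\<omega> \<in> space M. \<exists>j\<le>n. \<exists>q\<in>Q. 3 * b \<le> \<bar>V j q \<omega>\<bar>}"
    then have \<omega>: "\<omega> \<in> space M" and ex: "\<exists>j. j \<le> n \<and> (\<exists>q\<in>Q. 3 * b \<le> \<bar>V j q \<omega>\<bar>)" by auto
    define j where "j = (LEAST j. j \<le> n \<and> (\<exists>q\<in>Q. 3 * b \<le> \<bar>V j q \<omega>\<bar>))"
    have j: "j \<le> n" "\<exists>q\<in>Q. 3 * b \<le> \<bar>V j q \<omega>\<bar>"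
      using LeastI_ex[OF ex] unfolding j_def by auto
    have "\<bar>V l q \<omega>\<bar> < 3 * b" if "l < j" "q \<in> Q" for l q
    proof -
      have "\<not> (l \<le> n \<and> (\<exists>q\<in>Q. 3 * b \<le> \<bar>V l q \<omega>\<bar>))"
        using that(1) unfolding j_def by (rule not_less_Least)
      then show ?thesis using that j(1) by force
    qed
    then have F: "\<omega> \<in> F j" using \<omega> j by (simp add: F_def)
    obtain q where q: "q \<in> Q" "3 * b \<le> \<bar>V j q \<omega>\<bar>" using j by blast
    show "\<omega> \<in> E n \<union> (\<Union>j\<le>n. F j \<inter> G j)"
    proof (cases "b \<le> \<bar>V n q \<omega>\<bar>")
      case True
      then show ?thesis using \<omega> q by (auto simp: E_def)
    next
      case False
      then have "2 * b < \<bar>V n q \<omega> - V j q \<omega>\<bar>" using q by linarith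
      then have "\<omega> \<in> G j" using q \<omega> by (auto simp: G_def)
      then show ?thesis using F j by blast
    qed
  qed
  then have "prob {\<omega> \<in> space M. \<exists>j\<le>n. \<exists>q\<in>Q. 3 * b \<le> \<bar>V j q \<omega>\<bar>} \<le> prob (E n \<union> (\<Union>j\<le>n. F j \<inter> G j))"
    by (rule finite_measure_mono) measurable
  also have "\<dots> \<le> prob (E n) + prob (\<Union>j\<le>n. F j \<inter> G j)"
    by (rule measure_Un_le) measurable
  also have "prob (\<Union>j\<le>n. F j \<inter> G j) \<le> (\<Sum>j\<le>n. prob (F j \<inter> G j))"
    by (rule finite_measure_subadditive_finite) auto
  also have "(\<Sum>j\<le>n. prob (F j \<inter> G j)) \<le> (\<Sum>j\<le>n. prob (F j) * (2 * p))"
  proof (rule sum_mono)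
    fix j assume "j \<in> {..n}"
    then have j: "j \<le> n" by simp
    have "F j \<inter> G j = {\<omega> \<in> space M. ((\<exists>q\<in>Q. 3 * b \<le> \<bar>V j q \<omega>\<bar>) \<and> (\<forall>l<j. \<forall>q\<in>Q. \<bar>V l q \<omega>\<bar> < 3 * b)) \<and> (\<exists>q\<in>Q. 2 * b < \<bar>V n q \<omega> - V j q \<omega>\<bar>)}"
      by (auto simp: F_def G_def)
    then have "prob (F j \<inter> G j) = prob (F j) * prob (G j)"
      using ind[OF j] by (simp add: F_def G_def)
    moreover have "prob (G j) \<le> 2 * p"
    proof -
      have "G j \<subseteq> E n \<union> E j"
      proof
        fix \<omega> assume "\<omega> \<in> G j"
        then obtain q where "\<omega> \<in> space M" "q \<in> Q" "2 * b < \<bar>V n q \<omega> - V j q \<omega>\<bar>"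
          by (auto simp: G_def)
        moreover from this have "b \<le> \<bar>V n q \<omega>\<bar> \<or> b \<le> \<bar>V j q \<omega>\<bar>" by linarith
        ultimately show "\<omega> \<in> E n \<union> E j" by (auto simp: E_def)
      qed
      then have "prob (G j) \<le> prob (E n \<union> E j)" by (rule finite_measure_mono) (use j in measurable)
      also have "\<dots> \<le> prob (E n) + prob (E j)" by (rule measure_Un_le) (use j in measurable)
      also have "\<dots> \<le> 2 * p" using p[OF j] p[of n] by (simp add: E_def)
      finally show ?thesis .
    qed
    ultimately show "prob (F j \<inter> G j) \<le> prob (F j) * (2 * p)"
      by (simp add: mult_left_mono)
  qed
  also have "(\<Sum>j\<le>n. prob (F j) * (2 * p)) \<le> 1 * (2 * p)"
    unfolding sum_distrib_right[symmetric]
  proof (rule mult_right_mono)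
    have disj: "disjoint_family_on F {..n}"
    proof (unfold disjoint_family_on_def, intro ballI impI)
      fix j l :: nat assume "j \<noteq> l"
      then consider "j < l" | "l < j" by linarith
      then show "F j \<inter> F l = {}" by cases (force simp: F_def)+
    qed
    have "(\<Sum>j\<le>n. prob (F j)) = prob (\<Union>j\<le>n. F j)"
      by (rule finite_measure_finite_Union[symmetric]) (use disj in auto)
    also have "\<dots> \<le> 1" by simp
    finally show "(\<Sum>j\<le>n. prob (F j)) \<le> 1" .
    show "0 \<le> 2 * p" using p[of n] by (meson measure_nonneg order.refl order_trans mult_nonneg_nonneg zero_le_numeral)
  qed
  finally show ?thesis using p[of n] by (simp add: E_def)
qed

text \<open>
  Induction on the set of coordinates over which the maximum is taken: freezing all coordinates but one,
  the values on the slices orthogonal to it form a random walk of vectors, to which the one-parameter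
  inequality applies.
\<close>

lemma etemadi_grid:
  fixes Z :: "('d::finite \<Rightarrow> nat) \<Rightarrow> 'a \<Rightarrow> real" and n :: "'d \<Rightarrow> nat"
  defines "down \<equiv> \<lambda>s :: 'd \<Rightarrow> nat. PiE UNIV (\<lambda>i. {..<s i})"
  defines "S \<equiv> \<lambda>s \<omega>. \<Sum>c\<in>down s. Z c \<omega>"
  assumes Z: "indep_vars (\<lambda>_. borel) Z (down n)"
    and p: "\<And>s. (\<forall>i. s i \<le> n i) \<Longrightarrow> prob {\<omega> \<in> space M. a \<le> \<bar>S s \<omega>\<bar>} \<le> p"
  shows "prob {\<omega> \<in> space M. \<exists>s\<in>PiE UNIV (\<lambda>i. {..n i}). 3 ^ CARD('d) * a \<le> \<bar>S s \<omega>\<bar>} \<le> 3 ^ CARD('d) * p"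
proof -
  \<comment> \<open>Coordinates in \<open>A\<close> range freely and the others are frozen at
    \<open>r\<close>; the induction frees them one at a time.\<close>
  let ?R = "\<lambda>A r. PiE UNIV (\<lambda>i :: 'd. if i \<in> A then {..n i} else {r i})"
  have down_mono: "down s \<subseteq> down t" if "\<forall>i. s i \<le> t i" for s t
    unfolding down_def by (rule PiE_mono) (use that in auto)
  have fin: "finite (down s)" for s by (simp add: down_def)
  have rvZ: "c \<in> down n \<Longrightarrow> Z c \<in> borel_measurable M" for c
    using Z by (simp add: indep_vars_def)
  have rv: "S s \<in> borel_measurable M" if "\<forall>i. s i \<le> n i" for s
    unfolding S_def using down_mono[OF that] by (intro borel_measurable_sum rvZ) auto
  have *: "prob {\<omega> \<in> space M. \<exists>s\<in>?R A r. 3 ^ card A * a \<le> \<bar>S s \<omega>\<bar>} \<le> 3 ^ card A * p"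
    if "\<forall>i. r i \<le> n i" "finite A" for A r
    using that(2,1)
  proof (induction A arbitrary: r rule: finite_induct)
    case empty
    have "?R {} r = {r}" by (auto simp: PiE_def)
    then show ?case using p[OF empty] by simp
  next
    case (insert k A)
    define b where "b = 3 ^ card A * a"
    define Q where "Q = ?R A r"
    define V where "V j q = S (q(k := j))" for j q
    have Q: "finite Q" by (simp add: Q_def)
    have Qn: "\<forall>i. q i \<le> n i" if "q \<in> Q" for q
    proof
      fix i
      have "q i \<in> (if i \<in> A then {..n i} else {r i})" using that unfolding Q_def by (rule PiE_mem) simp
      then show "q i \<le> n i" using insert.prems by (auto split: if_splits)
    qed
    have upd: "\<forall>i. (q(k := j)) i \<le> n i" if "q \<in> Q" "j \<le> n k" for q j
      using Qn[OF that(1)] that(2) by simp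
    have R: "?R A (r(k := j)) = (\<lambda>q. q(k := j)) ` Q" for j
    proof (intro equalityI subsetI)
      fix s assume s: "s \<in> ?R A (r(k := j))"
      have "s k = j" using PiE_mem[OF s, of k] insert.hyps by simp
      then have "s = (s(k := r k))(k := j)" by auto
      moreover have "s(k := r k) \<in> Q"
        using s insert.hyps by (auto simp: Q_def PiE_iff split: if_splits)
      ultimately show "s \<in> (\<lambda>q. q(k := j)) ` Q" by blast
    next
      fix s assume "s \<in> (\<lambda>q. q(k := j)) ` Q"
      then obtain q where "q \<in> Q" "s = q(k := j)" by blast
      then show "s \<in> ?R A (r(k := j))"
        using insert.hyps by (auto simp: Q_def PiE_iff split: if_splits)
    qed
    \<comment> \<open>The induction hypothesis on a slice, at level \<open>b\<close>, supplies the
      bound required by the one-parameter inequality at each time \<open>j\<close>; each new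
      coordinate multiplies both level and bound by 3.\<close>
    have step: "prob {\<omega> \<in> space M. \<exists>j\<le>n k. \<exists>q\<in>Q. 3 * b \<le> \<bar>V j q \<omega>\<bar>} \<le> 3 * (3 ^ card A * p)"
    proof (rule etemadi[OF Q])
      show "V j q \<in> borel_measurable M" if "j \<le> n k" "q \<in> Q" for j q
        unfolding V_def by (rule rv[OF upd[OF that(2,1)]])
      show "prob {\<omega> \<in> space M. \<exists>q\<in>Q. b \<le> \<bar>V j q \<omega>\<bar>} \<le> 3 ^ card A * p" if "j \<le> n k" for j
        using insert.IH[of "r(k := j)"] insert.prems that by (simp add: R V_def b_def)
    next
      fix j assume j: "j \<le> n k"
      \<comment> \<open>Cutting the grid at height \<open>j\<close> in direction \<open>k\<close>:
        the cells in \<open>C\<close> determine the walk up to time \<open>j\<close>, those in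
        \<open>D\<close> its displacement after \<open>j\<close>. Disjointness of the two gives the
        required product formula.\<close>
      define C where "C = {c \<in> down n. c k < j}"
      define D where "D = {c \<in> down n. j \<le> c k}"
      have C: "down (q(k := l)) \<subseteq> C" if "q \<in> Q" "l \<le> j" for q l
      proof
        fix c assume c: "c \<in> down (q(k := l))"
        have "c k < l" using c by (auto simp: down_def PiE_iff split: if_splits)
        moreover have "c \<in> down n"
          by (rule subsetD[OF down_mono c], rule upd[OF that(1)]) (use that(2) j in linarith)
        ultimately show "c \<in> C" using that(2) by (simp add: C_def)
      qed
      have D: "down (q(k := n k)) - down (q(k := j)) \<subseteq> D" if "q \<in> Q" for q
      proof
        fix c assume c: "c \<in> down (q(k := n k)) - down (q(k := j))"
        have "c \<in> down n"
          by (rule subsetD[OF down_mono], rule upd[OF that order.refl]) (use c in blast)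
        moreover have "\<not> c k < j"
        proof
          assume "c k < j"
          then have "c \<in> down (q(k := j))" using c by (auto simp: down_def PiE_iff split: if_splits)
          then show False using c by simp
        qed
        ultimately show "c \<in> D" by (simp add: D_def)
      qed
      have V: "V l q \<omega> = (\<Sum>c\<in>down (q(k := l)). (\<lambda>c\<in>C. Z c \<omega>) c)" if "q \<in> Q" "l \<le> j" for q l \<omega>
        unfolding V_def S_def using C[OF that] by (intro sum.cong) auto
      have V': "V (n k) q \<omega> - V j q \<omega> = (\<Sum>c\<in>down (q(k := n k)) - down (q(k := j)). (\<lambda>c\<in>D. Z c \<omega>) c)"
        if "q \<in> Q" for q \<omega>
      proof -
        have "V (n k) q \<omega> - V j q \<omega> = (\<Sum>c\<in>down (q(k := n k)) - down (q(k := j)). Z c \<omega>)"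
          unfolding V_def S_def using j by (intro sum_diff[symmetric] fin down_mono) auto
        then show ?thesis using D[OF that] by (simp add: subset_iff)
      qed
      let ?P = "\<lambda>x. (\<exists>q\<in>Q. 3 * b \<le> \<bar>\<Sum>c\<in>down (q(k := j)). x c\<bar>) \<and>
        (\<forall>l\<in>{..<j}. \<forall>q\<in>Q. \<bar>\<Sum>c\<in>down (q(k := l)). x c\<bar> < 3 * b)"
      let ?Q = "\<lambda>x. \<exists>q\<in>Q. 2 * b < \<bar>\<Sum>c\<in>down (q(k := n k)) - down (q(k := j)). x c\<bar>"
      have [measurable]: "(\<lambda>x. \<Sum>c\<in>down (q(k := l)). x c :: real) \<in> borel_measurable (PiM C (\<lambda>_. borel))"
        if "q \<in> Q" "l \<le> j" for q l
        using C[OF that] by (intro borel_measurable_sum measurable_component_singleton) auto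
      have [measurable]: "(\<lambda>x. \<Sum>c\<in>down (q(k := n k)) - down (q(k := j)). x c :: real) \<in> borel_measurable (PiM D (\<lambda>_. borel))"
        if "q \<in> Q" for q
        using D[OF that] by (intro borel_measurable_sum measurable_component_singleton) auto
      have P: "{x \<in> space (PiM C (\<lambda>_. borel)). ?P x} \<in> sets (PiM C (\<lambda>_. borel))"
        using Q by measurable
      have Q': "{x \<in> space (PiM D (\<lambda>_. borel)). ?Q x} \<in> sets (PiM D (\<lambda>_. borel))"
        using Q by measurable
      have CD: "C \<inter> D = {}" "C \<subseteq> down n" "D \<subseteq> down n" by (auto simp: C_def D_def)
      have PV: "?P (\<lambda>c\<in>C. Z c \<omega>) \<longleftrightarrow> (\<exists>q\<in>Q. 3 * b \<le> \<bar>V j q \<omega>\<bar>) \<and> (\<forall>l<j. \<forall>q\<in>Q. \<bar>V l q \<omega>\<bar> < 3 * b)" for \<omega>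
        by (simp only: V[symmetric] order.refl less_imp_le lessThan_iff Ball_def Bex_def cong: conj_cong imp_cong)
      have QV: "?Q (\<lambda>c\<in>D. Z c \<omega>) \<longleftrightarrow> (\<exists>q\<in>Q. 2 * b < \<bar>V (n k) q \<omega> - V j q \<omega>\<bar>)" for \<omega>
        by (simp only: V'[symmetric] Bex_def cong: conj_cong)
      show "prob {\<omega> \<in> space M. ((\<exists>q\<in>Q. 3 * b \<le> \<bar>V j q \<omega>\<bar>) \<and> (\<forall>l<j. \<forall>q\<in>Q. \<bar>V l q \<omega>\<bar> < 3 * b)) \<and> (\<exists>q\<in>Q. 2 * b < \<bar>V (n k) q \<omega> - V j q \<omega>\<bar>)} =
        prob {\<omega> \<in> space M. (\<exists>q\<in>Q. 3 * b \<le> \<bar>V j q \<omega>\<bar>) \<and> (\<forall>l<j. \<forall>q\<in>Q. \<bar>V l q \<omega>\<bar> < 3 * b)} *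
        prob {\<omega> \<in> space M. \<exists>q\<in>Q. 2 * b < \<bar>V (n k) q \<omega> - V j q \<omega>\<bar>}"
        using indep_blocks[OF Z CD P Q'] unfolding PV QV .
    qed
    have "(\<exists>s\<in>?R (insert k A) r. 3 * b \<le> \<bar>S s \<omega>\<bar>) \<longleftrightarrow> (\<exists>j\<le>n k. \<exists>q\<in>Q. 3 * b \<le> \<bar>V j q \<omega>\<bar>)" for \<omega>
    proof -
      have "?R (insert k A) r = (\<Union>j\<in>{..n k}. (\<lambda>q. q(k := j)) ` Q)"
      proof (intro equalityI subsetI)
        fix s assume s: "s \<in> ?R (insert k A) r"
        have "s k \<le> n k" using PiE_mem[OF s, of k] by simp
        moreover have "s \<in> ?R A (r(k := s k))"
          using s by (auto simp: PiE_iff split: if_splits)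
        ultimately show "s \<in> (\<Union>j\<in>{..n k}. (\<lambda>q. q(k := j)) ` Q)" unfolding R[symmetric] by blast
      next
        fix s assume "s \<in> (\<Union>j\<in>{..n k}. (\<lambda>q. q(k := j)) ` Q)"
        then obtain j where j: "j \<le> n k" "s \<in> ?R A (r(k := j))" unfolding R[symmetric] by blast
        have "s k = j" using PiE_mem[OF j(2), of k] insert.hyps by simp
        then show "s \<in> ?R (insert k A) r"
          using j by (auto simp: PiE_iff split: if_splits)
      qed
      then show ?thesis by (auto simp: V_def)
    qed
    then show ?case
      using step insert.hyps by (simp add: b_def mult.assoc)
  qed
  have "?R UNIV n = PiE UNIV (\<lambda>i. {..n i})" by simp
  then show ?thesis using *[of n UNIV] by simp
qed

end

section \<open>Polynomial growth under a moment condition\<close>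

locale levy_sheet = prob_space M for M :: "'w measure" +
  fixes X :: "real ^ 'd::finite \<Rightarrow> 'w \<Rightarrow> real"
  assumes levy: "levy_field M X"
begin

abbreviation inc :: "real ^ 'd \<Rightarrow> real ^ 'd \<Rightarrow> 'w \<Rightarrow> real" where
  "inc a b \<omega> \<equiv> increment a b (\<lambda>t. X t \<omega>)"

lemma X_measurable: "t \<in> orthant \<Longrightarrow> X t \<in> borel_measurable M"
  using levy by (simp add: levy_field_def)

lemma AE_lamp: "AE \<omega> in M. lamp (\<lambda>t. X t \<omega>)"
  using levy by (simp add: levy_field_def)

lemma inc_measurable:
  assumes "a \<in> orthant" "a \<le> b"
  shows "inc a b \<in> borel_measurable M"
  unfolding increment_def
  by (intro borel_measurable_sum borel_measurable_times borel_measurable_const X_measurable)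
     (use assms orthant_le[OF assms] in \<open>auto simp: orthant_def\<close>)

lemma AE_inc_zero: "t \<in> orthant \<Longrightarrow> AE \<omega> in M. inc 0 t \<omega> = X t \<omega>"
  using AE_lamp by eventually_elim (rule lamp_increment_zero)

lemma indep_inc:
  assumes I: "finite I" and ab: "\<And>i. i \<in> I \<Longrightarrow> a i \<in> orthant \<and> a i \<le> b i"
    and disj: "disjoint_family_on (\<lambda>i. half_open_box (a i) (b i)) I"
  shows "indep_vars (\<lambda>_. borel) (\<lambda>i. inc (a i) (b i)) I"
proof -
  obtain h where h: "bij_betw h I {0..<card I}"
    using ex_bij_betw_finite_nat[OF I] by blast
  define e where "e = inv_into I h"
  have e: "e k \<in> I" "h (e k) = k" if "k < card I" for k
    using that h unfolding e_def bij_betw_def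
    by (auto intro: inv_into_into f_inv_into_f)
  have eh: "e (h i) = i" "h i < card I" if "i \<in> I" for i
    using that h unfolding e_def bij_betw_def by auto
  have "independent_increments M X" using levy by (simp add: levy_field_def)
  moreover have "\<forall>k<card I. a (e k) \<in> orthant \<and> a (e k) \<le> b (e k)"
    using e ab by blast
  moreover have "disjoint_family_on (\<lambda>k. half_open_box (a (e k)) (b (e k))) {..<card I}"
    unfolding disjoint_family_on_def
  proof (intro ballI impI)
    fix k l assume "k \<in> {..<card I}" "l \<in> {..<card I}" "k \<noteq> l"
    then have "e k \<noteq> e l" "e k \<in> I" "e l \<in> I" using e[of k] e[of l] by auto
    then show "half_open_box (a (e k)) (b (e k)) \<inter> half_open_box (a (e l)) (b (e l)) = {}"
      using disj by (simp add: disjoint_family_on_def)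
  qed
  ultimately have "indep_vars (\<lambda>_. borel) (\<lambda>k \<omega>. inc (a (e k)) (b (e k)) \<omega>) {..<card I}"
    unfolding independent_increments_def
    by (drule_tac spec[of _ "card I"], drule_tac spec[of _ "\<lambda>k. a (e k)"], drule_tac spec[of _ "\<lambda>k. b (e k)"]) blast
  then have "indep_vars (\<lambda>_. borel) (\<lambda>i \<omega>. \<Sum>k\<in>{h i}. 1 * inc (a (e k)) (b (e k)) \<omega>) I"
  proof (rule indep_vars_linear)
    show "disjoint_family_on (\<lambda>i. {h i}) I"
      unfolding disjoint_family_on_def
    proof (intro ballI impI)
      fix i j assume "i \<in> I" "j \<in> I" "i \<noteq> j"
      then have "h i \<noteq> h j" using eh(1)[of i] eh(1)[of j] by auto
      then show "{h i} \<inter> {h j} = {}" by simp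
    qed
  qed (use eh in auto)
  then show ?thesis
    by (rule indep_vars_cong[THEN iffD1, rotated -1]) (auto simp: eh)
qed

text \<open>The grid functions are monotone but not strictly so: coinciding grid points make empty
  half-open cells, which occur when a grid is cut at a prescribed point or truncated at
  \<open>t\<close>.\<close>

lemma indep_grid:
  fixes g :: "'d \<Rightarrow> nat \<Rightarrow> real"
  assumes g: "\<And>i. mono (g i)" "\<And>i. 0 \<le> g i 0" and C: "finite C"
  shows "indep_vars (\<lambda>_. borel) (\<lambda>c. inc (\<chi> i. g i (c i)) (\<chi> i. g i (Suc (c i)))) C"
proof (rule indep_inc[OF C])
  fix c :: "'d \<Rightarrow> nat"
  have "0 \<le> g i (c i)" for i
    using g(2)[of i] monoD[OF g(1), of 0 "c i" i] by linarith
  then show "(\<chi> i. g i (c i)) \<in> orthant \<and> (\<chi> i. g i (c i)) \<le> (\<chi> i. g i (Suc (c i)))"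
    using monoD[OF g(1)] by (auto simp: orthant_def less_eq_vec_def)
next
  have *: "half_open_box (\<chi> i. g i (c i)) (\<chi> i. g i (Suc (c i))) \<inter>
      half_open_box (\<chi> i. g i (c' i)) (\<chi> i. g i (Suc (c' i))) = {}" if "c i < c' i" for c c' i
  proof -
    have "g i (Suc (c i)) \<le> g i (c' i)" using that by (intro monoD[OF g(1)]) simp
    then have False if "g i (c' i) < t $ i" "t $ i \<le> g i (Suc (c i))" for t :: "real ^ 'd"
      using that by linarith
    then show ?thesis by (auto simp: half_open_box_def less_eq_vec_def)
  qed
  show "disjoint_family_on (\<lambda>c. half_open_box (\<chi> i. g i (c i)) (\<chi> i. g i (Suc (c i)))) C"
    unfolding disjoint_family_on_def
  proof (intro ballI impI)
    fix c c' :: "'d \<Rightarrow> nat" assume "c \<noteq> c'"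
    then obtain i where "c i \<noteq> c' i" by (metis ext)
    then consider "c i < c' i" | "c' i < c i" by linarith
    then show "half_open_box (\<chi> i. g i (c i)) (\<chi> i. g i (Suc (c i))) \<inter>
      half_open_box (\<chi> i. g i (c' i)) (\<chi> i. g i (Suc (c' i))) = {}"
      using *[of c i c'] *[of c' i c] by cases blast+
  qed
qed

lemma distr_inc:
  assumes "a \<in> orthant" "a \<le> b" "a + h \<in> orthant"
  shows "distr M borel (inc (a + h) (b + h)) = distr M borel (inc a b)"
proof -
  have "stationary_increments M X" using levy by (simp add: levy_field_def)
  then show ?thesis
    unfolding stationary_increments_def using assms by blast
qed

lemma prob_inc:
  assumes "a \<in> orthant" "a \<le> b"
  shows "prob {\<omega> \<in> space M. r \<le> \<bar>inc a b \<omega>\<bar>} = prob {\<omega> \<in> space M. r \<le> \<bar>inc 0 (b - a) \<omega>\<bar>}"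
proof -
  have "distr M borel (inc (a + - a) (b + - a)) = distr M borel (inc a b)"
    by (rule distr_inc) (use assms in \<open>auto simp: orthant_def\<close>)
  then have eq: "measure (distr M borel (inc 0 (b - a))) {x. r \<le> \<bar>x\<bar>} = measure (distr M borel (inc a b)) {x. r \<le> \<bar>x\<bar>}"
    by simp
  have "inc a b \<in> borel_measurable M" using assms by (rule inc_measurable)
  moreover have "inc 0 (b - a) \<in> borel_measurable M"
    by (rule inc_measurable) (use assms in \<open>auto simp: orthant_def less_eq_vec_def\<close>)
  ultimately show ?thesis
    using eq by (simp add: measure_distr vimage_def Int_def conj_commute)
qed

text \<open>Almost every path is bounded on a given box, so a bound common to all paths holds off an
  event of small probability. Passing through a countable set of points makes that event measurable;
  the null set of non-lamp paths is put into \<open>E\<close> as well.\<close>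

lemma tight:
  assumes "0 < \<epsilon>"
  obtains a E where "0 < a" "E \<in> events" "prob E \<le> \<epsilon>" "\<And>\<omega>. \<omega> \<in> space M - E \<Longrightarrow> lamp (\<lambda>t. X t \<omega>)"
    "\<And>\<omega> t. \<omega> \<in> space M - E \<Longrightarrow> t \<in> orthant \<Longrightarrow> t \<le> (\<chi> i. real n) \<Longrightarrow> \<bar>X t \<omega>\<bar> \<le> a"
proof -
  obtain N where N: "{\<omega> \<in> space M. \<not> lamp (\<lambda>t. X t \<omega>)} \<subseteq> N" "emeasure M N = 0" "N \<in> events"
    using AE_lamp by (rule AE_E)
  \<comment> \<open>The margin 1 accommodates \<open>round_up\<close>, which may leave the box by up
    to \<open>1 / 2 ^ m\<close>.\<close>
  define D where "D = {t :: real ^ 'd. \<forall>i. t $ i \<in> \<rat>} \<inter> {t \<in> orthant. t \<le> (\<chi> i. real n + 1)}"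
  have D: "countable D" unfolding D_def by (rule countable_Int1[OF countable_rational_vectors])
  \<comment> \<open>These events shrink with \<open>k\<close>, and outside \<open>N\<close> no path
    lies in all of them, since lamp paths are bounded on a compact box.\<close>
  define A where "A k = N \<union> {\<omega> \<in> space M. \<exists>t\<in>D. real k < \<bar>X t \<omega>\<bar>}" for k :: nat
  have A: "A k \<in> events" for k
  proof -
    have [measurable]: "t \<in> D \<Longrightarrow> X t \<in> borel_measurable M" for t
      by (rule X_measurable) (simp add: D_def)
    have "{\<omega> \<in> space M. \<exists>t\<in>D. real k < \<bar>X t \<omega>\<bar>} \<in> events"
      using D by (intro sets.sets_Collect_countable_Ex') measurable
    then show ?thesis using N(3) by (simp add: A_def)
  qed
  have "(\<lambda>k. prob (A k)) \<longlonglongrightarrow> prob (\<Inter>k. A k)"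
  proof (rule finite_Lim_measure_decseq)
    show "range A \<subseteq> events" using A by blast
    show "decseq A"
    proof (rule decseq_SucI)
      fix k
      have "real k < x" if "real (Suc k) < x" for x using that by simp
      then show "A (Suc k) \<subseteq> A k" unfolding A_def by blast
    qed
  qed
  moreover have "(\<Inter>k. A k) \<subseteq> N"
  proof
    fix \<omega> assume \<omega>: "\<omega> \<in> (\<Inter>k. A k)"
    show "\<omega> \<in> N"
    proof (rule ccontr)
      assume "\<omega> \<notin> N"
      have "\<omega> \<in> A 0" using \<omega> by blast
      then have "\<omega> \<in> space M" using \<open>\<omega> \<notin> N\<close> by (auto simp: A_def)
      then have "lamp (\<lambda>t. X t \<omega>)" using N(1) \<open>\<omega> \<notin> N\<close> by blast
      moreover have "compact {0 .. (\<chi> i. real n + 1) :: real ^ 'd}"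
        by (rule compact_interval)
      ultimately obtain B where B: "\<forall>u\<in>{0 .. (\<chi> i. real n + 1)} \<inter> orthant. \<bar>X u \<omega>\<bar> \<le> B"
        using lamp_bounded by blast
      obtain k :: nat where k: "B < real k" using reals_Archimedean2 by blast
      have "\<omega> \<in> A k" using \<omega> by blast
      then obtain t where "t \<in> D" "real k < \<bar>X t \<omega>\<bar>" using \<open>\<omega> \<notin> N\<close> by (auto simp: A_def)
      moreover from this have "\<bar>X t \<omega>\<bar> \<le> B"
        by (intro B[rule_format]) (auto simp: D_def orthant_def less_eq_vec_def)
      ultimately show False using k by linarith
    qed
  qed
  then have "prob (\<Inter>k. A k) = 0"
    using N by (metis finite_measure_mono measure_nonneg emeasure_eq_measure ennreal_eq_0_iff order_antisym)
  ultimately have "\<forall>\<^sub>F k in sequentially. prob (A k) < \<epsilon>"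
    using assms by (auto dest: order_tendstoD(2))
  then obtain k where k: "prob (A k) < \<epsilon>"
    by (auto simp: eventually_sequentially)
  have "lamp (\<lambda>t. X t \<omega>) \<and> (\<forall>t\<in>orthant. t \<le> (\<chi> i. real n) \<longrightarrow> \<bar>X t \<omega>\<bar> \<le> real k + 1)"
    if "\<omega> \<in> space M - A k" for \<omega>
  proof (intro conjI ballI impI)
    show l: "lamp (\<lambda>t. X t \<omega>)" using that N(1) by (auto simp: A_def)
    fix t :: "real ^ 'd" assume t: "t \<in> orthant" "t \<le> (\<chi> i. real n)"
    have "round_up m t \<in> D" for m
    proof -
      have "round_up m t $ i \<le> real n + 1" for i
      proof -
        have "t $ i \<le> real n" using t(2) by (simp add: less_eq_vec_def)
        moreover have "1 / 2 ^ m \<le> (1 :: real)" by simp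
        ultimately show ?thesis using round_up_diff_le[of m t i] by linarith
      qed
      then show ?thesis
        unfolding D_def using round_up_orthant[OF t(1)] by (auto simp: less_eq_vec_def intro: round_up_rational)
    qed
    then have "\<not> real k < \<bar>X (round_up m t) \<omega>\<bar>" for m
      using that unfolding A_def by blast
    then have "\<bar>X (round_up m t) \<omega>\<bar> \<le> real k" for m
      by (simp add: not_less)
    then have "\<bar>X t \<omega>\<bar> \<le> real k"
      by (intro LIMSEQ_le_const2[OF tendsto_rabs[OF lamp_round_up[OF l t(1)]]]) auto
    then show "\<bar>X t \<omega>\<bar> \<le> real k + 1" by simp
  qed
  then show thesis
    using A[of k] k by (intro that[of "real k + 1" "A k"]) auto
qed

lemma inc_bound:
  assumes "\<And>t. t \<in> orthant \<Longrightarrow> t \<le> b \<Longrightarrow> \<bar>X t \<omega>\<bar> \<le> B" "u \<in> orthant" "u \<le> v" "v \<le> b"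
  shows "\<bar>inc u v \<omega>\<bar> \<le> 2 ^ CARD('d) * B"
proof (rule abs_increment_le)
  fix t :: "real ^ 'd" assume t: "\<forall>i. t $ i = u $ i \<or> t $ i = v $ i"
  have "u $ i \<le> t $ i" "t $ i \<le> v $ i" for i
    using t[rule_format, of i] \<open>u \<le> v\<close> by (auto simp: less_eq_vec_def)
  then have "u \<le> t" "t \<le> v" by (auto simp: less_eq_vec_def)
  then show "\<bar>X t \<omega>\<bar> \<le> B"
    using assms by (intro assms(1)) (auto intro: orthant_le order_trans)
qed

text \<open>The increment over \<open>[0,s]\<close> is one cell of a partition of the unit cube,
  independent of the other cells together; tightness keeps those small with probability at least
  1/2.\<close>

lemma unit_box_comparison:
  "\<exists>a0>0. \<forall>a\<ge>a0. \<forall>s\<in>orthant. s \<le> (\<chi> i. 1) \<longrightarrow>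
    prob {\<omega> \<in> space M. 2 * a \<le> \<bar>inc 0 s \<omega>\<bar>} \<le> 2 * prob {\<omega> \<in> space M. a \<le> \<bar>inc 0 (\<chi> i. 1) \<omega>\<bar>}"
proof -
  obtain a1 E where a1: "a1 > 0" and E: "E \<in> events" "prob E \<le> 1 / 2"
    and bd: "\<And>\<omega> t. \<omega> \<in> space M - E \<Longrightarrow> t \<in> orthant \<Longrightarrow> t \<le> (\<chi> i. real 1) \<Longrightarrow> \<bar>X t \<omega>\<bar> \<le> a1"
    by (rule tight[of "1 / 2" 1]) auto
  \<comment> \<open>The remainder is a difference of two increments, each at most
    \<open>2 ^ CARD('d) * a1\<close> off \<open>E\<close>.\<close>
  let ?a0 = "2 * (2 ^ CARD('d) * a1)"
  have zero: "0 \<in> (orthant :: (real ^ 'd) set)" by (simp add: orthant_def)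
  have "prob {\<omega> \<in> space M. 2 * a \<le> \<bar>inc 0 s \<omega>\<bar>} \<le> 2 * prob {\<omega> \<in> space M. a \<le> \<bar>inc 0 (\<chi> i. 1) \<omega>\<bar>}"
    if a: "?a0 \<le> a" and s: "s \<in> orthant" "s \<le> (\<chi> i. 1)" for a s
  proof -
    have s01: "0 \<le> s $ i" "s $ i \<le> 1" for i using s by (auto simp: orthant_def less_eq_vec_def)
    \<comment> \<open>Grid points \<open>0\<close>, \<open>s $ i\<close>, \<open>1\<close> in each
      direction; the cell with all indices 0 is the box from \<open>0\<close> to
      \<open>s\<close>.\<close>
    define g where "g i k = (if k = 0 then 0 else if k = 1 then s $ i else 1)" for i :: 'd and k :: nat
    let ?C = "PiE (UNIV :: 'd set) (\<lambda>_. {0..<2 :: nat})" and ?c0 = "\<lambda>_ :: 'd. 0 :: nat"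
    let ?Z = "\<lambda>c. inc (\<chi> i. g i (c i)) (\<chi> i. g i (Suc (c i)))"
    have g: "mono (g i)" for i
      by (auto simp: mono_def g_def s01)
    have ind: "indep_vars (\<lambda>_. borel) ?Z ?C"
      by (rule indep_grid[OF g]) (auto simp: g_def)
    have Z0: "?Z ?c0 \<omega> = inc 0 s \<omega>" for \<omega>
      by (simp add: g_def zero_vec_def)
    have sum: "(\<Sum>c\<in>?C. ?Z c \<omega>) = inc 0 (\<chi> i. 1) \<omega>" for \<omega>
      using increment_grid[of ?c0 "\<lambda>_. 2" g "\<lambda>t. X t \<omega>"] by (simp add: g_def zero_vec_def)
    have c0: "?c0 \<in> ?C" by (simp add: PiE_iff)
    have rest: "(\<Sum>c\<in>?C - {?c0}. 1 * ?Z c \<omega>) = inc 0 (\<chi> i. 1) \<omega> - inc 0 s \<omega>" for \<omega>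
      using sum_diff1[of ?C "\<lambda>c. ?Z c \<omega>" ?c0] c0 Z0 by (simp add: sum)
    have single: "(\<Sum>c\<in>{?c0}. 1 * ?Z c \<omega>) = inc 0 s \<omega>" for \<omega> using Z0 by simp
    have total: "inc 0 s \<omega> + (inc 0 (\<chi> i. 1) \<omega> - inc 0 s \<omega>) = inc 0 (\<chi> i. 1) \<omega>" for \<omega> by simp
    have "prob {\<omega> \<in> space M. 2 * a \<le> \<bar>\<Sum>c\<in>{?c0}. 1 * ?Z c \<omega>\<bar>} * prob {\<omega> \<in> space M. \<bar>\<Sum>c\<in>?C - {?c0}. 1 * ?Z c \<omega>\<bar> \<le> a} \<le>
        prob {\<omega> \<in> space M. a \<le> \<bar>(\<Sum>c\<in>{?c0}. 1 * ?Z c \<omega>) + (\<Sum>c\<in>?C - {?c0}. 1 * ?Z c \<omega>)\<bar>}"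
      by (rule indep_linear_pair[OF ind]) (use c0 in auto)
    then have le: "prob {\<omega> \<in> space M. 2 * a \<le> \<bar>inc 0 s \<omega>\<bar>} * prob {\<omega> \<in> space M. \<bar>inc 0 (\<chi> i. 1) \<omega> - inc 0 s \<omega>\<bar> \<le> a} \<le>
        prob {\<omega> \<in> space M. a \<le> \<bar>inc 0 (\<chi> i. 1) \<omega>\<bar>}"
      unfolding rest single total .
    have "1 / 2 \<le> prob (space M - E)"
      using E by (simp add: prob_compl)
    also have "\<dots> \<le> prob {\<omega> \<in> space M. \<bar>inc 0 (\<chi> i. 1) \<omega> - inc 0 s \<omega>\<bar> \<le> a}"
    proof (rule finite_measure_mono)
      show "space M - E \<subseteq> {\<omega> \<in> space M. \<bar>inc 0 (\<chi> i. 1) \<omega> - inc 0 s \<omega>\<bar> \<le> a}"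
      proof
        fix \<omega> assume \<omega>: "\<omega> \<in> space M - E"
        have "\<bar>inc 0 s \<omega>\<bar> \<le> 2 ^ CARD('d) * a1" "\<bar>inc 0 (\<chi> i. 1) \<omega>\<bar> \<le> 2 ^ CARD('d) * a1"
          using zero s01 by (auto intro!: inc_bound[OF bd[OF \<omega>]] simp: less_eq_vec_def)
        then have "\<bar>inc 0 (\<chi> i. 1) \<omega> - inc 0 s \<omega>\<bar> \<le> a" using a by linarith
        then show "\<omega> \<in> {\<omega> \<in> space M. \<bar>inc 0 (\<chi> i. 1) \<omega> - inc 0 s \<omega>\<bar> \<le> a}" using \<omega> by simp
      qed
      have [measurable]: "inc 0 s \<in> borel_measurable M" "inc 0 (\<chi> i. 1) \<in> borel_measurable M"
        using zero s01 by (auto intro!: inc_measurable simp: less_eq_vec_def)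
      show "{\<omega> \<in> space M. \<bar>inc 0 (\<chi> i. 1) \<omega> - inc 0 s \<omega>\<bar> \<le> a} \<in> events" by measurable
    qed
    finally have "prob {\<omega> \<in> space M. 2 * a \<le> \<bar>inc 0 s \<omega>\<bar>} * (1 / 2) \<le> prob {\<omega> \<in> space M. a \<le> \<bar>inc 0 (\<chi> i. 1) \<omega>\<bar>}"
      by (intro order_trans[OF mult_left_mono le]) auto
    then show ?thesis by simp
  qed
  moreover have "?a0 > 0" using a1 by simp
  ultimately show ?thesis by blast
qed

text \<open>If a sum of \<open>n ^ d\<close> increments reaches \<open>n ^ d * b\<close>, one of
  them reaches \<open>b\<close>. By stationarity each has the law of an increment over a box in the
  unit cube, and the union bound gives the factor in front of \<open>p\<close>.\<close>

lemma prob_inc_box_le: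
  assumes comp: "\<And>s. s \<in> orthant \<Longrightarrow> s \<le> (\<chi> i. 1) \<Longrightarrow> prob {\<omega> \<in> space M. b \<le> \<bar>inc 0 s \<omega>\<bar>} \<le> p"
    and t: "t \<in> orthant" "t \<le> (\<chi> i. real n)" and n: "0 < n"
  shows "prob {\<omega> \<in> space M. real n ^ CARD('d) * b \<le> \<bar>inc 0 t \<omega>\<bar>} \<le> real n ^ CARD('d) * p"
proof -
  \<comment> \<open>The integer grid truncated at \<open>t\<close>: cells beyond \<open>t\<close>
    are degenerate, so the number of cells does not depend on \<open>t\<close>.\<close>
  define g where "g i k = min (real k) (t $ i)" for i :: 'd and k :: nat
  let ?C = "PiE (UNIV :: 'd set) (\<lambda>_. {0..<n})"
  let ?a = "\<lambda>c. \<chi> i. g i (c i)" and ?b = "\<lambda>c. \<chi> i. g i (Suc (c i))"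
  have t0: "0 \<le> t $ i" "t $ i \<le> real n" for i using t by (auto simp: orthant_def less_eq_vec_def)
  have sum: "inc 0 t \<omega> = (\<Sum>c\<in>?C. inc (?a c) (?b c) \<omega>)" for \<omega>
  proof -
    have "(\<chi> i. g i 0) = 0" "(\<chi> i. g i n) = t"
      using t0 by (simp_all add: g_def vec_eq_iff min_absorb1 min_absorb2)
    then show ?thesis
      using increment_grid[of "\<lambda>_. 0" "\<lambda>_. n" g "\<lambda>t. X t \<omega>"] by simp
  qed
  have ab: "?a c \<in> orthant" "?a c \<le> ?b c" "?b c - ?a c \<in> orthant" "?b c - ?a c \<le> (\<chi> i. 1)" for c
    using t0 by (auto simp: g_def orthant_def less_eq_vec_def min_def)
  have m: "{\<omega> \<in> space M. b \<le> \<bar>inc (?a c) (?b c) \<omega>\<bar>} \<in> events" for c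
    using inc_measurable[OF ab(1,2), of c] by measurable
  have "{\<omega> \<in> space M. real n ^ CARD('d) * b \<le> \<bar>inc 0 t \<omega>\<bar>} \<subseteq>
      (\<Union>c\<in>?C. {\<omega> \<in> space M. b \<le> \<bar>inc (?a c) (?b c) \<omega>\<bar>})"
  proof
    fix \<omega> assume \<omega>: "\<omega> \<in> {\<omega> \<in> space M. real n ^ CARD('d) * b \<le> \<bar>inc 0 t \<omega>\<bar>}"
    have "\<exists>c\<in>?C. b \<le> \<bar>inc (?a c) (?b c) \<omega>\<bar>"
    proof (rule ccontr)
      assume "\<not> ?thesis"
      then have "\<And>c. c \<in> ?C \<Longrightarrow> \<bar>inc (?a c) (?b c) \<omega>\<bar> < b" by (simp add: not_le)
      moreover have "(\<lambda>_. 0) \<in> ?C" using n by (simp add: PiE_iff)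
      ultimately have "(\<Sum>c\<in>?C. \<bar>inc (?a c) (?b c) \<omega>\<bar>) < (\<Sum>c\<in>?C. b)"
        by (intro sum_strict_mono) auto
      also have "\<dots> = real n ^ CARD('d) * b" by (simp add: card_PiE)
      finally have "\<bar>inc 0 t \<omega>\<bar> < real n ^ CARD('d) * b"
        unfolding sum by (rule le_less_trans[OF sum_abs])
      then show False using \<omega> by simp
    qed
    then show "\<omega> \<in> (\<Union>c\<in>?C. {\<omega> \<in> space M. b \<le> \<bar>inc (?a c) (?b c) \<omega>\<bar>})" using \<omega> by blast
  qed
  then have "prob {\<omega> \<in> space M. real n ^ CARD('d) * b \<le> \<bar>inc 0 t \<omega>\<bar>} \<le>
      prob (\<Union>c\<in>?C. {\<omega> \<in> space M. b \<le> \<bar>inc (?a c) (?b c) \<omega>\<bar>})"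
    by (rule finite_measure_mono) (intro sets.finite_UN m, simp)
  also have "\<dots> \<le> (\<Sum>c\<in>?C. prob {\<omega> \<in> space M. b \<le> \<bar>inc (?a c) (?b c) \<omega>\<bar>})"
    using m by (intro finite_measure_subadditive_finite) auto
  also have "\<dots> \<le> (\<Sum>c\<in>?C. p)"
  proof (rule sum_mono)
    fix c :: "'d \<Rightarrow> nat"
    show "prob {\<omega> \<in> space M. b \<le> \<bar>inc (?a c) (?b c) \<omega>\<bar>} \<le> p"
      unfolding prob_inc[OF ab(1,2)] by (rule comp[OF ab(3,4)])
  qed
  also have "\<dots> = real n ^ CARD('d) * p" by (simp add: card_PiE)
  finally show ?thesis .
qed

text \<open>A countable substitute for exceeding \<open>b\<close> somewhere in
  \<open>[0,n]^d\<close>: off this event right-continuity extends the bound from dyadic points to a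
  whole lamp path. It is written with increments from 0 because these are exactly sums of cells, for
  every path.\<close>

definition dyadic_exceed :: "nat \<Rightarrow> real \<Rightarrow> 'w set" where
  "dyadic_exceed n b = {\<omega> \<in> space M. \<exists>m. \<exists>s\<in>PiE (UNIV :: 'd set) (\<lambda>_. {..n * 2 ^ m}). b \<le> \<bar>inc 0 (\<chi> i. real (s i) / 2 ^ m) \<omega>\<bar>}"

text \<open>The maximal inequality does not see the mesh. Dyadic grids are nested, doubling the
  index leads from one to the next, so the events increase with \<open>m\<close> and the bound
  survives in the limit.\<close>

lemma prob_dyadic_exceed:
  assumes p: "\<And>t. t \<in> orthant \<Longrightarrow> t \<le> (\<chi> i. real n) \<Longrightarrow> prob {\<omega> \<in> space M. a \<le> \<bar>inc 0 t \<omega>\<bar>} \<le> p"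
  shows "dyadic_exceed n (3 ^ CARD('d) * a) \<in> events"
    and "prob (dyadic_exceed n (3 ^ CARD('d) * a)) \<le> 3 ^ CARD('d) * p"
proof -
  let ?b = "3 ^ CARD('d) * a"
  let ?pt = "\<lambda>m s. \<chi> i :: 'd. real (s i) / 2 ^ m"
  let ?S = "\<lambda>m. PiE (UNIV :: 'd set) (\<lambda>_. {..n * 2 ^ m})"
  define A where "A m = {\<omega> \<in> space M. \<exists>s\<in>?S m. ?b \<le> \<bar>inc 0 (?pt m s) \<omega>\<bar>}" for m
  have U: "dyadic_exceed n ?b = (\<Union>m. A m)"
    by (auto simp: dyadic_exceed_def A_def)
  have A: "A m \<in> events" for m
  proof -
    have [measurable]: "inc 0 (?pt m s) \<in> borel_measurable M" for s
      using dyadic_orthant by (intro inc_measurable) (auto simp: orthant_iff)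
    show ?thesis unfolding A_def by measurable
  qed
  have P: "prob (A m) \<le> 3 ^ CARD('d) * p" for m
  proof -
    let ?g = "\<lambda>_ :: 'd. \<lambda>k. real k / 2 ^ m"
    let ?Z = "\<lambda>c. inc (\<chi> i. ?g i (c i)) (\<chi> i. ?g i (Suc (c i)))"
    have S: "(\<Sum>c\<in>PiE UNIV (\<lambda>i. {..<s i}). ?Z c \<omega>) = inc 0 (?pt m s) \<omega>" for s \<omega>
      using increment_grid[of "\<lambda>_. 0" s ?g "\<lambda>t. X t \<omega>"] by (simp add: atLeast0LessThan zero_vec_def)
    have "indep_vars (\<lambda>_. borel) ?Z (PiE UNIV (\<lambda>i. {..<n * 2 ^ m}))"
      by (rule indep_grid) (auto simp: mono_def divide_right_mono)
    note grid = etemadi_grid[of ?Z "\<lambda>_. n * 2 ^ m" a p, OF this, unfolded S]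
    show ?thesis
      unfolding A_def
    proof (rule grid)
      fix s :: "'d \<Rightarrow> nat" assume s: "\<forall>i. s i \<le> n * 2 ^ m"
      have "real (s i) / 2 ^ m \<le> real n" for i
      proof -
        have "real (s i) \<le> real (n * 2 ^ m)" using s by (simp only: of_nat_le_iff)
        then show ?thesis by (simp add: pos_divide_le_eq)
      qed
      then show "prob {\<omega> \<in> space M. a \<le> \<bar>inc 0 (?pt m s) \<omega>\<bar>} \<le> p"
        using dyadic_orthant by (intro p) (auto simp: less_eq_vec_def)
    qed
  qed
  have "incseq A"
  proof (rule incseq_SucI, rule subsetI)
    fix m \<omega> assume "\<omega> \<in> A m"
    then obtain s where s: "\<omega> \<in> space M" "s \<in> ?S m" "?b \<le> \<bar>inc 0 (?pt m s) \<omega>\<bar>"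
      by (auto simp: A_def)
    have "?pt (Suc m) (\<lambda>i. 2 * s i) = ?pt m s" by simp
    moreover have "(\<lambda>i. 2 * s i) \<in> ?S (Suc m)" using s(2) by (auto simp: PiE_iff)
    ultimately show "\<omega> \<in> A (Suc m)"
      using s unfolding A_def by (intro CollectI conjI bexI[of _ "\<lambda>i. 2 * s i"]) (auto simp del: power_Suc)
  qed
  then have "(\<lambda>m. prob (A m)) \<longlonglongrightarrow> prob (\<Union>m. A m)"
    using A by (intro finite_Lim_measure_incseq) auto
  then show "prob (dyadic_exceed n ?b) \<le> 3 ^ CARD('d) * p"
    unfolding U by (rule LIMSEQ_le_const2) (use P in auto)
  show "dyadic_exceed n ?b \<in> events"
    unfolding U using A by auto
qed

lemma prob_inc_one_le:
  assumes \<eta>: "0 < \<eta>" and fin: "(\<integral>\<^sup>+\<omega>. ennreal (\<bar>X (\<chi> i. 1) \<omega>\<bar> powr \<eta>) \<partial>M) < \<infinity>"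
  shows "\<exists>C\<ge>0. \<forall>a>0. prob {\<omega> \<in> space M. a \<le> \<bar>inc 0 (\<chi> i. 1) \<omega>\<bar>} \<le> C / a powr \<eta>"
proof -
  let ?u = "\<lambda>\<omega>. ennreal (\<bar>X (\<chi> i. 1) \<omega>\<bar> powr \<eta>)"
  have one: "(\<chi> i. 1) \<in> (orthant :: (real ^ 'd) set)" by (simp add: orthant_def)
  have [measurable]: "X (\<chi> i. 1) \<in> borel_measurable M" by (rule X_measurable[OF one])
  have [measurable]: "inc 0 (\<chi> i. 1) \<in> borel_measurable M"
    using one by (intro inc_measurable) (auto simp: orthant_iff)
  define C where "C = enn2real (\<integral>\<^sup>+\<omega>. ?u \<omega> \<partial>M)"
  have C: "(\<integral>\<^sup>+\<omega>. ?u \<omega> \<partial>M) = ennreal C" using fin by (simp add: C_def)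
  have "prob {\<omega> \<in> space M. a \<le> \<bar>inc 0 (\<chi> i. 1) \<omega>\<bar>} \<le> C / a powr \<eta>" if a: "a > 0" for a
  proof -
    have "prob {\<omega> \<in> space M. a \<le> \<bar>inc 0 (\<chi> i. 1) \<omega>\<bar>} = prob {\<omega> \<in> space M. a \<le> \<bar>X (\<chi> i. 1) \<omega>\<bar>}"
      using AE_inc_zero[OF one] by (intro finite_measure_eq_AE) auto
    also have "\<dots> \<le> C / a powr \<eta>"
    proof -
      have "emeasure M {\<omega> \<in> space M. a \<le> \<bar>X (\<chi> i. 1) \<omega>\<bar>} \<le>
          emeasure M {\<omega> \<in> space M. 1 \<le> ennreal (1 / a powr \<eta>) * ?u \<omega>}"
      proof (rule emeasure_mono, safe)
        fix \<omega> assume "a \<le> \<bar>X (\<chi> i. 1) \<omega>\<bar>"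
        then have "a powr \<eta> \<le> \<bar>X (\<chi> i. 1) \<omega>\<bar> powr \<eta>" using a \<eta> by (intro powr_mono2) auto
        then have "1 \<le> 1 / a powr \<eta> * \<bar>X (\<chi> i. 1) \<omega>\<bar> powr \<eta>" using a by (simp add: field_simps)
        then show "1 \<le> ennreal (1 / a powr \<eta>) * ?u \<omega>"
          by (simp add: ennreal_mult'[symmetric] ennreal_ge_1 del: ennreal_1)
      qed measurable
      also have "\<dots> \<le> ennreal (1 / a powr \<eta>) * (\<integral>\<^sup>+\<omega>. ?u \<omega> * indicator (space M) \<omega> \<partial>M)"
        by (rule nn_integral_Markov_inequality) auto
      also have "(\<integral>\<^sup>+\<omega>. ?u \<omega> * indicator (space M) \<omega> \<partial>M) = ennreal C"
        unfolding C[symmetric] by (intro nn_integral_cong) auto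
      also have "ennreal (1 / a powr \<eta>) * ennreal C = ennreal (C / a powr \<eta>)"
        by (simp add: ennreal_mult'[symmetric] C_def)
      finally show ?thesis
        by (simp add: emeasure_eq_measure C_def)
    qed
    finally show ?thesis .
  qed
  moreover have "C \<ge> 0" by (simp add: C_def)
  ultimately show ?thesis by blast
qed

lemma AE_poly_bounded:
  assumes \<eta>: "0 < \<eta>" and fin: "(\<integral>\<^sup>+\<omega>. ennreal (\<bar>X (\<chi> i. 1) \<omega>\<bar> powr \<eta>) \<partial>M) < \<infinity>"
  shows "AE \<omega> in M. \<exists>C N. \<forall>t\<in>orthant. \<bar>X t \<omega>\<bar> \<le> C * (1 + norm t) ^ N"
proof -
  let ?d = "CARD('d)"
  obtain C where C: "0 \<le> C" "\<And>a. a > 0 \<Longrightarrow> prob {\<omega> \<in> space M. a \<le> \<bar>inc 0 (\<chi> i. 1) \<omega>\<bar>} \<le> C / a powr \<eta>"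
    using prob_inc_one_le[OF assms] by blast
  obtain a0 where a0: "a0 > 0" "\<And>a s. a0 \<le> a \<Longrightarrow> s \<in> orthant \<Longrightarrow> s \<le> (\<chi> i. 1) \<Longrightarrow>
      prob {\<omega> \<in> space M. 2 * a \<le> \<bar>inc 0 s \<omega>\<bar>} \<le> 2 * prob {\<omega> \<in> space M. a \<le> \<bar>inc 0 (\<chi> i. 1) \<omega>\<bar>}"
    using unit_box_comparison by blast
  \<comment> \<open>With this \<open>K\<close>, the \<open>n ^ d\<close> unit boxes times the Markov
    bound of order \<open>n powr (- K * \<eta>)\<close> are at most of order
    \<open>n powr (- 2)\<close>, which is summable.\<close>
  obtain K :: nat where K: "(real ?d + 2) / \<eta> \<le> real K" using real_arch_simple by blast
  have K\<eta>: "real ?d + 2 \<le> real K * \<eta>" using K \<eta> by (simp add: field_simps)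
  have "K > 0" using K \<eta> by (cases K) (auto simp: field_simps)
  \<comment> \<open>The factors come from the maximal inequality, from the number of unit boxes, and
    from the comparison with the full unit cube, in this order.\<close>
  define b where "b n = 3 ^ ?d * (real n ^ ?d * (2 * real n ^ K))" for n
  have G: "dyadic_exceed n (b n) \<in> events \<and> prob (dyadic_exceed n (b n)) \<le> 3 ^ ?d * (2 * C) * inverse (real n ^ 2)"
    if n: "0 < n" "a0 \<le> real n" for n
  proof -
    have an: "a0 \<le> real n ^ K"
    proof -
      have "real n ^ 1 \<le> real n ^ K" using n \<open>K > 0\<close> by (intro power_increasing) auto
      then show ?thesis using n(2) unfolding power_one_right by linarith
    qed
    have n0: "real n > 0" using n by simp
    define p where "p = real n ^ ?d * (2 * (C / (real n ^ K) powr \<eta>))"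
    have p: "prob {\<omega> \<in> space M. real n ^ ?d * (2 * real n ^ K) \<le> \<bar>inc 0 t \<omega>\<bar>} \<le> p"
      if "t \<in> orthant" "t \<le> (\<chi> i. real n)" for t
      unfolding p_def
    proof (rule prob_inc_box_le[OF _ that n(1)])
      fix s :: "real ^ 'd" assume "s \<in> orthant" "s \<le> (\<chi> i. 1)"
      from a0(2)[OF an this] C(2)[of "real n ^ K"] n0
      show "prob {\<omega> \<in> space M. 2 * real n ^ K \<le> \<bar>inc 0 s \<omega>\<bar>} \<le> 2 * (C / (real n ^ K) powr \<eta>)"
        by simp
    qed
    have "p \<le> 2 * C * inverse (real n ^ 2)"
    proof -
      have "(real n ^ K) powr \<eta> = real n powr (real K * \<eta>)"
        using n0 by (simp add: powr_powr flip: powr_realpow)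
      then have "p = 2 * C * real n powr (real ?d - real K * \<eta>)"
        using n0 by (simp add: p_def powr_diff powr_realpow)
      also have "\<dots> \<le> 2 * C * real n powr (- 2)"
        using n K\<eta> C(1) by (intro mult_left_mono powr_mono) auto
      also have "real n powr (- 2) = inverse (real n ^ 2)"
        using n0 powr_realpow[of "real n" 2] by (simp add: powr_minus)
      finally show ?thesis .
    qed
    then have "3 ^ ?d * p \<le> 3 ^ ?d * (2 * C) * inverse (real n ^ 2)"
      by (simp add: mult.assoc)
    then show ?thesis
      using prob_dyadic_exceed[of n "real n ^ ?d * (2 * real n ^ K)" p, OF p] unfolding b_def by linarith
  qed
  define n0 where "n0 = nat \<lceil>a0\<rceil> + 1"
  have n0: "0 < n" "a0 \<le> real n" if "n0 \<le> n" for n using that by (auto simp: n0_def, linarith)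
  \<comment> \<open>The estimates hold only for positive \<open>n\<close> with
    \<open>a0 \<le> real n\<close>; the earlier events are emptied, which does not affect what
    happens eventually.\<close>
  define A where "A n = (if n0 \<le> n then dyadic_exceed n (b n) else {})" for n
  have A: "A n \<in> events" for n using G n0 by (auto simp: A_def)
  have "summable (\<lambda>n. prob (A n))"
  proof (rule summable_comparison_test)
    show "\<exists>N. \<forall>n\<ge>N. norm (prob (A n)) \<le> 3 ^ ?d * (2 * C) * inverse (real n ^ 2)"
      using G n0 by (intro exI[of _ n0]) (auto simp: A_def)
    show "summable (\<lambda>n. 3 ^ ?d * (2 * C) * inverse (real n ^ 2))"
      by (intro summable_mult inverse_power_summable) simp
  qed
  then have "AE \<omega> in M. \<forall>\<^sub>F n in sequentially. \<omega> \<in> space M - A n"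
    using A by (intro borel_cantelli_AE1) (auto simp: emeasure_eq_measure)
  with AE_lamp show ?thesis
  proof eventually_elim
    case (elim \<omega>)
    then obtain n1 where n1: "\<And>n. n1 \<le> n \<Longrightarrow> \<omega> \<in> space M - A n"
      by (auto simp: eventually_sequentially)
    let ?N = "?d + K"
    let ?c = "real (n0 + n1 + 1)"
    have "\<bar>X t \<omega>\<bar> \<le> 3 ^ ?d * 2 * ?c ^ ?N * (1 + norm t) ^ ?N" if t: "t \<in> orthant" for t
    proof -
      \<comment> \<open>Large enough for the estimates, for this path's Borel-Cantelli threshold
        \<open>n1\<close>, and for \<open>[0,n]^d\<close> to contain \<open>t\<close>, yet at most
        \<open>?c * (1 + norm t)\<close>.\<close>
      define n where "n = n0 + n1 + nat \<lceil>norm t\<rceil>"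
      have nt: "norm t \<le> real n" by (simp add: n_def) linarith
      have nc: "real n \<le> ?c * (1 + norm t)"
      proof -
        have "real (nat \<lceil>norm t\<rceil>) \<le> norm t + 1"
          using of_int_ceiling_le_add_one[of "norm t"] by simp
        moreover have "0 \<le> real (n0 + n1) * norm t" by simp
        moreover have "?c * (1 + norm t) = real (n0 + n1) + 1 + real (n0 + n1) * norm t + norm t"
          by (simp add: algebra_simps)
        ultimately show ?thesis unfolding n_def of_nat_add by linarith
      qed
      have "\<omega> \<notin> dyadic_exceed n (b n)" "\<omega> \<in> space M"
        using n1[of n] by (auto simp: n_def A_def)
      then have small: "\<bar>inc 0 (\<chi> i. real (s i) / 2 ^ m) \<omega>\<bar> < b n" if "s \<in> PiE UNIV (\<lambda>_. {..n * 2 ^ m})" for s m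
        using that unfolding dyadic_exceed_def by (auto simp: not_le)
      have "\<bar>X (round_up m t) \<omega>\<bar> \<le> b n" for m
      proof -
        define s where "s i = nat \<lceil>2 ^ m * t $ i\<rceil>" for i
        have t0: "0 \<le> t $ i" for i using t by (simp add: orthant_def)
        have up: "round_up m t = (\<chi> i. real (s i) / 2 ^ m)"
        proof (simp add: round_up_def s_def vec_eq_iff, intro allI)
          fix i
          have "0 \<le> 2 ^ m * t $ i" using t0[of i] by simp
          then have "0 \<le> \<lceil>2 ^ m * t $ i\<rceil>" by linarith
          then show "real_of_int \<lceil>2 ^ m * t $ i\<rceil> = real (nat \<lceil>2 ^ m * t $ i\<rceil>)" by simp
        qed
        have "s i \<le> n * 2 ^ m" for i
        proof -
          have "t $ i \<le> real n" using component_le_norm_cart[of t i] nt by linarith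
          then have "2 ^ m * t $ i \<le> real_of_int (int (n * 2 ^ m))" by (simp add: mult.commute)
          then show ?thesis unfolding s_def by (simp only: nat_le_iff ceiling_le_iff)
        qed
        then have "\<bar>inc 0 (round_up m t) \<omega>\<bar> < b n" unfolding up by (intro small) (auto simp: PiE_iff)
        then show ?thesis
          using lamp_increment_zero[OF elim(1) round_up_orthant[OF t]] by simp
      qed
      then have "\<bar>X t \<omega>\<bar> \<le> b n"
        by (intro LIMSEQ_le_const2[OF tendsto_rabs[OF lamp_round_up[OF elim(1) t]]]) auto
      also have "b n = 3 ^ ?d * 2 * real n ^ ?N" by (simp add: b_def power_add)
      also have "\<dots> \<le> 3 ^ ?d * 2 * (?c * (1 + norm t)) ^ ?N"
        using nc by (intro mult_left_mono power_mono) auto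
      finally show ?thesis by (simp add: power_mult_distrib mult.assoc)
    qed
    then show ?case by blast
  qed
qed

lemma AE_tempered:
  assumes "0 < \<eta>" "(\<integral>\<^sup>+\<omega>. ennreal (\<bar>X (\<chi> i. 1) \<omega>\<bar> powr \<eta>) \<partial>M) < \<infinity>"
  shows "AE \<omega> in M. \<omega> \<in> tempered_event M X"
  using AE_lamp AE_poly_bounded[OF assms] AE_space
proof eventually_elim
  case (elim \<omega>)
  then obtain C N where "\<And>t. t \<in> orthant \<Longrightarrow> \<bar>X t \<omega>\<bar> \<le> C * (1 + norm t) ^ N" by blast
  from poly_bounded_tempered[OF lamp_measurable[OF elim(1)] this] elim(3)
  show ?case unfolding tempered_event_def by blast
qed

end

section \<open>Independent blocks\<close>

text \<open>
  A Riemann sum of \<open>\<integral> \<psi>(s) \<Delta> X ds\<close>, with \<open>\<Delta> X\<close> the increment over the box with corners \<open>3j + s\<close> and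
  \<open>3j + s + 2\<close>, over the upper corners \<open>s\<close> of the dyadic cells of the unit cube: paths are
  right-continuous, so upper corners are the ones that give convergence.
\<close>

definition block :: "nat \<Rightarrow> (('d::finite \<Rightarrow> nat) \<Rightarrow> real) \<Rightarrow> nat \<Rightarrow> (real ^ 'd \<Rightarrow> real) \<Rightarrow> real" where
  "block m w j f = (\<Sum>e\<in>PiE UNIV (\<lambda>_. {0..<2 ^ m}). w e *
     increment (\<chi> i. 3 * real j + real (Suc (e i)) / 2 ^ m) (\<chi> i. 3 * real j + real (Suc (e i)) / 2 ^ m + 2) f)"

text \<open>The translation by \<open>3 * j\<close> is made in the index, so the cells of all blocks
  belong to one grid of mesh \<open>1 / 2 ^ m\<close>; joint independence of the blocks needs
  this.\<close>

definition cell_increment :: "nat \<Rightarrow> nat \<Rightarrow> ('d::finite \<Rightarrow> nat) \<Rightarrow> (real ^ 'd \<Rightarrow> real) \<Rightarrow> real" where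
  "cell_increment m j c f = increment (\<chi> i. real (c i + 3 * j * 2 ^ m) / 2 ^ m) (\<chi> i. real (Suc (c i + 3 * j * 2 ^ m)) / 2 ^ m) f"

text \<open>A discrete convolution of \<open>w\<close> with the indicator of a cube of side 2: the
  total weight of the boxes that cover the cell \<open>c\<close>.\<close>

definition cell_weight :: "nat \<Rightarrow> (('d::finite \<Rightarrow> nat) \<Rightarrow> real) \<Rightarrow> ('d \<Rightarrow> nat) \<Rightarrow> real" where
  "cell_weight m w c = (\<Sum>e\<in>PiE UNIV (\<lambda>_. {0..<2 ^ m}). w e * of_bool (\<forall>i. c i \<in> {Suc (e i)..<Suc (e i) + 2 * 2 ^ m}))"

lemma cell_increment_sum:
  fixes a b :: "'d::finite \<Rightarrow> nat"
  assumes "\<And>i. a i \<le> b i"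
  shows "(\<Sum>c\<in>PiE UNIV (\<lambda>i. {a i..<b i}). cell_increment m j c f) =
    increment (\<chi> i. 3 * real j + real (a i) / 2 ^ m) (\<chi> i. 3 * real j + real (b i) / 2 ^ m) f"
  unfolding cell_increment_def
  using increment_grid[of a b "\<lambda>_ k. real (k + 3 * j * 2 ^ m) / 2 ^ m" f, OF assms]
  by (simp add: add_divide_distrib add.commute)

text \<open>The boxes in a block overlap, so their increments are dependent. Exchanging the sums
  over boxes and cells rewrites the block in terms of disjoint cells.\<close>

lemma block_eq_cells:
  fixes w :: "('d::finite \<Rightarrow> nat) \<Rightarrow> real"
  shows "block m w j f = (\<Sum>c\<in>PiE UNIV (\<lambda>_. {0..<3 * 2 ^ m}). cell_weight m w c * cell_increment m j c f)"
proof -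
  let ?E = "PiE (UNIV :: 'd set) (\<lambda>_. {0..<2 ^ m :: nat})" and ?C = "PiE (UNIV :: 'd set) (\<lambda>_. {0..<3 * 2 ^ m :: nat})"
  have "increment (\<chi> i. 3 * real j + real (Suc (e i)) / 2 ^ m) (\<chi> i. 3 * real j + real (Suc (e i)) / 2 ^ m + 2) f =
      (\<Sum>c\<in>?C. of_bool (\<forall>i. c i \<in> {Suc (e i)..<Suc (e i) + 2 * 2 ^ m}) * cell_increment m j c f)" if "e \<in> ?E" for e
  proof -
    let ?B = "PiE UNIV (\<lambda>i. {Suc (e i)..<Suc (e i) + 2 * 2 ^ m})"
    have "increment (\<chi> i. 3 * real j + real (Suc (e i)) / 2 ^ m) (\<chi> i. 3 * real j + real (Suc (e i)) / 2 ^ m + 2) f =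
        (\<Sum>c\<in>?B. cell_increment m j c f)"
      by (subst cell_increment_sum) (auto simp: add_divide_distrib add_ac)
    also have "\<dots> = (\<Sum>c\<in>?C \<inter> ?B. cell_increment m j c f)"
    proof -
      \<comment> \<open>\<open>Suc (e i) \<le> 2 ^ m\<close>, so the box ends by
        \<open>3 * 2 ^ m\<close>: a block stays within side 3 and does not meet the next
        one.\<close>
      have "?B \<subseteq> ?C"
      proof (rule PiE_mono)
        fix i show "{Suc (e i)..<Suc (e i) + 2 * 2 ^ m} \<subseteq> {0..<3 * 2 ^ m}"
          using PiE_mem[OF that, of i] by auto
      qed
      then show ?thesis by (simp add: Int_absorb1)
    qed
    also have "\<dots> = (\<Sum>c\<in>?C. if c \<in> ?B then cell_increment m j c f else 0)"
      by (rule sum.inter_restrict) simp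
    also have "\<dots> = (\<Sum>c\<in>?C. of_bool (\<forall>i. c i \<in> {Suc (e i)..<Suc (e i) + 2 * 2 ^ m}) * cell_increment m j c f)"
      by (intro sum.cong) (auto simp: PiE_iff)
    finally show ?thesis .
  qed
  then have "block m w j f = (\<Sum>e\<in>?E. w e * (\<Sum>c\<in>?C. of_bool (\<forall>i. c i \<in> {Suc (e i)..<Suc (e i) + 2 * 2 ^ m}) * cell_increment m j c f))"
    unfolding block_def by (intro sum.cong) auto
  also have "\<dots> = (\<Sum>c\<in>?C. cell_weight m w c * cell_increment m j c f)"
    unfolding cell_weight_def sum_distrib_left sum_distrib_right by (subst sum.swap) (simp only: mult.assoc)
  finally show ?thesis .
qed

text \<open>Since \<open>Suc (e i) \<le> 2 ^ m\<close> and
  \<open>2 * 2 ^ m < Suc (e i) + 2 * 2 ^ m\<close>, every box covers the whole middle cube, whose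
  cells hence all carry the same full weight.\<close>

lemma cell_weight_inner:
  fixes w :: "('d::finite \<Rightarrow> nat) \<Rightarrow> real"
  assumes "c \<in> PiE UNIV (\<lambda>_. {2 ^ m..<2 * 2 ^ m})"
  shows "cell_weight m w c = (\<Sum>e\<in>PiE UNIV (\<lambda>_. {0..<2 ^ m}). w e)"
  unfolding cell_weight_def
proof (rule sum.cong)
  fix e assume e: "e \<in> PiE (UNIV :: 'd set) (\<lambda>_. {0..<2 ^ m :: nat})"
  have "c i \<in> {Suc (e i)..<Suc (e i) + 2 * 2 ^ m}" for i
    using PiE_mem[OF e, of i] PiE_mem[OF assms, of i] by auto
  then show "w e * of_bool (\<forall>i. c i \<in> {Suc (e i)..<Suc (e i) + 2 * 2 ^ m}) = w e" by simp
qed simp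

context levy_sheet
begin

lemma indep_grid_inj:
  fixes g :: "'d \<Rightarrow> nat \<Rightarrow> real"
  assumes g: "\<And>i. mono (g i)" "\<And>i. 0 \<le> g i 0" and I: "finite I" "inj_on q I"
  shows "indep_vars (\<lambda>_. borel) (\<lambda>x \<omega>. inc (\<chi> i. g i (q x i)) (\<chi> i. g i (Suc (q x i))) \<omega>) I"
proof -
  have "indep_vars (\<lambda>_. borel) (\<lambda>x \<omega>. \<Sum>c\<in>{q x}. 1 * inc (\<chi> i. g i (c i)) (\<chi> i. g i (Suc (c i))) \<omega>) I"
  proof (rule indep_vars_linear)
    show "indep_vars (\<lambda>_. borel) (\<lambda>c. inc (\<chi> i. g i (c i)) (\<chi> i. g i (Suc (c i)))) (q ` I)"
      using g I by (intro indep_grid) auto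
    show "disjoint_family_on (\<lambda>x. {q x}) I"
      using I(2) unfolding disjoint_family_on_def inj_on_def by blast
  qed auto
  then show ?thesis by simp
qed

lemma indep_cells:
  assumes "finite I" "inj_on (\<lambda>x i. c x i + 3 * j x * 2 ^ m) I"
  shows "indep_vars (\<lambda>_. borel) (\<lambda>x \<omega>. cell_increment m (j x) (c x) (\<lambda>t. X t \<omega>)) I"
  unfolding cell_increment_def
  by (rule indep_grid_inj[where g="\<lambda>_ k. real k / 2 ^ m" and q="\<lambda>x i. c x i + 3 * j x * 2 ^ m", OF _ _ assms])
     (auto simp: mono_def divide_right_mono)

lemma cell_measurable: "(\<lambda>\<omega>. cell_increment m j c (\<lambda>t. X t \<omega>)) \<in> borel_measurable M"
  unfolding cell_increment_def
  by (rule inc_measurable) (auto simp: orthant_def less_eq_vec_def divide_right_mono)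

lemma block_measurable [measurable]: "(\<lambda>\<omega>. block m w j (\<lambda>t. X t \<omega>)) \<in> borel_measurable M"
  unfolding block_eq_cells
  by (intro borel_measurable_sum borel_measurable_times borel_measurable_const cell_measurable)

lemma distr_cell: "distr M borel (\<lambda>\<omega>. cell_increment m j c (\<lambda>t. X t \<omega>)) = distr M borel (\<lambda>\<omega>. cell_increment m 0 c (\<lambda>t. X t \<omega>))"
proof -
  have eq: "(\<chi> i. real (c i + 3 * j * 2 ^ m) / 2 ^ m) = (\<chi> i. real (c i + 3 * 0 * 2 ^ m) / 2 ^ m) + (\<chi> i. 3 * real j)"
    "(\<chi> i. real (Suc (c i + 3 * j * 2 ^ m)) / 2 ^ m) = (\<chi> i. real (Suc (c i + 3 * 0 * 2 ^ m)) / 2 ^ m) + (\<chi> i. 3 * real j)"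
    by (simp_all add: vec_eq_iff add_divide_distrib)
  show ?thesis
    unfolding cell_increment_def eq
    by (rule distr_inc) (auto simp: orthant_def less_eq_vec_def divide_right_mono)
qed

lemma indep_blocks_family: "indep_vars (\<lambda>_. borel) (\<lambda>j \<omega>. block m w j (\<lambda>t. X t \<omega>)) {..<n}"
proof -
  let ?C = "PiE (UNIV :: 'd set) (\<lambda>_. {0..<3 * 2 ^ m :: nat})"
  have "indep_vars (\<lambda>_. borel) (\<lambda>x \<omega>. cell_increment m (fst x) (snd x) (\<lambda>t. X t \<omega>)) ({..<n} \<times> ?C)"
  proof (rule indep_cells)
    show "inj_on (\<lambda>x i. snd x i + 3 * fst x * 2 ^ m) ({..<n} \<times> ?C)"
    proof (rule inj_onI)
      fix x y :: "nat \<times> ('d \<Rightarrow> nat)"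
      assume xy: "x \<in> {..<n} \<times> ?C" "y \<in> {..<n} \<times> ?C"
        and eq: "(\<lambda>i. snd x i + 3 * fst x * 2 ^ m) = (\<lambda>i. snd y i + 3 * fst y * 2 ^ m)"
      define j l c d where "j = fst x" "l = fst y" "c = snd x" "d = snd y"
      note defs = this
      have c: "\<forall>i. c i < 3 * 2 ^ m" and d: "\<forall>i. d i < 3 * 2 ^ m"
        using xy by (auto simp: defs PiE_iff mem_Times_iff)
      have eq': "c i + 3 * 2 ^ m * j = d i + 3 * 2 ^ m * l" for i
        using fun_cong[OF eq, of i] by (simp add: defs mult_ac)
      \<comment> \<open>Each \<open>c i\<close> is below \<open>3 * 2 ^ m\<close>, so block number
        and cell index are quotient and remainder of the grid index.\<close>
      have "j = l"
        using arg_cong[OF eq', of "\<lambda>x. x div (3 * 2 ^ m)"] c d by simp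
      moreover have "c = d" using eq' \<open>j = l\<close> by auto
      ultimately show "x = y" by (simp add: defs prod_eq_iff)
    qed
  qed simp
  then have "indep_vars (\<lambda>_. borel) (\<lambda>j \<omega>. \<Sum>x\<in>{j} \<times> ?C. cell_weight m w (snd x) * cell_increment m (fst x) (snd x) (\<lambda>t. X t \<omega>)) {..<n}"
    by (rule indep_vars_linear) (auto simp: disjoint_family_on_def)
  moreover have "(\<Sum>x\<in>{j} \<times> ?C. cell_weight m w (snd x) * cell_increment m (fst x) (snd x) f) = block m w j f" for j f
    unfolding block_eq_cells by (rule sum.reindex_bij_witness[where i="Pair j" and j=snd]) auto
  ultimately show ?thesis by simp
qed

text \<open>The middle cells add up to \<open>\<kappa>\<close> times the increment over a unit cube,
  and the remaining cells are independent of them. The threshold \<open>a0\<close> must not depend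
  on \<open>m\<close>, \<open>w\<close> or \<open>j\<close>, because the mesh is refined and
  \<open>j\<close> tends to infinity afterwards.\<close>

lemma block_tail:
  assumes \<kappa>: "0 < \<kappa>"
  shows "\<exists>a0>0. \<forall>m w j a. (\<forall>e. 0 \<le> w e) \<longrightarrow> (\<Sum>e\<in>PiE (UNIV :: 'd set) (\<lambda>_. {0..<2 ^ m}). w e) = \<kappa> \<longrightarrow> a0 \<le> a \<longrightarrow>
    prob {\<omega> \<in> space M. 2 * a \<le> \<kappa> * \<bar>X (\<chi> i. 1) \<omega>\<bar>} / 2 \<le> prob {\<omega> \<in> space M. a \<le> \<bar>block m w j (\<lambda>t. X t \<omega>)\<bar>}"
proof -
  obtain a1 E where a1: "a1 > 0" and E: "E \<in> events" "prob E \<le> 1 / 2"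
    and bd: "\<And>\<omega> t. \<omega> \<in> space M - E \<Longrightarrow> t \<in> orthant \<Longrightarrow> t \<le> (\<chi> i. real 3) \<Longrightarrow> \<bar>X t \<omega>\<bar> \<le> a1"
    by (rule tight[of "1 / 2" 3]) auto
  \<comment> \<open>Off \<open>E\<close>, both block 0 and its middle part are at most
    \<open>\<kappa> * (2 ^ CARD('d) * a1)\<close>; the remainder is their difference.\<close>
  define a0 where "a0 = 2 * (\<kappa> * (2 ^ CARD('d) * a1))"
  have "prob {\<omega> \<in> space M. 2 * a \<le> \<kappa> * \<bar>X (\<chi> i. 1) \<omega>\<bar>} / 2 \<le> prob {\<omega> \<in> space M. a \<le> \<bar>block m w j (\<lambda>t. X t \<omega>)\<bar>}"
    if w: "\<forall>e. 0 \<le> w e" "(\<Sum>e\<in>PiE (UNIV :: 'd set) (\<lambda>_. {0..<2 ^ m}). w e) = \<kappa>" and a: "a0 \<le> a" for m w j a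
  proof -
    let ?C = "PiE (UNIV :: 'd set) (\<lambda>_. {0..<3 * 2 ^ m :: nat})"
    let ?B = "PiE (UNIV :: 'd set) (\<lambda>_. {2 ^ m..<2 * 2 ^ m :: nat})"
    let ?Z = "\<lambda>j c \<omega>. cell_increment m j c (\<lambda>t. X t \<omega>)"
    define v where "v = cell_weight m w"
    define D where "D j \<omega> = (\<Sum>c\<in>?B. \<kappa> * ?Z j c \<omega>)" for j \<omega>
    define R where "R j \<omega> = (\<Sum>c\<in>?C - ?B. v c * ?Z j c \<omega>)" for j \<omega>
    have BC: "?B \<subseteq> ?C" by (rule PiE_mono) auto
    have ind: "indep_vars (\<lambda>_. borel) (?Z j) ?C" for j
      by (rule indep_cells) (auto simp: inj_on_def fun_eq_iff)
    have D: "D j \<omega> = \<kappa> * inc (\<chi> i. 3 * real j + 1) (\<chi> i. 3 * real j + 2) \<omega>" for j \<omega>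
      unfolding D_def sum_distrib_left[symmetric] by (subst cell_increment_sum) auto
    have DR: "D j \<omega> + R j \<omega> = block m w j (\<lambda>t. X t \<omega>)" for j \<omega>
    proof -
      have "D j \<omega> = (\<Sum>c\<in>?B. v c * ?Z j c \<omega>)"
        unfolding D_def by (intro sum.cong) (auto simp: v_def cell_weight_inner w(2))
      then have "D j \<omega> + R j \<omega> = (\<Sum>c\<in>?C. v c * ?Z j c \<omega>)"
        unfolding R_def using BC by (subst sum.subset_diff[of ?B ?C]) auto
      then show ?thesis by (simp only: block_eq_cells v_def)
    qed
    have Rm [measurable]: "R j \<in> borel_measurable M" for j
      unfolding R_def using cell_measurable by (intro borel_measurable_sum borel_measurable_times) auto
    \<comment> \<open>The path bound is available on \<open>[0,3]^d\<close> only, so the remainder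
      is moved to block 0.\<close>
    have "distr M borel (R j) = distr M borel (R 0)"
      unfolding R_def by (rule distr_linear_eq) (auto intro: indep_vars_subset[OF ind] distr_cell)
    then have "measure (distr M borel (R j)) {x. \<bar>x\<bar> \<le> a} = measure (distr M borel (R 0)) {x. \<bar>x\<bar> \<le> a}" by simp
    then have Rj: "prob {\<omega> \<in> space M. \<bar>R j \<omega>\<bar> \<le> a} = prob {\<omega> \<in> space M. \<bar>R 0 \<omega>\<bar> \<le> a}"
      by (simp add: measure_distr vimage_def Int_def conj_commute)
    have "1 / 2 \<le> prob (space M - E)"
      using E by (simp add: prob_compl)
    also have "\<dots> \<le> prob {\<omega> \<in> space M. \<bar>R 0 \<omega>\<bar> \<le> a}"
    proof (rule finite_measure_mono)
      show "space M - E \<subseteq> {\<omega> \<in> space M. \<bar>R 0 \<omega>\<bar> \<le> a}"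
      proof
        fix \<omega> assume \<omega>: "\<omega> \<in> space M - E"
        have "\<bar>block m w 0 (\<lambda>t. X t \<omega>)\<bar> \<le> (\<Sum>e\<in>PiE UNIV (\<lambda>_. {0..<2 ^ m}). w e * (2 ^ CARD('d) * a1))"
          unfolding block_def
        proof (rule order_trans[OF sum_abs], rule sum_mono)
          fix e :: "'d \<Rightarrow> nat" assume e: "e \<in> PiE UNIV (\<lambda>_. {0..<2 ^ m})"
          have le1: "real (Suc (e i)) / 2 ^ m \<le> 1" for i
          proof -
            have "Suc (e i) \<le> 2 ^ m" using PiE_mem[OF e, of i] by auto
            then have "real (Suc (e i)) \<le> real (2 ^ m)" by (simp only: of_nat_le_iff)
            then show ?thesis by simp
          qed
          have "3 * real 0 + x + 2 \<le> real 3" if "x \<le> 1" for x using that by simp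
          then have "(\<chi> i. 3 * real 0 + real (Suc (e i)) / 2 ^ m + 2) \<le> (\<chi> i :: 'd. real 3)"
            unfolding less_eq_vec_def vec_lambda_beta using le1 by blast
          then have "\<bar>inc (\<chi> i. 3 * real 0 + real (Suc (e i)) / 2 ^ m) (\<chi> i. 3 * real 0 + real (Suc (e i)) / 2 ^ m + 2) \<omega>\<bar> \<le> 2 ^ CARD('d) * a1"
            by (intro inc_bound[where b="\<chi> i. real 3", OF bd[OF \<omega>]]) (assumption | simp add: orthant_def less_eq_vec_def)+
          then show "\<bar>w e * inc (\<chi> i. 3 * real 0 + real (Suc (e i)) / 2 ^ m) (\<chi> i. 3 * real 0 + real (Suc (e i)) / 2 ^ m + 2) \<omega>\<bar> \<le> w e * (2 ^ CARD('d) * a1)"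
            using w(1) by (simp add: abs_mult mult_left_mono)
        qed
        then have 1: "\<bar>block m w 0 (\<lambda>t. X t \<omega>)\<bar> \<le> \<kappa> * (2 ^ CARD('d) * a1)"
          by (simp only: sum_distrib_right[symmetric] w(2))
        have "\<bar>inc (\<chi> i. 3 * real 0 + 1) (\<chi> i. 3 * real 0 + 2) \<omega>\<bar> \<le> 2 ^ CARD('d) * a1"
          by (intro inc_bound[where b="\<chi> i. real 3", OF bd[OF \<omega>]]) (simp_all add: orthant_def less_eq_vec_def)
        then have "\<bar>D 0 \<omega>\<bar> \<le> \<kappa> * (2 ^ CARD('d) * a1)"
          unfolding D using \<kappa> by (simp add: abs_mult)
        then have "\<bar>R 0 \<omega>\<bar> \<le> a"
          using 1 DR[of 0 \<omega>] a unfolding a0_def by linarith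
        then show "\<omega> \<in> {\<omega> \<in> space M. \<bar>R 0 \<omega>\<bar> \<le> a}" using \<omega> by simp
      qed
      show "{\<omega> \<in> space M. \<bar>R 0 \<omega>\<bar> \<le> a} \<in> events" by measurable
    qed
    finally have half: "1 / 2 \<le> prob {\<omega> \<in> space M. \<bar>R j \<omega>\<bar> \<le> a}" by (simp only: Rj)
    have "prob {\<omega> \<in> space M. 2 * a \<le> \<bar>D j \<omega>\<bar>} * prob {\<omega> \<in> space M. \<bar>R j \<omega>\<bar> \<le> a} \<le> prob {\<omega> \<in> space M. a \<le> \<bar>D j \<omega> + R j \<omega>\<bar>}"
      unfolding D_def R_def by (rule indep_linear_pair[OF ind]) (use BC in auto)
    then have le: "prob {\<omega> \<in> space M. 2 * a \<le> \<bar>D j \<omega>\<bar>} * (1 / 2) \<le> prob {\<omega> \<in> space M. a \<le> \<bar>block m w j (\<lambda>t. X t \<omega>)\<bar>}"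
      unfolding DR by (rule order_trans[OF mult_left_mono[OF half], rotated]) simp
    have one: "(\<chi> i. 1) \<in> (orthant :: (real ^ 'd) set)" by (simp add: orthant_def)
    have [measurable]: "X (\<chi> i. 1) \<in> borel_measurable M" by (rule X_measurable[OF one])
    have [measurable]: "inc 0 (\<chi> i. 1) \<in> borel_measurable M"
      using one by (intro inc_measurable) (auto simp: orthant_iff)
    have "prob {\<omega> \<in> space M. 2 * a \<le> \<bar>D j \<omega>\<bar>} = prob {\<omega> \<in> space M. 2 * a / \<kappa> \<le> \<bar>inc (\<chi> i. 3 * real j + 1) (\<chi> i. 3 * real j + 2) \<omega>\<bar>}"
      unfolding D using \<kappa> by (simp add: abs_mult pos_divide_le_eq mult.commute)
    also have "\<dots> = prob {\<omega> \<in> space M. 2 * a / \<kappa> \<le> \<bar>inc 0 ((\<chi> i. 3 * real j + 2) - (\<chi> i. 3 * real j + 1)) \<omega>\<bar>}"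
      by (rule prob_inc) (auto simp: orthant_def less_eq_vec_def)
    also have "(\<chi> i. 3 * real j + 2) - (\<chi> i. 3 * real j + 1) = (\<chi> i :: 'd. 1)"
      by (simp add: vec_eq_iff)
    also have "prob {\<omega> \<in> space M. 2 * a / \<kappa> \<le> \<bar>inc 0 (\<chi> i. 1) \<omega>\<bar>} = prob {\<omega> \<in> space M. 2 * a / \<kappa> \<le> \<bar>X (\<chi> i. 1) \<omega>\<bar>}"
      using AE_inc_zero[OF one] by (intro finite_measure_eq_AE) auto
    also have "\<dots> = prob {\<omega> \<in> space M. 2 * a \<le> \<kappa> * \<bar>X (\<chi> i. 1) \<omega>\<bar>}"
      using \<kappa> by (simp add: pos_divide_le_eq mult.commute)
    finally show ?thesis using le by simp
  qed
  moreover have "a0 > 0" using a1 \<kappa> by (simp add: a0_def)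
  ultimately show ?thesis by blast
qed

end

section \<open>Pairing with bumps\<close>

locale bump =
  fixes h :: "nat \<Rightarrow> real \<Rightarrow> real"
  assumes deriv: "derivative_sequence h" and nonneg: "\<And>x. 0 \<le> h 0 x"
    and support: "\<And>n x. x \<notin> {0<..<1} \<Longrightarrow> h n x = 0" and pos: "0 < h 0 (1 / 2)"
begin

definition \<psi> :: "real ^ 'd::finite \<Rightarrow> real" where
  "\<psi> = bump_at h 0"

lemma \<psi>_nonneg: "0 \<le> \<psi> s"
  by (simp add: \<psi>_def bump_at_def prod_nonneg nonneg)

lemma \<psi>_support: "\<psi> s \<noteq> 0 \<Longrightarrow> 0 < s $ i \<and> s $ i < 1"
  using support[of "s $ i" 0] by (fastforce simp: \<psi>_def bump_at_def)

lemma bump_at_shift: "bump_at h v t = \<psi> (t - v)"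
  by (simp add: \<psi>_def bump_at_def)

lemma \<psi>_schwartz: "(\<psi> :: real ^ 'd::finite \<Rightarrow> real) \<in> schwartz_space"
  unfolding \<psi>_def using deriv support by (rule bump_schwartz)

lemma \<psi>_orthant: "indicator orthant s * (x * \<psi> s) = x * \<psi> s"
  using \<psi>_support[of s] by (cases "\<psi> s = 0") (auto simp: indicator_def orthant_def less_imp_le)

lemma \<psi>_measurable [measurable]: "\<psi> \<in> borel_measurable borel"
  by (rule schwartz_measurable[OF \<psi>_schwartz])

lemma \<psi>_integrable: "integrable lborel (\<psi> :: real ^ 'd::finite \<Rightarrow> real)"
proof -
  \<comment> \<open>The constant density 1 grows polynomially, with \<open>C = 1\<close> and
    \<open>N = 0\<close>.\<close>
  have "\<forall>\<phi>\<in>schwartz_space. set_integrable lborel orthant (\<lambda>t :: real ^ 'd. 1 * \<phi> t)"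
    by (rule poly_bounded_tempered(1)[of _ 1 0]) auto
  from this[rule_format, OF \<psi>_schwartz] show ?thesis
    unfolding set_integrable_def real_scaleR_def \<psi>_orthant by simp
qed

definition \<kappa> :: "'d::finite itself \<Rightarrow> real" where
  "\<kappa> _ = (LINT s|lborel. (\<psi> (s :: real ^ 'd)))"

lemma \<kappa>_pos: "0 < \<kappa> TYPE('d::finite)"
proof -
  have cont: "continuous_on UNIV (\<psi> :: real ^ 'd \<Rightarrow> real)"
  proof -
    have "(\<psi> :: real ^ 'd \<Rightarrow> real) differentiable_on UNIV"
      using smooth_bump[OF deriv, of 0] unfolding smooth_def \<psi>_def
      by (auto dest: spec[of _ "[]"] simp: partial_derivs_def)
    then show ?thesis by (rule differentiable_imp_continuous_on)
  qed
  let ?c = "(\<chi> i. 1 / 2) :: real ^ 'd"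
  have c: "0 < \<psi> ?c" using pos by (simp add: \<psi>_def bump_at_def prod_pos)
  have "\<kappa> TYPE('d) \<noteq> 0"
  proof
    assume "\<kappa> TYPE('d) = 0"
    then have "AE s in lborel. \<psi> (s :: real ^ 'd) = 0"
      unfolding \<kappa>_def using \<psi>_nonneg by (subst (asm) integral_nonneg_eq_0_iff_AE[OF \<psi>_integrable]) auto
    then have null: "emeasure lborel {s :: real ^ 'd. \<psi> s \<noteq> 0} = 0"
      by (simp add: AE_iff_measurable[OF _ refl])
    have "open {s :: real ^ 'd. \<psi> s \<noteq> 0}"
      by (rule open_Collect_neq[OF cont continuous_on_const])
    moreover have "{s :: real ^ 'd. \<psi> s \<noteq> 0} \<noteq> {}" using c by (metis (mono_tags) empty_Collect_eq less_irrefl)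
    ultimately have "\<not> negligible {s :: real ^ 'd. \<psi> s \<noteq> 0}"
      by (rule open_not_negligible)
    then show False
      using null by (simp add: negligible_iff_null_sets null_sets_def null_sets_completionI)
  qed
  moreover have "0 \<le> \<kappa> TYPE('d)"
    unfolding \<kappa>_def by (intro integral_nonneg_AE AE_I2 \<psi>_nonneg)
  ultimately show ?thesis by simp
qed

text \<open>The exact mass of \<open>\<psi>\<close> on a dyadic cell, indexed by its upper corner,
  instead of a value of \<open>\<psi>\<close> times a volume. The Riemann sum then equals an
  integral against \<open>round_up m s\<close>, and the weights add up to \<open>\<kappa>\<close>
  for every \<open>m\<close>, as \<open>block_tail\<close> demands.\<close>

definition weight :: "nat \<Rightarrow> ('d::finite \<Rightarrow> nat) \<Rightarrow> real" where
  "weight m e = (LINT s|lborel. \<psi> s * of_bool (round_up m s = (\<chi> i. real (Suc (e i)) / 2 ^ m)))"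

lemma weight_nonneg: "0 \<le> weight m e"
  unfolding weight_def by (intro integral_nonneg_AE AE_I2) (simp add: \<psi>_nonneg)

lemma weight_integrable:
  "integrable lborel (\<lambda>s :: real ^ 'd::finite. \<psi> s * of_bool (round_up m s = v))"
proof (rule Bochner_Integration.integrable_bound[OF \<psi>_integrable])
  have "(\<lambda>s. of_bool (round_up m s = v) :: real) \<in> borel_measurable borel"
    by (rule measurable_round_up)
  then show "(\<lambda>s :: real ^ 'd. \<psi> s * of_bool (round_up m s = v)) \<in> borel_measurable lborel"
    by measurable
qed (auto simp: abs_mult)

lemma \<psi>_round_up:
  fixes G :: "real ^ 'd::finite \<Rightarrow> real"
  shows "\<psi> s * G (round_up m s) = (\<Sum>e\<in>PiE UNIV (\<lambda>_. {0..<2 ^ m}).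
    G (\<chi> i. real (Suc (e i)) / 2 ^ m) * (\<psi> s * of_bool (round_up m s = (\<chi> i. real (Suc (e i)) / 2 ^ m))))"
proof (cases "\<psi> s = 0")
  case False
  let ?E = "PiE (UNIV :: 'd set) (\<lambda>_. {0..<2 ^ m :: nat})" and ?pt = "\<lambda>e. \<chi> i :: 'd. real (Suc (e i)) / 2 ^ m"
  \<comment> \<open>On the support of \<open>\<psi>\<close> each coordinate lies strictly between 0
    and 1, so the ceiling runs from 1 to \<open>2 ^ m\<close>; hence the shift by one.\<close>
  define e where "e i = nat (\<lceil>2 ^ m * s $ i\<rceil> - 1)" for i
  have ce: "0 < \<lceil>2 ^ m * s $ i\<rceil>" "\<lceil>2 ^ m * s $ i\<rceil> \<le> 2 ^ m" for i
  proof -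
    have s: "0 < s $ i" "s $ i < 1" using \<psi>_support[OF False, of i] by auto
    show "0 < \<lceil>2 ^ m * s $ i\<rceil>" using s(1) by simp
    show "\<lceil>2 ^ m * s $ i\<rceil> \<le> 2 ^ m" using s(2) by (simp add: ceiling_le_iff)
  qed
  have eS: "real (Suc (e i)) = real_of_int \<lceil>2 ^ m * s $ i\<rceil>" for i
    using ce(1)[of i] by (simp add: e_def)
  have pt: "round_up m s = ?pt e" by (simp only: round_up_def eS)
  have "e i < 2 ^ m" for i
  proof -
    have "int (e i) < int (2 ^ m)" using ce[of i] unfolding e_def by simp
    then show ?thesis by (simp only: of_nat_less_iff)
  qed
  then have eE: "e \<in> ?E" by (simp add: PiE_iff)
  have inj: "round_up m s = ?pt f \<longleftrightarrow> f = e" for f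
  proof
    assume "round_up m s = ?pt f"
    then have eq: "?pt e = ?pt f" unfolding pt .
    have "f i = e i" for i
    proof -
      have "?pt e $ i = ?pt f $ i" by (simp only: eq)
      then show ?thesis by simp
    qed
    then show "f = e" by blast
  qed (simp only: pt)
  have "(\<Sum>f\<in>?E. G (?pt f) * (\<psi> s * of_bool (round_up m s = ?pt f))) = (\<Sum>f\<in>?E. if f = e then G (?pt f) * \<psi> s else 0)"
    by (intro sum.cong refl) (simp only: inj, simp)
  also have "\<dots> = \<psi> s * G (round_up m s)"
    unfolding pt using eE by (subst sum.delta) (simp_all add: mult.commute)
  finally show ?thesis by simp
qed simp

lemma integral_round_up:
  fixes G :: "real ^ 'd::finite \<Rightarrow> real"
  shows "(LINT s|lborel. \<psi> s * G (round_up m s)) = (\<Sum>e\<in>PiE UNIV (\<lambda>_. {0..<2 ^ m}). weight m e * G (\<chi> i. real (Suc (e i)) / 2 ^ m))"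
proof -
  have "(LINT s|lborel. \<psi> s * G (round_up m s)) = (LINT s|lborel. (\<Sum>e\<in>PiE UNIV (\<lambda>_. {0..<2 ^ m}).
      G (\<chi> i. real (Suc (e i)) / 2 ^ m) * (\<psi> s * of_bool (round_up m s = (\<chi> i. real (Suc (e i)) / 2 ^ m)))))"
    by (rule Bochner_Integration.integral_cong[OF refl \<psi>_round_up])
  also have "\<dots> = (\<Sum>e\<in>PiE UNIV (\<lambda>_. {0..<2 ^ m}).
      LINT s|lborel. G (\<chi> i. real (Suc (e i)) / 2 ^ m) * (\<psi> s * of_bool (round_up m s = (\<chi> i. real (Suc (e i)) / 2 ^ m))))"
    by (rule Bochner_Integration.integral_sum) (rule integrable_mult_right[OF weight_integrable])
  finally show ?thesis
    by (simp only: integral_mult_right_zero weight_def mult.commute)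
qed

lemma sum_weight: "(\<Sum>e\<in>PiE UNIV (\<lambda>_ :: 'd. {0..<2 ^ m}). weight m e) = \<kappa> TYPE('d::finite)"
  using integral_round_up[of "\<lambda>_ :: real ^ 'd. 1" m] by (simp add: \<kappa>_def)

text \<open>The variable \<open>W_j\<close> of the overview after a change of variables: the mixed
  difference has moved from the bump to the path.\<close>

definition limit_block :: "nat \<Rightarrow> (real ^ 'd::finite \<Rightarrow> real) \<Rightarrow> real" where
  "limit_block j f = (LINT s|lborel. \<psi> s * increment ((\<chi> i. 3 * real j) + s) ((\<chi> i. 3 * real j + 2) + s) f)"

text \<open>Rounding \<open>s\<close> up moves all corners of the box upwards at once, so
  right-continuity applies at each of them. Over the support of \<open>\<psi>\<close> they stay in
  \<open>[0, 3 * j + 3]^d\<close>, where the path is bounded, and dominated convergence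
  applies.\<close>

lemma tendsto_block:
  fixes f :: "real ^ 'd::finite \<Rightarrow> real"
  assumes f: "lamp f"
  shows "(\<lambda>m. block m (weight m) j f) \<longlonglongrightarrow> limit_block j f"
proof -
  let ?a = "\<chi> i :: 'd. 3 * real j" and ?b = "\<chi> i :: 'd. 3 * real j + 2"
  define G where "G s = increment (?a + s) (?b + s) f" for s
  have blk: "block m (weight m) j f = (LINT s|lborel. \<psi> s * G (round_up m s))" for m
  proof -
    have "(\<chi> i :: 'd. 3 * real j + real (Suc (e i)) / 2 ^ m) = ?a + (\<chi> i. real (Suc (e i)) / 2 ^ m)"
      "(\<chi> i :: 'd. 3 * real j + real (Suc (e i)) / 2 ^ m + 2) = ?b + (\<chi> i. real (Suc (e i)) / 2 ^ m)" for e
      by (simp_all add: vec_eq_iff)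
    then show ?thesis unfolding integral_round_up block_def by (simp only: G_def)
  qed
  obtain B where B: "\<forall>u\<in>{0 .. (\<chi> i. 3 * real j + 3)} \<inter> orthant. \<bar>f u\<bar> \<le> B"
    using lamp_bounded[OF f compact_interval] by blast
  have "(\<lambda>m. LINT s|lborel. \<psi> s * G (round_up m s)) \<longlonglongrightarrow> (LINT s|lborel. \<psi> s * G s)"
  proof (rule integral_dominated_convergence)
    have lim: "(\<lambda>m. \<psi> s * G (round_up m s)) \<longlonglongrightarrow> \<psi> s * G s" for s
    proof (cases "\<psi> s = 0")
      case False
      then have s: "0 < s $ i" for i using \<psi>_support by blast
      have "(\<lambda>m. f (\<chi> i. if \<epsilon> i = 1 then (?a + round_up m s) $ i else (?b + round_up m s) $ i)) \<longlonglongrightarrow>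
          f (\<chi> i. if \<epsilon> i = 1 then (?a + s) $ i else (?b + s) $ i)" for \<epsilon> :: "'d \<Rightarrow> nat"
      proof (rule lamp_right_continuous[OF f])
        show "(\<chi> i. if \<epsilon> i = 1 then (?a + s) $ i else (?b + s) $ i) \<in> orthant"
          using less_imp_le[OF s] by (auto simp: orthant_def intro!: add_nonneg_nonneg)
        show "(\<lambda>m. \<chi> i. if \<epsilon> i = 1 then (?a + round_up m s) $ i else (?b + round_up m s) $ i) \<longlonglongrightarrow>
            (\<chi> i. if \<epsilon> i = 1 then (?a + s) $ i else (?b + s) $ i)"
        proof (rule vec_tendstoI)
          fix i
          have "(\<lambda>m. round_up m s $ i) \<longlonglongrightarrow> s $ i"
            by (rule tendsto_vec_nth[OF tendsto_round_up])
          then show "(\<lambda>m. (\<chi> i. if \<epsilon> i = 1 then (?a + round_up m s) $ i else (?b + round_up m s) $ i) $ i) \<longlonglongrightarrow>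
              (\<chi> i. if \<epsilon> i = 1 then (?a + s) $ i else (?b + s) $ i) $ i"
            by (cases "\<epsilon> i = 1") (auto intro!: tendsto_intros)
        qed
        show "(\<chi> i. if \<epsilon> i = 1 then (?a + s) $ i else (?b + s) $ i) \<le>
            (\<chi> i. if \<epsilon> i = 1 then (?a + round_up m s) $ i else (?b + round_up m s) $ i)" for m
          using round_up_ge[of s m] by (auto simp: less_eq_vec_def)
      qed
      then show ?thesis
        unfolding G_def increment_def by (intro tendsto_mult tendsto_sum tendsto_const)
    qed simp
    then show "AE s in lborel. (\<lambda>m. \<psi> s * G (round_up m s)) \<longlonglongrightarrow> \<psi> s * G s" by simp
    show m: "(\<lambda>s. \<psi> s * G (round_up m s)) \<in> borel_measurable lborel" for m
      using measurable_round_up[of G m] by measurable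
    show "(\<lambda>s. \<psi> s * G s) \<in> borel_measurable lborel"
      by (rule borel_measurable_LIMSEQ_real[OF lim m])
    show "integrable lborel (\<lambda>s. \<psi> s * (2 ^ CARD('d) * B))"
      by (intro integrable_mult_left \<psi>_integrable)
    have "norm (\<psi> s * G (round_up m s)) \<le> \<psi> s * (2 ^ CARD('d) * B)" for s m
    proof (cases "\<psi> s = 0")
      case False
      have r: "0 \<le> round_up m s $ i" "round_up m s $ i \<le> 1" for i
      proof -
        have s: "0 < s $ i" "s $ i < 1" using \<psi>_support[OF False] by auto
        then show "0 \<le> round_up m s $ i"
          using round_up_ge[of s m] unfolding less_eq_vec_def by (meson less_imp_le order_trans)
        have "\<lceil>2 ^ m * s $ i\<rceil> \<le> 2 ^ m" using s by (simp add: ceiling_le_iff)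
        then have "real_of_int \<lceil>2 ^ m * s $ i\<rceil> \<le> real_of_int (2 ^ m)" by (simp only: of_int_le_iff)
        then show "round_up m s $ i \<le> 1" by (simp add: round_up_def)
      qed
      have "\<bar>G (round_up m s)\<bar> \<le> 2 ^ CARD('d) * B"
        unfolding G_def
      proof (rule abs_increment_le)
        fix t :: "real ^ 'd"
        assume t: "\<forall>i. t $ i = (?a + round_up m s) $ i \<or> t $ i = (?b + round_up m s) $ i"
        have "0 \<le> t $ i \<and> t $ i \<le> 3 * real j + 3" for i
          using t[rule_format, of i] r[of i] by auto
        then show "\<bar>f t\<bar> \<le> B" by (intro B[rule_format]) (auto simp: orthant_def less_eq_vec_def)
      qed
      then show ?thesis using \<psi>_nonneg[of s] by (simp add: abs_mult mult_left_mono)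
    qed simp
    then show "AE s in lborel. norm (\<psi> s * G (round_up m s)) \<le> \<psi> s * (2 ^ CARD('d) * B)" for m
      by simp
  qed
  then show ?thesis
    unfolding blk limit_block_def G_def .
qed

text \<open>For \<open>v\<close> in the orthant the support of the translated bump lies in the
  orthant, so the restriction of the integral disappears after the change of variables.
  Integrability is transferred too, since the alternating sum of pairings has to be taken out of the
  integral.\<close>

lemma pairing_translate:
  fixes f :: "real ^ 'd::finite \<Rightarrow> real"
  assumes "lamp f" "v \<in> orthant"
  shows "(LINT t:orthant|lborel. f t * bump_at h v t) = (LINT s|lborel. \<psi> s * f (v + s))"
    and "set_integrable lborel orthant (\<lambda>t. f t * bump_at h v t) \<Longrightarrow> integrable lborel (\<lambda>s. \<psi> s * f (v + s))"
proof -
  let ?F = "\<lambda>t. (indicator orthant t * f t) * bump_at h v t"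
  have bm: "bump_at h v \<in> borel_measurable borel"
    by (rule schwartz_measurable[OF bump_schwartz[OF deriv support]])
  have [measurable]: "?F \<in> borel_measurable borel"
    by (rule borel_measurable_times[OF lamp_measurable[OF assms(1)] bm])
  have eq: "?F (v + s) = \<psi> s * f (v + s)" for s
  proof (cases "\<psi> s = 0")
    case False
    then have "0 \<le> s $ i" for i using \<psi>_support[of s i] by simp
    then have "v + s \<in> orthant" using assms(2) by (auto simp: orthant_def)
    then show ?thesis by (simp add: bump_at_shift)
  qed (simp add: bump_at_shift)
  have "(LINT t|lborel. ?F t) = (LINT t|distr lborel borel ((+) v). ?F t)"
    by (simp add: lborel_distr_plus)
  also have "\<dots> = (LINT s|lborel. ?F (v + s))"
    by (rule integral_distr) measurable
  finally show "(LINT t:orthant|lborel. f t * bump_at h v t) = (LINT s|lborel. \<psi> s * f (v + s))"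
    unfolding eq by (simp add: set_lebesgue_integral_def mult.assoc)
  assume "set_integrable lborel orthant (\<lambda>t. f t * bump_at h v t)"
  then have "integrable (distr lborel borel ((+) v)) ?F"
    by (simp add: lborel_distr_plus set_integrable_def mult.assoc)
  then have "integrable lborel (\<lambda>s. ?F (v + s))"
    by (subst (asm) integrable_distr_eq) measurable
  then show "integrable lborel (\<lambda>s. \<psi> s * f (v + s))" unfolding eq .
qed

text \<open>A block is an alternating sum of \<open>2 ^ d\<close> pairings with bumps at distance of
  order \<open>j\<close>. A single natural number \<open>p\<close> governs both constant and degree,
  so that the exceptional sets form a countable family; the inequality is strict so that it is
  inherited by the Riemann sums for large \<open>m\<close>.\<close>

lemma limit_block_poly_bounded:
  fixes f :: "real ^ 'd::finite \<Rightarrow> real"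
  assumes f: "lamp f" and int: "\<And>\<phi>. \<phi> \<in> schwartz_space \<Longrightarrow> set_integrable lborel orthant (\<lambda>t. f t * \<phi> t)"
    and T: "tempered_distribution (\<lambda>\<phi>. LINT t:orthant|lborel. f t * \<phi> t)"
  shows "\<exists>p :: nat. \<forall>j. \<bar>limit_block j f\<bar> < (real p + 1) * (1 + real j) ^ (p + 1)"
proof -
  obtain C N where C: "\<And>v. \<bar>(LINT t:orthant|lborel. f t * bump_at h v t)\<bar> \<le> C * (1 + norm v) ^ N"
    using tempered_bump_bound[OF deriv support T] by blast
  let ?E = "(UNIV :: 'd set) \<rightarrow>\<^sub>E {0, 1 :: nat}"
  define K where "K = 2 ^ CARD('d) * (\<bar>C\<bar> * (3 * real CARD('d) + 1) ^ N)"
  have bound: "\<bar>limit_block j f\<bar> \<le> K * (1 + real j) ^ N" for j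
  proof -
    define v where "v \<epsilon> = (\<chi> i :: 'd. if \<epsilon> i = (1 :: nat) then 3 * real j else 3 * real j + 2)" for \<epsilon>
    have vo: "v \<epsilon> \<in> orthant" for \<epsilon> by (auto simp: v_def orthant_def)
    have I: "integrable lborel (\<lambda>s. \<psi> s * f (v \<epsilon> + s))" for \<epsilon>
      by (rule pairing_translate(2)[OF f vo int[OF bump_schwartz[OF deriv support]]])
    have "\<psi> s * increment ((\<chi> i. 3 * real j) + s) ((\<chi> i. 3 * real j + 2) + s) f =
        (\<Sum>\<epsilon>\<in>?E. (-1) ^ (\<Sum>i\<in>UNIV. \<epsilon> i) * (\<psi> s * f (v \<epsilon> + s)))" for s
    proof -
      have "(\<chi> i. if \<epsilon> i = 1 then ((\<chi> i. 3 * real j) + s) $ i else ((\<chi> i. 3 * real j + 2) + s) $ i) = v \<epsilon> + s" for \<epsilon> :: "'d \<Rightarrow> nat"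
        by (auto simp: v_def vec_eq_iff)
      then show ?thesis unfolding increment_def by (simp add: sum_distrib_left mult.left_commute)
    qed
    then have "limit_block j f = (LINT s|lborel. (\<Sum>\<epsilon>\<in>?E. (-1) ^ (\<Sum>i\<in>UNIV. \<epsilon> i) * (\<psi> s * f (v \<epsilon> + s))))"
      unfolding limit_block_def by simp
    also have "\<dots> = (\<Sum>\<epsilon>\<in>?E. (-1) ^ (\<Sum>i\<in>UNIV. \<epsilon> i) * (LINT s|lborel. \<psi> s * f (v \<epsilon> + s)))"
      using I by (subst Bochner_Integration.integral_sum) auto
    finally have "\<bar>limit_block j f\<bar> \<le> (\<Sum>\<epsilon>\<in>?E. \<bar>(LINT s|lborel. \<psi> s * f (v \<epsilon> + s))\<bar>)"
      by (auto intro!: order_trans[OF sum_abs] simp: abs_mult power_abs)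
    also have "\<dots> \<le> (\<Sum>\<epsilon>\<in>?E. \<bar>C\<bar> * ((3 * real CARD('d) + 1) * (1 + real j)) ^ N)"
    proof (rule sum_mono)
      fix \<epsilon> :: "'d \<Rightarrow> nat"
      have "norm (v \<epsilon>) \<le> (\<Sum>i\<in>UNIV. \<bar>v \<epsilon> $ i\<bar>)" by (rule norm_le_l1_cart)
      also have "\<dots> \<le> (\<Sum>i\<in>(UNIV :: 'd set). 3 * real j + 2)" by (intro sum_mono) (simp add: v_def)
      finally have "1 + norm (v \<epsilon>) \<le> 1 + real CARD('d) * (3 * real j + 2)" by simp
      also have "\<dots> \<le> (3 * real CARD('d) + 1) * (1 + real j)" by (simp add: algebra_simps)
      finally have "(1 + norm (v \<epsilon>)) ^ N \<le> ((3 * real CARD('d) + 1) * (1 + real j)) ^ N"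
        by (intro power_mono) auto
      then have "\<bar>C\<bar> * (1 + norm (v \<epsilon>)) ^ N \<le> \<bar>C\<bar> * ((3 * real CARD('d) + 1) * (1 + real j)) ^ N"
        by (rule mult_left_mono) simp
      moreover have "C * (1 + norm (v \<epsilon>)) ^ N \<le> \<bar>C\<bar> * (1 + norm (v \<epsilon>)) ^ N"
        by (intro mult_right_mono) auto
      ultimately show "\<bar>(LINT s|lborel. \<psi> s * f (v \<epsilon> + s))\<bar> \<le> \<bar>C\<bar> * ((3 * real CARD('d) + 1) * (1 + real j)) ^ N"
        using C[of "v \<epsilon>"] unfolding pairing_translate(1)[OF f vo] by linarith
    qed
    also have "\<dots> = K * (1 + real j) ^ N" by (simp add: card_PiE K_def power_mult_distrib)
    finally show ?thesis .
  qed
  obtain q :: nat where q: "K \<le> real q" using real_arch_simple by blast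
  have "\<bar>limit_block j f\<bar> < (real (max q N) + 1) * (1 + real j) ^ (max q N + 1)" for j
  proof -
    have "K * (1 + real j) ^ N \<le> real (max q N) * (1 + real j) ^ (max q N + 1)"
      using q by (intro mult_mono power_increasing) auto
    also have "\<dots> < (real (max q N) + 1) * (1 + real j) ^ (max q N + 1)"
      by (intro mult_strict_right_mono) auto
    finally show ?thesis using bound[of j] by linarith
  qed
  then show ?thesis by blast
qed

end

section \<open>Absence of moments\<close>

context levy_sheet
begin

text \<open>With \<open>U = (\<bar>Y\<bar> / \<beta>) powr (1 / (p + 1))\<close> the events read
  \<open>1 + j \<le> U\<close>, and \<open>U\<close> is at most 1 plus the number of them that
  occur. A summable tail would thus give \<open>U\<close>, and with it this moment of
  \<open>Y\<close>, a finite expectation.\<close>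

lemma not_summable_tail:
  assumes [measurable]: "Y \<in> borel_measurable M" and \<beta>: "0 < \<beta>"
    and inf: "(\<integral>\<^sup>+\<omega>. ennreal (\<bar>Y \<omega>\<bar> powr (1 / real (p + 1))) \<partial>M) = \<infinity>"
  shows "\<not> summable (\<lambda>j. prob {\<omega> \<in> space M. \<beta> * (1 + real j) ^ (p + 1) \<le> \<bar>Y \<omega>\<bar>})"
proof
  let ?A = "\<lambda>j. {\<omega> \<in> space M. \<beta> * (1 + real j) ^ (p + 1) \<le> \<bar>Y \<omega>\<bar>}"
  let ?\<eta> = "1 / real (p + 1)"
  assume sum: "summable (\<lambda>j. prob (?A j))"
  define U where "U \<omega> = (\<bar>Y \<omega>\<bar> / \<beta>) powr ?\<eta>" for \<omega>
  have U0: "0 \<le> U \<omega>" for \<omega> by (simp add: U_def)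
  have Upow: "\<beta> * U \<omega> ^ (p + 1) = \<bar>Y \<omega>\<bar>" for \<omega>
  proof -
    have "U \<omega> ^ (p + 1) = \<bar>Y \<omega>\<bar> / \<beta>"
    proof (cases "Y \<omega> = 0")
      case False
      then have "U \<omega> ^ (p + 1) = U \<omega> powr real (p + 1)"
        using \<beta> by (subst powr_realpow) (auto simp: U_def)
      also have "\<dots> = \<bar>Y \<omega>\<bar> / \<beta>"
        using False \<beta> by (simp add: U_def powr_powr del: of_nat_add of_nat_Suc)
      finally show ?thesis .
    qed (simp add: U_def)
    then show ?thesis using \<beta> by simp
  qed
  have A: "\<omega> \<in> ?A j \<longleftrightarrow> 1 + real j \<le> U \<omega>" if "\<omega> \<in> space M" for \<omega> j
  proof -
    have "\<omega> \<in> ?A j \<longleftrightarrow> \<beta> * (1 + real j) ^ (p + 1) \<le> \<beta> * U \<omega> ^ (p + 1)"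
      using that by (simp only: Upow mem_Collect_eq simp_thms)
    also have "\<dots> \<longleftrightarrow> (1 + real j) ^ (p + 1) \<le> U \<omega> ^ (p + 1)"
      using \<beta> by (simp only: mult_le_cancel_left_pos)
    also have "\<dots> \<longleftrightarrow> 1 + real j \<le> U \<omega>"
      using U0[of \<omega>] by (intro power_mono_iff) auto
    finally show ?thesis .
  qed
  have le: "ennreal (U \<omega>) \<le> 1 + (\<Sum>j. indicator (?A j) \<omega>)" if \<omega>: "\<omega> \<in> space M" for \<omega>
  proof -
    define n where "n = nat \<lfloor>U \<omega>\<rfloor>"
    have "real n = real_of_int \<lfloor>U \<omega>\<rfloor>" using U0[of \<omega>] by (simp add: n_def)
    then have n: "real n \<le> U \<omega>" "U \<omega> \<le> 1 + real n" by linarith+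
    have "\<omega> \<in> ?A j" if "j < n" for j
    proof -
      have "1 + real j \<le> real n" using that by linarith
      then show ?thesis unfolding A[OF \<omega>] using n(1) by linarith
    qed
    then have "ennreal (real n) = (\<Sum>j<n. indicator (?A j) \<omega>)" by (simp add: ennreal_of_nat_eq_real_of_nat)
    also have "\<dots> \<le> (\<Sum>j. indicator (?A j) \<omega>)" by (rule sum_le_suminf) auto
    finally have 1: "1 + ennreal (real n) \<le> 1 + (\<Sum>j. indicator (?A j) \<omega>)" by (rule add_left_mono)
    have "ennreal (U \<omega>) \<le> ennreal (1 + real n)" using n(2) by (rule ennreal_leI)
    also have "\<dots> = 1 + ennreal (real n)" by (subst ennreal_plus) simp_all
    also note 1
    finally show ?thesis .
  qed
  have "(\<integral>\<^sup>+\<omega>. ennreal (U \<omega>) \<partial>M) \<le> (\<integral>\<^sup>+\<omega>. 1 + (\<Sum>j. indicator (?A j) \<omega>) \<partial>M)"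
    by (rule nn_integral_mono) (rule le)
  also have "\<dots> = 1 + (\<Sum>j. \<integral>\<^sup>+\<omega>. indicator (?A j) \<omega> \<partial>M)"
    by (subst nn_integral_add) (auto simp: emeasure_space_1 nn_integral_suminf)
  also have "\<dots> = 1 + (\<Sum>j. ennreal (prob (?A j)))"
    by (simp add: emeasure_eq_measure)
  also have "\<dots> < \<infinity>"
    using sum by (simp add: ennreal_suminf_neq_top less_top[symmetric])
  finally have fin: "(\<integral>\<^sup>+\<omega>. ennreal (U \<omega>) \<partial>M) < \<infinity>" .
  have "(\<integral>\<^sup>+\<omega>. ennreal (\<bar>Y \<omega>\<bar> powr ?\<eta>) \<partial>M) = (\<integral>\<^sup>+\<omega>. ennreal (\<beta> powr ?\<eta>) * ennreal (U \<omega>) \<partial>M)"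
  proof (rule nn_integral_cong)
    fix \<omega>
    have eq: "\<beta> powr ?\<eta> * U \<omega> = \<bar>Y \<omega>\<bar> powr ?\<eta>"
      using \<beta> unfolding U_def by (subst powr_mult[symmetric]) auto
    show "ennreal (\<bar>Y \<omega>\<bar> powr ?\<eta>) = ennreal (\<beta> powr ?\<eta>) * ennreal (U \<omega>)"
      unfolding eq[symmetric] by (rule ennreal_mult) (auto simp: U0)
  qed
  also have "\<dots> = ennreal (\<beta> powr ?\<eta>) * (\<integral>\<^sup>+\<omega>. ennreal (U \<omega>) \<partial>M)"
    by (rule nn_integral_cmult) (simp add: U_def)
  also have "\<dots> < \<infinity>" using fin by (simp add: ennreal_mult_less_top)
  finally show False using inf by simp
qed

text \<open>The second Borel-Cantelli argument, run on Riemann sums. The conclusion is inclusion in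
  a null set, so that \<open>limit_block\<close> need not be shown to be a random variable.\<close>

lemma null_limit_block_bounded:
  assumes "bump h" and inf: "\<And>\<eta>. 0 < \<eta> \<Longrightarrow> (\<integral>\<^sup>+\<omega>. ennreal (\<bar>X (\<chi> i. 1) \<omega>\<bar> powr \<eta>) \<partial>M) = \<infinity>"
  shows "\<exists>N\<in>null_sets M. {\<omega> \<in> space M. lamp (\<lambda>t. X t \<omega>) \<and>
    (\<forall>j. \<bar>bump.limit_block h j (\<lambda>t. X t \<omega>)\<bar> < (real p + 1) * (1 + real j) ^ (p + 1))} \<subseteq> N"
proof -
  interpret bump h by fact
  define c where "c j = (real p + 1) * (1 + real j) ^ (p + 1)" for j :: nat
  let ?\<kappa> = "\<kappa> TYPE('d)"
  define W where "W m j \<omega> = block m (weight m) j (\<lambda>t. X t \<omega>)" for m j \<omega>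
  have W [measurable]: "W m j \<in> borel_measurable M" for m j
    unfolding W_def by measurable
  have one: "(\<chi> i. 1) \<in> (orthant :: (real ^ 'd) set)" by (simp add: orthant_def)
  have [measurable]: "X (\<chi> i. 1) \<in> borel_measurable M" by (rule X_measurable[OF one])
  obtain a0 where a0: "\<forall>m w j a. (\<forall>e. 0 \<le> w e) \<longrightarrow> (\<Sum>e\<in>PiE (UNIV :: 'd set) (\<lambda>_. {0..<2 ^ m}). w e) = ?\<kappa> \<longrightarrow> a0 \<le> a \<longrightarrow>
      prob {\<omega> \<in> space M. 2 * a \<le> ?\<kappa> * \<bar>X (\<chi> i. 1) \<omega>\<bar>} / 2 \<le> prob {\<omega> \<in> space M. a \<le> \<bar>block m w j (\<lambda>t. X t \<omega>)\<bar>}"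
    using block_tail[OF \<kappa>_pos[where 'd='d]] by blast
  have tail: "prob {\<omega> \<in> space M. 2 * a \<le> ?\<kappa> * \<bar>X (\<chi> i. 1) \<omega>\<bar>} / 2 \<le> prob {\<omega> \<in> space M. a \<le> \<bar>W m j \<omega>\<bar>}"
    if "a0 \<le> a" for a m j
    using a0[rule_format, OF weight_nonneg sum_weight that] by (simp only: W_def)
  obtain j0 :: nat where j0: "a0 \<le> real j0" using real_arch_simple by blast
  define q where "q j = (if j0 \<le> j then prob {\<omega> \<in> space M. 2 * c j \<le> ?\<kappa> * \<bar>X (\<chi> i. 1) \<omega>\<bar>} / 2 else 0)" for j
  have q0: "0 \<le> q j" for j by (simp add: q_def)
  have qW: "q j \<le> prob {\<omega> \<in> space M. c j \<le> \<bar>W m j \<omega>\<bar>}" for m j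
  proof (cases "j0 \<le> j")
    case True
    have "real j0 \<le> 1 + real j" using True by simp
    also have "\<dots> = 1 * (1 + real j) ^ 1" by simp
    also have "\<dots> \<le> c j"
      unfolding c_def by (intro mult_mono power_increasing) auto
    finally show ?thesis using tail[of "c j" m j] j0 True by (simp add: q_def)
  qed (simp add: q_def)
  have nsum: "\<not> summable q"
  proof
    assume "summable q"
    then have "summable (\<lambda>j. 2 * q j)" by (rule summable_mult)
    moreover have "\<forall>\<^sub>F j in sequentially. 2 * q j = prob {\<omega> \<in> space M. (2 * (real p + 1) / ?\<kappa>) * (1 + real j) ^ (p + 1) \<le> \<bar>X (\<chi> i. 1) \<omega>\<bar>}"
    proof (rule eventually_sequentiallyI[of j0])
      fix j assume "j0 \<le> j"
      have "2 * c j \<le> ?\<kappa> * x \<longleftrightarrow> (2 * (real p + 1) / ?\<kappa>) * (1 + real j) ^ (p + 1) \<le> x" for x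
      proof -
        have "(2 * (real p + 1) / ?\<kappa>) * (1 + real j) ^ (p + 1) = (2 * c j) / ?\<kappa>"
          by (simp add: c_def)
        then show ?thesis
          using \<kappa>_pos[where 'd='d] by (simp only: pos_divide_le_eq mult.commute)
      qed
      then show "2 * q j = prob {\<omega> \<in> space M. (2 * (real p + 1) / ?\<kappa>) * (1 + real j) ^ (p + 1) \<le> \<bar>X (\<chi> i. 1) \<omega>\<bar>}"
        using \<open>j0 \<le> j\<close> by (simp only: q_def if_True)
    qed
    ultimately have "summable (\<lambda>j. prob {\<omega> \<in> space M. (2 * (real p + 1) / ?\<kappa>) * (1 + real j) ^ (p + 1) \<le> \<bar>X (\<chi> i. 1) \<omega>\<bar>})"
      by (rule summable_cong[THEN iffD1, rotated])
    moreover have "0 < 2 * (real p + 1) / ?\<kappa>" using \<kappa>_pos[where 'd='d] by simp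
    ultimately show False
      using not_summable_tail[of "X (\<chi> i. 1)" "2 * (real p + 1) / ?\<kappa>" p] inf[of "1 / real (p + 1)"] by simp
  qed
  define A where "A n m = {\<omega> \<in> space M. \<forall>j\<in>{..<n}. \<bar>W m j \<omega>\<bar> < c j}" for n m
  have A [measurable]: "A n m \<in> events" for n m
    unfolding A_def by measurable
  \<comment> \<open>Independence and \<open>1 - x \<le> exp (- x)\<close> give a bound that does not
    involve the mesh \<open>m\<close>. For \<open>n = 0\<close> the intersection over
    \<open>j\<close> would not be \<open>A n m\<close>.\<close>
  have PA: "prob (A n m) \<le> exp (- (\<Sum>j<n. q j))" if "0 < n" for n m
  proof -
    have ind: "indep_vars (\<lambda>_. borel) (\<lambda>j. W m j) {..<n}"
      unfolding W_def by (rule indep_blocks_family)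
    have "A n m = (\<Inter>j\<in>{..<n}. W m j -` {x. \<bar>x\<bar> < c j} \<inter> space M)"
      using that by (auto simp: A_def)
    then have "prob (A n m) = (\<Prod>j<n. prob (W m j -` {x. \<bar>x\<bar> < c j} \<inter> space M))"
      using that by (simp only:) (rule indep_varsD_finite[OF ind], auto)
    also have "\<dots> \<le> (\<Prod>j<n. exp (- q j))"
    proof (intro prod_mono conjI)
      fix j
      have "W m j -` {x. \<bar>x\<bar> < c j} \<inter> space M = space M - {\<omega> \<in> space M. c j \<le> \<bar>W m j \<omega>\<bar>}" by auto
      then have "prob (W m j -` {x. \<bar>x\<bar> < c j} \<inter> space M) = 1 - prob {\<omega> \<in> space M. c j \<le> \<bar>W m j \<omega>\<bar>}"
        by (simp only:) (rule prob_compl, measurable)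
      also have "\<dots> \<le> 1 - q j" using qW by simp
      also have "\<dots> \<le> exp (- q j)" using exp_ge_add_one_self[of "- q j"] by simp
      finally show "prob (W m j -` {x. \<bar>x\<bar> < c j} \<inter> space M) \<le> exp (- q j)" .
    qed simp
    also have "\<dots> = exp (- (\<Sum>j<n. q j))" by (simp add: exp_sum sum_negf[symmetric])
    finally show ?thesis .
  qed
  \<comment> \<open>The limit inferior over the mesh: the first \<open>n\<close> Riemann sums are
    small from some \<open>m\<close> on. It contains every path whose limits are strictly small, and
    the bound uniform in \<open>m\<close> carries over to it.\<close>
  define L where "L n = (\<Union>k. \<Inter>m\<in>{k..}. A n m)" for n
  have inter [measurable]: "(\<Inter>m\<in>{k..}. A n m) \<in> events" for n k
    by (intro sets.countable_INT') auto
  have L [measurable]: "L n \<in> events" for n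
    unfolding L_def using inter by blast
  have PL: "prob (L n) \<le> exp (- (\<Sum>j<n. q j))" if "0 < n" for n
  proof (rule LIMSEQ_le_const2)
    show "(\<lambda>k. prob (\<Inter>m\<in>{k..}. A n m)) \<longlonglongrightarrow> prob (L n)"
      unfolding L_def by (intro finite_Lim_measure_incseq incseq_SucI) (use inter in auto)
    have "prob (\<Inter>m\<in>{k..}. A n m) \<le> prob (A n k)" for k
      by (intro finite_measure_mono) auto
    then show "\<exists>N. \<forall>k\<ge>N. prob (\<Inter>m\<in>{k..}. A n m) \<le> exp (- (\<Sum>j<n. q j))"
      using PA[OF that] by (meson order_trans)
  qed
  have "prob (\<Inter>n. L n) \<le> 0"
  proof (rule field_le_epsilon)
    fix e :: real assume e: "0 < e"
    have "\<exists>n>0. - ln e < (\<Sum>j<n. q j)"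
    proof (rule ccontr)
      assume "\<not> ?thesis"
      then have le: "(\<Sum>j<n. q j) \<le> - ln e" if "0 < n" for n using that by (meson not_less)
      have "(\<Sum>j\<le>n. q j) \<le> - ln e" for n
        using le[of "Suc n"] by (simp only: lessThan_Suc_atMost zero_less_Suc)
      then have "summable q" using q0 by (rule bounded_imp_summable[rotated])
      then show False using nsum by simp
    qed
    then obtain n where n: "0 < n" "- ln e < (\<Sum>j<n. q j)" by blast
    have "prob (\<Inter>n. L n) \<le> prob (L n)" by (intro finite_measure_mono) auto
    also have "\<dots> \<le> exp (- (\<Sum>j<n. q j))" by (rule PL[OF n(1)])
    also have "\<dots> \<le> exp (ln e)" using n(2) by simp
    finally show "prob (\<Inter>n. L n) \<le> 0 + e" using e by simp
  qed
  then have "prob (\<Inter>n. L n) = 0" using measure_nonneg by (rule order_antisym)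
  then have "(\<Inter>n. L n) \<in> null_sets M"
    by (intro null_setsI) (auto simp: emeasure_eq_measure)
  moreover have "{\<omega> \<in> space M. lamp (\<lambda>t. X t \<omega>) \<and> (\<forall>j. \<bar>limit_block j (\<lambda>t. X t \<omega>)\<bar> < c j)} \<subseteq> (\<Inter>n. L n)"
  proof (intro subsetI INT_I)
    fix \<omega> n assume \<omega>: "\<omega> \<in> {\<omega> \<in> space M. lamp (\<lambda>t. X t \<omega>) \<and> (\<forall>j. \<bar>limit_block j (\<lambda>t. X t \<omega>)\<bar> < c j)}"
    have "\<forall>\<^sub>F m in sequentially. \<forall>j\<in>{..<n}. \<bar>W m j \<omega>\<bar> < c j"
    proof (rule eventually_ball_finite, simp, rule ballI)
      fix j
      have "(\<lambda>m. W m j \<omega>) \<longlonglongrightarrow> limit_block j (\<lambda>t. X t \<omega>)"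
        unfolding W_def using \<omega> by (intro tendsto_block) auto
      then have "(\<lambda>m. \<bar>W m j \<omega>\<bar>) \<longlonglongrightarrow> \<bar>limit_block j (\<lambda>t. X t \<omega>)\<bar>" by (rule tendsto_rabs)
      then show "\<forall>\<^sub>F m in sequentially. \<bar>W m j \<omega>\<bar> < c j"
        using \<omega> by (auto dest: order_tendstoD(2))
    qed
    then obtain k where "\<And>m. k \<le> m \<Longrightarrow> \<forall>j\<in>{..<n}. \<bar>W m j \<omega>\<bar> < c j"
      by (auto simp: eventually_sequentially)
    then have "\<omega> \<in> (\<Inter>m\<in>{k..}. A n m)" using \<omega> by (auto simp: A_def)
    then show "\<omega> \<in> L n" unfolding L_def by blast
  qed
  ultimately show ?thesis unfolding c_def by blast
qed

lemma AE_not_tempered: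
  assumes inf: "\<And>\<eta>. 0 < \<eta> \<Longrightarrow> (\<integral>\<^sup>+\<omega>. ennreal (\<bar>X (\<chi> i. 1) \<omega>\<bar> powr \<eta>) \<partial>M) = \<infinity>"
  shows "AE \<omega> in M. \<omega> \<notin> tempered_event M X"
proof -
  obtain h where "derivative_sequence h" "\<And>x. 0 \<le> h 0 x" "\<And>n x. x \<notin> {0<..<1} \<Longrightarrow> h n x = 0" "0 < h 0 (1 / 2 :: real)"
    using bump_sequence by blast
  then have h: "bump h" by (intro bump.intro) auto
  then interpret bump h .
  have "AE \<omega> in M. \<forall>p :: nat. \<not> (lamp (\<lambda>t. X t \<omega>) \<and> (\<forall>j. \<bar>limit_block j (\<lambda>t. X t \<omega>)\<bar> < (real p + 1) * (1 + real j) ^ (p + 1)))"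
    unfolding AE_all_countable
  proof
    fix p :: nat
    obtain N where "N \<in> null_sets M" "{\<omega> \<in> space M. lamp (\<lambda>t. X t \<omega>) \<and>
        (\<forall>j. \<bar>limit_block j (\<lambda>t. X t \<omega>)\<bar> < (real p + 1) * (1 + real j) ^ (p + 1))} \<subseteq> N"
      using null_limit_block_bounded[OF h inf, of p] by blast
    then show "AE \<omega> in M. \<not> (lamp (\<lambda>t. X t \<omega>) \<and> (\<forall>j. \<bar>limit_block j (\<lambda>t. X t \<omega>)\<bar> < (real p + 1) * (1 + real j) ^ (p + 1)))"
      by (intro AE_I'[of N]) auto
  qed
  with AE_lamp show ?thesis
  proof eventually_elim
    case (elim \<omega>)
    show ?case
    proof
      assume "\<omega> \<in> tempered_event M X"
      then have "\<exists>p :: nat. \<forall>j. \<bar>limit_block j (\<lambda>t. X t \<omega>)\<bar> < (real p + 1) * (1 + real j) ^ (p + 1)"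
        unfolding tempered_event_def by (intro limit_block_poly_bounded elim) auto
      then show False using elim by blast
    qed
  qed
qed

end

theorem corollary3p15:
  fixes M :: "'w measure"
    and X :: "real ^ 'd \<Rightarrow> 'w \<Rightarrow> real"
    and J :: "'w \<Rightarrow> ((real ^ 'd) \<times> real) measure"
    and \<gamma> \<sigma> :: real and \<nu> :: "real measure"
  assumes "prob_space M" and "complete_measure M"
    and "levy_field M X"
    and "J = (\<lambda>\<omega>. jump_measure (\<lambda>t. X t \<omega>))"
    and "characteristic_triplet M X \<gamma> \<sigma> \<nu>"
  shows "((\<exists>\<eta>>0. (\<integral>\<^sup>+\<omega>. ennreal (\<bar>X (\<chi> i. 1) \<omega>\<bar> powr \<eta>) \<partial>M) < \<infinity>) \<longrightarrow>
            tempered_event M X \<in> sets M \<and> measure M (tempered_event M X) = 1) \<and>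
         ((\<forall>\<eta>>0. (\<integral>\<^sup>+\<omega>. ennreal (\<bar>X (\<chi> i. 1) \<omega>\<bar> powr \<eta>) \<partial>M) = \<infinity>) \<longrightarrow>
            tempered_event M X \<in> sets M \<and> measure M (tempered_event M X) = 0)"
proof -
  interpret levy_sheet M X
    using assms(1,3) by (simp add: levy_sheet_def levy_sheet_axioms_def)
  interpret complete_measure M by fact
  let ?\<Omega> = "tempered_event M X"
  have sub: "?\<Omega> \<subseteq> space M" by (auto simp: tempered_event_def)
  \<comment> \<open>An almost sure statement only encloses the complement of
    \<open>?\<Omega>\<close> (below, \<open>?\<Omega>\<close> itself) in a null set; completeness of
    \<open>M\<close> is what makes the event measurable.\<close>
  have 1: "?\<Omega> \<in> events \<and> prob ?\<Omega> = 1" if "AE \<omega> in M. \<omega> \<in> ?\<Omega>"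
  proof -
    obtain N where "{\<omega> \<in> space M. \<omega> \<notin> ?\<Omega>} \<subseteq> N" "emeasure M N = 0" "N \<in> events"
      using \<open>AE \<omega> in M. \<omega> \<in> ?\<Omega>\<close> by (rule AE_E)
    then have "{\<omega> \<in> space M. \<omega> \<notin> ?\<Omega>} \<in> events"
      using complete[of "{\<omega> \<in> space M. \<omega> \<notin> ?\<Omega>}" N] by (simp add: null_sets_def)
    then have "space M - {\<omega> \<in> space M. \<omega> \<notin> ?\<Omega>} \<in> events" by (rule sets.compl_sets)
    moreover have "space M - {\<omega> \<in> space M. \<omega> \<notin> ?\<Omega>} = ?\<Omega>" using sub by auto
    ultimately have ev: "?\<Omega> \<in> events" by simp
    show ?thesis using prob_eq_1[OF ev] that ev by simp
  qed
  have 0: "?\<Omega> \<in> events \<and> prob ?\<Omega> = 0" if "AE \<omega> in M. \<omega> \<notin> ?\<Omega>"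
  proof -
    obtain N where "{\<omega> \<in> space M. \<not> \<omega> \<notin> ?\<Omega>} \<subseteq> N" "emeasure M N = 0" "N \<in> events"
      using \<open>AE \<omega> in M. \<omega> \<notin> ?\<Omega>\<close> by (rule AE_E)
    then have ev: "?\<Omega> \<in> events"
      using complete[of ?\<Omega> N] sub by (auto simp: null_sets_def subset_iff)
    show ?thesis using prob_eq_0[OF ev] that ev by simp
  qed
  show ?thesis
    using 1 0 AE_tempered AE_not_tempered by blast
qed

end
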